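(* Let $\omega=(\omega_n)$ be an increasing sequence of algebra weights on $\mathbb R^+$ such that, for every $n\in\mathbb N$, $\omega_n(t)\to\infty$ as $t\to\infty$, $\lim_{t\to\infty}\omega_n(t)^{1/t}=1$, and $\sup_{t\in\mathbb R^+}\omega_{n+1}(t)/\omega_n(t)=\infty$. Suppose that for every $n\in\mathbb N$ there exists $m\in\mathbb N$ such that $$\frac{t\omega_n(t)}{\omega_m(t)}\to0\quad\text{as }t\to\infty,$$ and let $\mu\in B(\omega)$. Let $D_\mu f=Xf*\mu$ $(f\in A(\omega))$ and $\overline{D}_\mu\nu=X\nu*\mu$ $(\nu\in B(\omega))$. Then the following conditions are equivalent: (a) $D_{\mu}$ is a Montel derivation on $A(\omega)$. (b) $D_{\mu}$ is a weakly Montel derivation on $A(\omega)$. (c) $\mu$ is absolutely continuous (with respect to Lebesgue measure on $\mathbb R^+$). (d) $\overline{D}_{\mu}$ is a Montel derivation on $B(\omega)$. (e) $\overline{D}_{\mu}$ is a weakly Montel derivation on $B(\omega)$.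
   Context: All spaces are complex and $\mathbb R^+=[0,\infty)$. An algebra weight on $\mathbb R^+$ is a positive Borel function $w$ on $\mathbb R^+$ such that $w$ and $1/w$ are locally bounded, $w$ is right continuous, $w(t+s)\le w(t)w(s)$ for all $t,s\in\mathbb R^+$, and $w(0)=1$. For an algebra weight $w$, $L^1(w)$ is the Banach algebra (under convolution $(f*g)(t)=\int_0^tf(s)g(t-s)\,ds$) of functions $f$ on $\mathbb R^+$ with $\|f\|_w=\int_0^\infty|f(t)|w(t)\,dt<\infty$, and $M(w)$ is the Banach algebra (under convolution of measures, $\int_{\mathbb R^+} h\,d(\nu*\mu)=\int_{\mathbb R^+}\int_{\mathbb R^+}h(t+s)\,d\mu(s)\,d\nu(t)$) of locally finite complex Borel measures $\mu$ on $\mathbb R^+$ with $\|\mu\|_w=\int_{\mathbb R^+}w(t)\,d|\mu|(t)<\infty$. For a sequence $\omega=(\omega_n)$ as in the statement, $$A(\omega)=\bigcap_nL^1(\omega_n),\qquad B(\omega)=\bigcap_nM(\omega_n),$$ equipped with the increasing sequence of norms $\|\cdot\|_n=\|\cdot\|_{\omega_n}$, are Fréchet algebras under convolution; $A(\omega)\subseteq B(\omega)$ via $f\mapsto f(t)\,dt$. $X$ is multiplication by the coordinate: $(Xf)(t)=tf(t)$ for functions and $d(X\nu)(t)=t\,d\nu(t)$ for measures. Under the stated assumption it is known that $D_\mu$ and $\overline D_\mu$ are continuous derivations on $A(\omega)$ and $B(\omega)$ respectively. A linear operator between two Fréchet spaces is called Montel (respectively weakly Montel) if it maps bounded sets to relatively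 compact (respectively weakly relatively compact) sets. *)

theory Defs
  imports "HOL-Analysis.Analysis" "HOL-Library.Function_Algebras"
begin

section \<open>Operators on spaces with a sequence of seminorms\<close>

text \<open>A complex algebra, with carrier set inside an additive group, topologized by an
  increasing sequence of (semi)norms, so that balls for single seminorms form a base.\<close>

record 'a seminormed_algebra =
  space_of :: "'a set"
  scale :: "complex \<Rightarrow> 'a \<Rightarrow> 'a"
  mult :: "'a \<Rightarrow> 'a \<Rightarrow> 'a"
  snorm :: "nat \<Rightarrow> 'a \<Rightarrow> real"

definition seminorm_topology :: "'a::ab_group_add seminormed_algebra \<Rightarrow> 'a topology" where
  "seminorm_topology S = topology_generated_by
     {{y \<in> space_of S. snorm S n (y - x) < e} | n x e. x \<in> space_of S \<and> 0 < e}"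

definition linear_operator ::
    "'a::ab_group_add seminormed_algebra \<Rightarrow> 'b::ab_group_add seminormed_algebra \<Rightarrow> ('a \<Rightarrow> 'b) \<Rightarrow> bool"
  where "linear_operator S S' T \<longleftrightarrow>
     T ` space_of S \<subseteq> space_of S' \<and>
     (\<forall>x\<in>space_of S. \<forall>y\<in>space_of S. T (x + y) = T x + T y) \<and>
     (\<forall>c. \<forall>x\<in>space_of S. T (scale S c x) = scale S' c (T x))"

definition dual_space :: "'a::ab_group_add seminormed_algebra \<Rightarrow> ('a \<Rightarrow> complex) set" where
  "dual_space S = {\<phi>.
     (\<forall>x\<in>space_of S. \<forall>y\<in>space_of S. \<phi> (x + y) = \<phi> x + \<phi> y) \<and>
     (\<forall>c. \<forall>x\<in>space_of S. \<phi> (scale S c x) = c * \<phi> x) \<and>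
     continuous_map (seminorm_topology S) euclidean \<phi>}"

definition weak_topology :: "'a::ab_group_add seminormed_algebra \<Rightarrow> 'a topology" where
  "weak_topology S = topology_generated_by
     {{y \<in> space_of S. \<phi> y \<in> U} | \<phi> U. \<phi> \<in> dual_space S \<and> open U}"

definition bounded_subset :: "'a::ab_group_add seminormed_algebra \<Rightarrow> 'a set \<Rightarrow> bool" where
  "bounded_subset S C \<longleftrightarrow> C \<subseteq> space_of S \<and> (\<forall>n. \<exists>K. \<forall>x\<in>C. snorm S n x \<le> K)"

definition relatively_compact_in :: "'a topology \<Rightarrow> 'a set \<Rightarrow> bool" where
  "relatively_compact_in \<T> C \<longleftrightarrow> C \<subseteq> topspace \<T> \<and> compactin \<T> (\<T> closure_of C)"

definition Montel ::
    "'a::ab_group_add seminormed_algebra \<Rightarrow> 'b::ab_group_add seminormed_algebra \<Rightarrow> ('a \<Rightarrow> 'b) \<Rightarrow> bool"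
  where "Montel S S' T \<longleftrightarrow> linear_operator S S' T \<and>
     (\<forall>C. bounded_subset S C \<longrightarrow> relatively_compact_in (seminorm_topology S') (T ` C))"

definition weakly_Montel ::
    "'a::ab_group_add seminormed_algebra \<Rightarrow> 'b::ab_group_add seminormed_algebra \<Rightarrow> ('a \<Rightarrow> 'b) \<Rightarrow> bool"
  where "weakly_Montel S S' T \<longleftrightarrow> linear_operator S S' T \<and>
     (\<forall>C. bounded_subset S C \<longrightarrow> relatively_compact_in (weak_topology S') (T ` C))"

definition derivation :: "'a::ab_group_add seminormed_algebra \<Rightarrow> ('a \<Rightarrow> 'a) \<Rightarrow> bool" where
  "derivation S T \<longleftrightarrow> linear_operator S S T \<and>
     (\<forall>x\<in>space_of S. \<forall>y\<in>space_of S. T (mult S x y) = mult S (T x) y + mult S x (T y))"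

definition Montel_derivation :: "'a::ab_group_add seminormed_algebra \<Rightarrow> ('a \<Rightarrow> 'a) \<Rightarrow> bool" where
  "Montel_derivation S T \<longleftrightarrow> derivation S T \<and> Montel S S T"

definition weakly_Montel_derivation ::
    "'a::ab_group_add seminormed_algebra \<Rightarrow> ('a \<Rightarrow> 'a) \<Rightarrow> bool" where
  "weakly_Montel_derivation S T \<longleftrightarrow> derivation S T \<and> weakly_Montel S S T"


section \<open>Algebra weights\<close>

abbreviation borel_plus :: "real measure" where
  "borel_plus \<equiv> restrict_space borel {0..}"

abbreviation lborel_plus :: "real measure" where
  "lborel_plus \<equiv> restrict_space lborel {0..}"

definition algebra_weight :: "(real \<Rightarrow> real) \<Rightarrow> bool" where
  "algebra_weight w \<longleftrightarrow>
     w \<in> borel_measurable borel_plus \<and>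
     (\<forall>t\<ge>0. 0 < w t) \<and>
     (\<forall>b. bounded (w ` {0..b})) \<and>
     (\<forall>b. bounded ((\<lambda>t. 1 / w t) ` {0..b})) \<and>
     (\<forall>t\<ge>0. continuous (at_right t) w) \<and>
     (\<forall>t\<ge>0. \<forall>s\<ge>0. w (t + s) \<le> w t * w s) \<and>
     w 0 = 1"


section \<open>Locally finite complex measures\<close>

definition bounded_borel :: "real set set" where
  "bounded_borel = {E \<in> sets borel_plus. bounded E}"

text \<open>A locally finite complex measure need not have a value on unbounded sets, so it is a
  countably additive function on the bounded Borel subsets of the half-line; it is set to 0
  elsewhere to make the representation unique.\<close>

definition locally_finite_measure :: "(real set \<Rightarrow> complex) \<Rightarrow> bool" where
  "locally_finite_measure \<mu> \<longleftrightarrow>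
     (\<forall>E. E \<notin> bounded_borel \<longrightarrow> \<mu> E = 0) \<and>
     (\<forall>E::nat \<Rightarrow> real set. range E \<subseteq> bounded_borel \<longrightarrow> disjoint_family E \<longrightarrow>
        (\<Union>i. E i) \<in> bounded_borel \<longrightarrow> (\<lambda>i. \<mu> (E i)) sums \<mu> (\<Union>i. E i))"

text \<open>The total variation \<open>|\<mu>|\<close>, a positive measure on all Borel subsets of the half-line.
  For locally finite \<open>\<mu>\<close> the set function below is countably additive, so it is the
  measure produced by \<^const>\<open>measure_of\<close>; likewise for \<open>positive_variation\<close>.\<close>

definition total_variation :: "(real set \<Rightarrow> complex) \<Rightarrow> real measure" where
  "total_variation \<mu> = measure_of {0..} (sets borel_plus)
     (\<lambda>E. SUP P \<in> {P. finite P \<and> P \<subseteq> bounded_borel \<and> disjoint P \<and> \<Union>P \<subseteq> E}.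
        \<Sum>F\<in>P. ennreal (cmod (\<mu> F)))"

text \<open>The positive part of the Jordan decomposition of a real set function \<open>u\<close>: the value at
  \<open>E\<close> is the supremum of \<open>u F\<close> over \<open>F \<subseteq> E\<close>. Truncation of negative
  values by \<^const>\<open>ennreal\<close> is harmless since \<open>u {} = 0\<close>.\<close>

definition positive_variation :: "(real set \<Rightarrow> real) \<Rightarrow> real measure" where
  "positive_variation u = measure_of {0..} (sets borel_plus)
     (\<lambda>E. SUP F \<in> {F \<in> bounded_borel. F \<subseteq> E}. ennreal (u F))"

text \<open>The integral \<open>\<integral> h d\<mu>\<close>, by Jordan decomposition of real and imaginary part.\<close>

definition measure_integral :: "(real set \<Rightarrow> complex) \<Rightarrow> (real \<Rightarrow> complex) \<Rightarrow> complex" where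
  "measure_integral \<mu> h =
     (LINT t|positive_variation (\<lambda>E. Re (\<mu> E)). h t)
     - (LINT t|positive_variation (\<lambda>E. - Re (\<mu> E)). h t)
     + \<i> * ((LINT t|positive_variation (\<lambda>E. Im (\<mu> E)). h t)
            - (LINT t|positive_variation (\<lambda>E. - Im (\<mu> E)). h t))"

text \<open>The defining formula of the convolution product, taken at \<open>h = indicator E\<close>.\<close>

definition measure_conv ::
    "(real set \<Rightarrow> complex) \<Rightarrow> (real set \<Rightarrow> complex) \<Rightarrow> (real set \<Rightarrow> complex)" where
  "measure_conv \<nu> \<mu> = (\<lambda>E. if E \<in> bounded_borel
     then measure_integral \<nu> (\<lambda>t. measure_integral \<mu> (\<lambda>s. indicator E (t + s))) else 0)"

definition measure_X :: "(real set \<Rightarrow> complex) \<Rightarrow> (real set \<Rightarrow> complex)" where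
  "measure_X \<nu> = (\<lambda>E. if E \<in> bounded_borel
     then measure_integral \<nu> (\<lambda>t. indicator E t * complex_of_real t) else 0)"

definition measure_norm :: "(real \<Rightarrow> real) \<Rightarrow> (real set \<Rightarrow> complex) \<Rightarrow> ennreal" where
  "measure_norm w \<mu> = (\<integral>\<^sup>+ t. ennreal (w t) \<partial>total_variation \<mu>)"

definition M_space :: "(real \<Rightarrow> real) \<Rightarrow> (real set \<Rightarrow> complex) set" where
  "M_space w = {\<mu>. locally_finite_measure \<mu> \<and> measure_norm w \<mu> < \<infinity>}"

definition abs_continuous :: "(real set \<Rightarrow> complex) \<Rightarrow> bool" where
  "abs_continuous \<mu> \<longleftrightarrow> (\<forall>E\<in>bounded_borel. emeasure lborel E = 0 \<longrightarrow> \<mu> E = 0)"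


section \<open>Functions on the half-line, modulo null sets\<close>

definition ae_equal :: "(real \<Rightarrow> complex) \<Rightarrow> (real \<Rightarrow> complex) \<Rightarrow> bool" where
  "ae_equal f g \<longleftrightarrow> f \<in> borel_measurable borel_plus \<and> g \<in> borel_measurable borel_plus \<and>
     (AE t in lborel_plus. f t = g t)"

quotient_type ae_fun = "real \<Rightarrow> complex" / partial: ae_equal
proof (rule part_equivpI)
  show "\<exists>f. ae_equal f f" by (rule exI[of _ "\<lambda>_. 0"]) (simp add: ae_equal_def)
  show "symp ae_equal" by (auto simp: symp_def ae_equal_def elim: AE_mp)
  show "transp ae_equal" unfolding transp_def ae_equal_def
    by (auto elim: eventually_elim2)
qed

instantiation ae_fun :: ab_group_add
begin

lift_definition zero_ae_fun :: ae_fun is "\<lambda>_. 0"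
  by (simp add: ae_equal_def)

lift_definition plus_ae_fun :: "ae_fun \<Rightarrow> ae_fun \<Rightarrow> ae_fun" is "\<lambda>f g t. f t + g t"
  unfolding ae_equal_def by (auto elim: eventually_elim2)

lift_definition minus_ae_fun :: "ae_fun \<Rightarrow> ae_fun \<Rightarrow> ae_fun" is "\<lambda>f g t. f t - g t"
  unfolding ae_equal_def by (auto elim: eventually_elim2)

lift_definition uminus_ae_fun :: "ae_fun \<Rightarrow> ae_fun" is "\<lambda>f t. - f t"
  unfolding ae_equal_def by (auto elim: eventually_mono)

instance
  by standard (transfer; auto simp: ae_equal_def algebra_simps)+

end

lift_definition fun_scale :: "complex \<Rightarrow> ae_fun \<Rightarrow> ae_fun" is "\<lambda>c f t. c * f t"
  unfolding ae_equal_def by (auto elim: eventually_mono)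

lift_definition fun_X :: "ae_fun \<Rightarrow> ae_fun" is "\<lambda>f t. complex_of_real t * f t"
proof -
  fix f g assume "ae_equal f g"
  moreover have "complex_of_real \<in> borel_measurable borel_plus"
    by (rule measurable_restrict_space1) simp
  ultimately show "ae_equal (\<lambda>t. complex_of_real t * f t) (\<lambda>t. complex_of_real t * g t)"
    unfolding ae_equal_def by (auto elim: eventually_mono)
qed

lemma zero_extension_measurable:
  fixes f :: "real \<Rightarrow> complex"
  shows "f \<in> borel_measurable borel_plus \<Longrightarrow> (\<lambda>s. indicator {0..} s *\<^sub>R f s) \<in> borel_measurable borel"
  by (simp add: borel_measurable_restrict_space_iff)

lemma fun_conv_zero_extension:
  fixes f g :: "real \<Rightarrow> complex"
  shows "set_lebesgue_integral lborel {0..t} (\<lambda>s. f s * g (t - s)) =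
    (LINT s|lborel. (indicator {0..} s *\<^sub>R f s) * (indicator {0..} (t - s) *\<^sub>R g (t - s)))"
  unfolding set_lebesgue_integral_def
  by (intro Bochner_Integration.integral_cong) (auto simp: indicator_def)

lemma fun_conv_measurable:
  fixes f g :: "real \<Rightarrow> complex"
  assumes f: "f \<in> borel_measurable borel_plus" and g: "g \<in> borel_measurable borel_plus"
  shows "(\<lambda>t. set_lebesgue_integral lborel {0..t} (\<lambda>s. f s * g (t - s))) \<in> borel_measurable borel"
proof -
  have "(\<lambda>t. LINT s|lborel. F s * G (t - s)) \<in> borel_measurable borel"
    if [measurable]: "F \<in> borel_measurable borel" "G \<in> borel_measurable borel"
    for F G :: "real \<Rightarrow> complex"
    by measurable
  from this[OF f[THEN zero_extension_measurable] g[THEN zero_extension_measurable]]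
  show ?thesis
    unfolding fun_conv_zero_extension .
qed

lemma fun_conv_cong:
  assumes "ae_equal f f'" and "ae_equal g g'"
  shows "set_lebesgue_integral lborel {0..t} (\<lambda>s. f s * g (t - s)) =
         set_lebesgue_integral lborel {0..t} (\<lambda>s. f' s * g' (t - s))"
proof -
  have cong: "(LINT s|lborel. F s * G (t - s)) = (LINT s|lborel. F' s * G' (t - s))"
    if [measurable]: "F \<in> borel_measurable borel" "F' \<in> borel_measurable borel"
        "G \<in> borel_measurable borel" "G' \<in> borel_measurable borel"
      and F: "AE s in lborel. F s = F' s" and G: "AE s in lborel. G s = G' s"
    for F F' G G' :: "real \<Rightarrow> complex"
  proof (rule integral_cong_AE)
    have "AE s in lborel. G (t + (-1) * s) = G' (t + (-1) * s)"
      by (rule AE_borel_affine[OF _ _ G]) (simp, measurable)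
    with F show "AE s in lborel. F s * G (t - s) = F' s * G' (t - s)"
      by eventually_elim simp
  qed measurable
  have ext: "AE s in lborel. indicator {0..} s *\<^sub>R h s = indicator {0..} s *\<^sub>R h' s"
    if "ae_equal h h'" for h h'
    using that by (auto simp: ae_equal_def AE_restrict_space_iff indicator_def elim: eventually_mono)
  show ?thesis
    unfolding fun_conv_zero_extension
    by (rule cong) (use assms in \<open>auto simp only: ae_equal_def intro: zero_extension_measurable
      ext[unfolded ae_equal_def]\<close>)
qed

lift_definition fun_conv :: "ae_fun \<Rightarrow> ae_fun \<Rightarrow> ae_fun" is
  "\<lambda>f g t. set_lebesgue_integral lborel {0..t} (\<lambda>s. f s * g (t - s))"
proof -
  fix f f' g g' assume fg: "ae_equal f f'" "ae_equal g g'"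
  then show "ae_equal (\<lambda>t. set_lebesgue_integral lborel {0..t} (\<lambda>s. f s * g (t - s)))
                   (\<lambda>t. set_lebesgue_integral lborel {0..t} (\<lambda>s. f' s * g' (t - s)))"
    unfolding fun_conv_cong[OF fg]
    by (auto simp: ae_equal_def intro!: measurable_restrict_space1 fun_conv_measurable)
qed

lift_definition fun_norm :: "(real \<Rightarrow> real) \<Rightarrow> ae_fun \<Rightarrow> ennreal" is
  "\<lambda>w f. \<integral>\<^sup>+ t. ennreal (cmod (f t) * w t) \<partial>lborel_plus"
  unfolding ae_equal_def by (auto intro!: nn_integral_cong_AE elim: eventually_mono)

lift_definition fun_measure :: "ae_fun \<Rightarrow> (real set \<Rightarrow> complex)" is
  "\<lambda>f E. if E \<in> bounded_borel then set_lebesgue_integral lborel_plus E f else 0"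
proof -
  fix f g assume fg: "ae_equal f g"
  have "set_lebesgue_integral lborel_plus E f = set_lebesgue_integral lborel_plus E g"
    if "E \<in> bounded_borel" for E
  proof (rule set_lebesgue_integral_cong_AE)
    show "AE x\<in>E in lborel_plus. f x = g x"
      using fg by (auto simp: ae_equal_def elim: eventually_mono)
  qed (use fg that in \<open>auto simp: ae_equal_def bounded_borel_def\<close>)
  then show "(\<lambda>E. if E \<in> bounded_borel then set_lebesgue_integral lborel_plus E f else 0) =
             (\<lambda>E. if E \<in> bounded_borel then set_lebesgue_integral lborel_plus E g else 0)"
    by auto
qed

definition L1_space :: "(real \<Rightarrow> real) \<Rightarrow> ae_fun set" where
  "L1_space w = {f. fun_norm w f < \<infinity>}"


section \<open>The algebras and the derivations\<close>

definition A_algebra :: "(nat \<Rightarrow> real \<Rightarrow> real) \<Rightarrow> ae_fun seminormed_algebra" where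
  "A_algebra \<omega> = \<lparr>space_of = (\<Inter>n. L1_space (\<omega> n)), scale = fun_scale, mult = fun_conv,
     snorm = (\<lambda>n f. enn2real (fun_norm (\<omega> n) f))\<rparr>"

definition B_algebra :: "(nat \<Rightarrow> real \<Rightarrow> real) \<Rightarrow> (real set \<Rightarrow> complex) seminormed_algebra" where
  "B_algebra \<omega> = \<lparr>space_of = (\<Inter>n. M_space (\<omega> n)), scale = (\<lambda>c \<nu> E. c * \<nu> E),
     mult = measure_conv, snorm = (\<lambda>n \<nu>. enn2real (measure_norm (\<omega> n) \<nu>))\<rparr>"

text \<open>The convolution of a function with a measure is taken in \<open>B(\<omega>)\<close>, via the embedding
  \<^const>\<open>fun_measure\<close> of \<open>A(\<omega>)\<close>; it lies in (the image of) the ideal \<open>A(\<omega>)\<close>.\<close>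

definition D_op :: "(nat \<Rightarrow> real \<Rightarrow> real) \<Rightarrow> (real set \<Rightarrow> complex) \<Rightarrow> ae_fun \<Rightarrow> ae_fun" where
  "D_op \<omega> \<mu> f = (THE g. g \<in> space_of (A_algebra \<omega>) \<and>
     fun_measure g = measure_conv (fun_measure (fun_X f)) \<mu>)"

definition D_bar :: "(real set \<Rightarrow> complex) \<Rightarrow> (real set \<Rightarrow> complex) \<Rightarrow> (real set \<Rightarrow> complex)" where
  "D_bar \<mu> \<nu> = measure_conv (measure_X \<nu>) \<mu>"

end

theory Submission
  imports Defs
begin

text \<open>
  Absolute continuity implies compactness: if \<open>\<mu>\<close> has density \<open>g\<close>, then \<open>X\<nu> * \<mu>\<close> is the integral of the
  translates \<open>\<tau>\<^sub>t g\<close> with respect to \<open>t d\<nu>(t)\<close>. The condition on the weights makes these measures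
  uniformly small near infinity when \<open>\<nu>\<close> runs through a bounded set, and \<open>t \<mapsto> \<tau>\<^sub>t g\<close> is continuous in
  mean, so the integral is uniformly approximated by sums over a finite grid with bounded
  coefficients. Hence the image is totally bounded in every norm of the Frechet space \<open>A(\<omega>)\<close>.

  Weak compactness implies absolute continuity: apply the operator to a bounded approximation
  \<open>f\<^sub>k\<close> of the point mass at 1. A weak cluster point of the images can only be the translate of \<open>\<mu>\<close> by 1,
  because the values on the intervals \<open>[0, x)\<close> converge. The images are absolutely continuous, and
  absolute continuity is preserved since evaluation at a bounded null set is a continuous
  functional.

  The calculus of complex measures rests on writing \<open>\<nu>(E) = \<integral> 1\<^sub>E(T) H dM\<close> for some measure \<open>M\<close>,
  map \<open>T\<close> and integrable \<open>H\<close>: convolution then becomes the tensor product of such data, with no need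
  to compute densities of images.
\<close>

section \<open>Topologies defined by seminorms\<close>

text \<open>The approximated point mass sits at 1 because X annihilates the point mass at 0, and the
  approximants carry a factor 1/t so that X turns them into normalised indicators. They approach 1
  from the right: then the images converge on every interval \<open>{0..<x}\<close>, even if \<mu>
  has an atom at its endpoint \<open>x - 1\<close>, and such intervals already determine a measure.
  Since every weight is bounded away from 0, all elements of B(\<omega>) have finite total
  variation, so convolution reduces to Fubini with integrable densities although the measures have
  values only on bounded sets. Smallness near infinity costs a change of norm: the n-th norm of the
  tail of X\<nu> is compared with the m-th norm of \<nu>, so total boundedness in one norm rests on
  boundedness in several. For the operator on B(\<omega>) compactness is also proved in A(\<omega>),
  where the images have their densities, and is then carried along the continuous embedding.\<close>

locale seminormed_group =
  fixes S :: "'a::ab_group_add seminormed_algebra"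
  assumes zero_mem: "0 \<in> space_of S"
    and add_mem: "x \<in> space_of S \<Longrightarrow> y \<in> space_of S \<Longrightarrow> x + y \<in> space_of S"
    and minus_mem: "x \<in> space_of S \<Longrightarrow> - x \<in> space_of S"
    and snorm_zero: "snorm S n 0 = 0"
    and snorm_triangle: "x \<in> space_of S \<Longrightarrow> y \<in> space_of S \<Longrightarrow>
          snorm S n (x + y) \<le> snorm S n x + snorm S n y"
    and snorm_minus: "x \<in> space_of S \<Longrightarrow> snorm S n (- x) = snorm S n x"
    and snorm_Suc: "x \<in> space_of S \<Longrightarrow> snorm S n x \<le> snorm S (Suc n) x"
begin

lemma diff_mem: "x \<in> space_of S \<Longrightarrow> y \<in> space_of S \<Longrightarrow> x - y \<in> space_of S"
  using add_mem[of x "- y"] minus_mem[of y] by simp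

text \<open>The triangle inequality for \<open>x\<close> and \<open>- x\<close>, whose sum has
  seminorm 0, bounds twice the seminorm of \<open>x\<close> from below.\<close>

lemma snorm_nonneg: "x \<in> space_of S \<Longrightarrow> 0 \<le> snorm S n x"
  using snorm_triangle[of x "- x" n] minus_mem[of x] snorm_minus[of x n] snorm_zero[of n] by simp

lemma snorm_mono: "x \<in> space_of S \<Longrightarrow> m \<le> n \<Longrightarrow> snorm S m x \<le> snorm S n x"
  by (rule lift_Suc_mono_le[of "\<lambda>n. snorm S n x"]) (auto intro: snorm_Suc)

lemma snorm_diff_commute:
  "x \<in> space_of S \<Longrightarrow> y \<in> space_of S \<Longrightarrow> snorm S n (x - y) = snorm S n (y - x)"
  using snorm_minus[of "y - x" n] diff_mem[of y x] by simp

lemma snorm_diff_triangle: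
  assumes "x \<in> space_of S" "y \<in> space_of S" "z \<in> space_of S"
  shows "snorm S n (x - z) \<le> snorm S n (x - y) + snorm S n (y - z)"
  using snorm_triangle[of "x - y" "y - z" n] assms by (simp add: diff_mem)

definition snball :: "nat \<Rightarrow> 'a \<Rightarrow> real \<Rightarrow> 'a set" where
  "snball n x e = {y \<in> space_of S. snorm S n (y - x) < e}"

lemma snball_mem: "x \<in> space_of S \<Longrightarrow> 0 < e \<Longrightarrow> x \<in> snball n x e"
  by (simp add: snball_def snorm_zero)

lemma openin_snball:
  "x \<in> space_of S \<Longrightarrow> 0 < e \<Longrightarrow> openin (seminorm_topology S) (snball n x e)"
  unfolding seminorm_topology_def snball_def by (rule topology_generated_by_Basis) blast

lemma topspace_seminorm: "topspace (seminorm_topology S) = space_of S"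
proof -
  have "x \<in> topspace (seminorm_topology S)" if "x \<in> space_of S" for x
    using openin_subset[OF openin_snball[OF that, of 1 0]] snball_mem[OF that, of 1 0] by auto
  then show ?thesis
    unfolding seminorm_topology_def topology_generated_by_topspace by blast
qed

text \<open>The generating sets are balls with arbitrary centres and indices. Because the seminorms
  increase, two balls about the same point contain a ball for the larger index, so a neighbourhood
  of a point can always be tested by a single ball about it.\<close>

lemma openin_seminorm_iff:
  "openin (seminorm_topology S) U \<longleftrightarrow>
     U \<subseteq> space_of S \<and> (\<forall>x\<in>U. \<exists>n e. 0 < e \<and> snball n x e \<subseteq> U)"
proof
  assume U: "openin (seminorm_topology S) U"
  have "\<forall>x\<in>U. \<exists>n e. 0 < e \<and> snball n x e \<subseteq> U"
    using U unfolding seminorm_topology_def openin_topology_generated_by_iff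
  proof induction
    case (Int a b)
    show ?case
    proof
      fix x assume x: "x \<in> a \<inter> b"
      from x Int.IH obtain n1 e1 n2 e2 where *: "0 < e1" "snball n1 x e1 \<subseteq> a" "0 < e2" "snball n2 x e2 \<subseteq> b"
        by blast
      have xS: "x \<in> space_of S"
        using topology_generated_by_topspace[of "{{y \<in> space_of S. snorm S n (y - z) < e} |n z e. z \<in> space_of S \<and> 0 < e}"]
          openin_subset[of "seminorm_topology S" a] Int.hyps x
        unfolding seminorm_topology_def openin_topology_generated_by_iff by fastforce
      have "snball (max n1 n2) x (min e1 e2) \<subseteq> snball n1 x e1 \<inter> snball n2 x e2"
        using snorm_mono[OF diff_mem[OF _ xS], of _ n1 "max n1 n2"] snorm_mono[OF diff_mem[OF _ xS], of _ n2 "max n1 n2"]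
        by (force simp: snball_def)
      with * show "\<exists>n e. 0 < e \<and> snball n x e \<subseteq> a \<inter> b"
        by (intro exI[of _ "max n1 n2"] exI[of _ "min e1 e2"]) auto
    qed
  next
    case (UN K)
    then show ?case by (meson Union_iff Union_upper order_trans)
  next
    case (Basis s)
    then obtain n z e where s: "s = snball n z e" and z: "z \<in> space_of S" "0 < e"
      by (auto simp: snball_def)
    show ?case
    proof
      fix x assume x: "x \<in> s"
      then have xS: "x \<in> space_of S" and lt: "snorm S n (x - z) < e" by (auto simp: s snball_def)
      have "snball n x (e - snorm S n (x - z)) \<subseteq> s"
        using snorm_diff_triangle[OF _ xS z(1), of _ n] by (force simp: s snball_def)
      with lt show "\<exists>n e. 0 < e \<and> snball n x e \<subseteq> s"
        by (intro exI[of _ n] exI[of _ "e - snorm S n (x - z)"]) auto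
    qed
  qed simp
  with openin_subset[OF U] show "U \<subseteq> space_of S \<and> (\<forall>x\<in>U. \<exists>n e. 0 < e \<and> snball n x e \<subseteq> U)"
    by (simp add: topspace_seminorm)
next
  assume *: "U \<subseteq> space_of S \<and> (\<forall>x\<in>U. \<exists>n e. 0 < e \<and> snball n x e \<subseteq> U)"
  show "openin (seminorm_topology S) U"
  proof (subst openin_subopen, safe)
    fix x assume x: "x \<in> U"
    with * obtain n e where "0 < e" "snball n x e \<subseteq> U" by blast
    with x * show "\<exists>T. openin (seminorm_topology S) T \<and> x \<in> T \<and> T \<subseteq> U"
      by (intro exI[of _ "snball n x e"]) (auto intro: openin_snball snball_mem)
  qed
qed

text \<open>Total boundedness for one seminorm at a time. The centres may lie outside
  \<open>C\<close>, which makes the property pass to subsets.\<close>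

definition precompact_in :: "nat \<Rightarrow> 'a set \<Rightarrow> bool" where
  "precompact_in n C \<longleftrightarrow> (\<forall>e>0. \<exists>F. finite F \<and> F \<subseteq> space_of S \<and> C \<subseteq> (\<Union>x\<in>F. snball n x e))"

lemma precompact_inD:
  "precompact_in n C \<Longrightarrow> 0 < e \<Longrightarrow> \<exists>F. finite F \<and> F \<subseteq> space_of S \<and> C \<subseteq> (\<Union>x\<in>F. snball n x e)"
  by (simp add: precompact_in_def)

text \<open>The classical argument that complete and totally bounded sets are compact, run directly
  on the sequence of seminorms. If an open cover of the closure had no finite subcover, one could
  pick nested sets without finite subcover that shrink in every seminorm. Points chosen in them form
  a Cauchy sequence, and the member of the cover containing its limit swallows one of these
  sets.\<close>

lemma relatively_compact_seminormI:
  assumes complete: "\<And>\<sigma>. range \<sigma> \<subseteq> space_of S \<Longrightarrow>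
      (\<And>n e. 0 < e \<Longrightarrow> \<exists>N. \<forall>i\<ge>N. \<forall>j\<ge>N. snorm S n (\<sigma> i - \<sigma> j) < e) \<Longrightarrow>
      \<exists>x\<in>space_of S. \<forall>n. (\<lambda>i. snorm S n (\<sigma> i - x)) \<longlonglongrightarrow> 0"
    and C: "C \<subseteq> space_of S" and precompact: "\<And>n. precompact_in n C"
  shows "relatively_compact_in (seminorm_topology S) C"
proof -
  let ?T = "seminorm_topology S"
  define K where "K = ?T closure_of C"
  have KS: "K \<subseteq> space_of S"
    unfolding K_def using closure_of_subset_topspace[of ?T C] by (simp add: topspace_seminorm)
  \<comment> \<open>Every point of the closure has a point of \<open>C\<close> within e/2, so
    doubling the radius of a net for \<open>C\<close> covers the closure.\<close>
  have cover: "\<exists>F. finite F \<and> F \<subseteq> space_of S \<and> K \<subseteq> (\<Union>x\<in>F. snball n x e)" if e: "0 < e" for n e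
  proof -
    obtain F where F: "finite F" "F \<subseteq> space_of S" "C \<subseteq> (\<Union>x\<in>F. snball n x (e/2))"
      using precompact_inD[OF precompact half_gt_zero[OF e], of n] by blast
    have "K \<subseteq> (\<Union>x\<in>F. snball n x e)"
    proof
      fix y assume y: "y \<in> K"
      with KS have yS: "y \<in> space_of S" by auto
      have "\<exists>c\<in>C. c \<in> snball n y (e/2)"
        using y openin_snball[OF yS half_gt_zero[OF e], of n] snball_mem[OF yS half_gt_zero[OF e], of n]
        unfolding K_def in_closure_of by blast
      then obtain c x where cx: "c \<in> snball n y (e/2)" "x \<in> F" "c \<in> snball n x (e/2)"
        using F(3) by blast
      then have "snorm S n (y - x) < e"
        using snorm_diff_triangle[OF yS _ , of c x n] F(2) snorm_diff_commute[OF yS, of c n]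
        by (auto simp: snball_def)
      with cx yS show "y \<in> (\<Union>x\<in>F. snball n x e)" by (auto simp: snball_def)
    qed
    with F show ?thesis by blast
  qed
  have "compactin ?T K"
    unfolding compactin_def
  proof (intro conjI allI impI)
    show "K \<subseteq> topspace ?T" by (simp add: KS topspace_seminorm)
    fix \<U> assume \<U>: "(\<forall>U\<in>\<U>. openin ?T U) \<and> K \<subseteq> \<Union> \<U>"
    show "\<exists>\<F>. finite \<F> \<and> \<F> \<subseteq> \<U> \<and> K \<subseteq> \<Union> \<F>"
    proof (rule ccontr)
      assume contr: "\<nexists>\<F>. finite \<F> \<and> \<F> \<subseteq> \<U> \<and> K \<subseteq> \<Union> \<F>"
      define bad where "bad B \<longleftrightarrow> B \<subseteq> K \<and> (\<nexists>\<F>. finite \<F> \<and> \<F> \<subseteq> \<U> \<and> B \<subseteq> \<Union> \<F>)" for B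
      have step: "\<exists>B'. bad B' \<and> B' \<subseteq> B \<and> (\<forall>x\<in>B'. \<forall>y\<in>B'. snorm S n (x - y) < 1 / real (Suc n))"
        if "bad B" for B n
      proof (rule ccontr)
        assume no: "\<not> ?thesis"
        define e where "e = 1 / real (Suc n) / 2"
        have e: "0 < e" "e + e = 1 / real (Suc n)" by (simp add: e_def, simp only: e_def field_sum_of_halves)
        obtain F where F: "finite F" "F \<subseteq> space_of S" "K \<subseteq> (\<Union>x\<in>F. snball n x e)"
          using cover[OF e(1), of n] by blast
        have "\<exists>\<F>. finite \<F> \<and> \<F> \<subseteq> \<U> \<and> B \<inter> snball n x e \<subseteq> \<Union>\<F>" if x: "x \<in> F" for x
        proof -
          have xS: "x \<in> space_of S" using x F by auto
          have "snorm S n (y - z) < 1 / real (Suc n)" if "y \<in> B \<inter> snball n x e" "z \<in> B \<inter> snball n x e" for y z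
            using that snorm_diff_triangle[OF _ xS, of y z n] snorm_diff_commute[OF xS, of z n]
            unfolding e(2)[symmetric] by (auto simp: snball_def)
          then have "\<not> bad (B \<inter> snball n x e)" using no by blast
          with \<open>bad B\<close> show ?thesis unfolding bad_def by blast
        qed
        then have "\<forall>x\<in>F. \<exists>\<F>. finite \<F> \<and> \<F> \<subseteq> \<U> \<and> B \<inter> snball n x e \<subseteq> \<Union>\<F>" by (rule ballI)
        from bchoice[OF this] obtain f
          where f: "\<forall>x\<in>F. finite (f x) \<and> f x \<subseteq> \<U> \<and> B \<inter> snball n x e \<subseteq> \<Union>(f x)" by (elim exE)
        have "B \<subseteq> \<Union>(\<Union>x\<in>F. f x)"
        proof
          fix y assume y: "y \<in> B"
          with \<open>bad B\<close> have "y \<in> K" unfolding bad_def by (elim conjE subsetD)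
          with F(3) have "y \<in> (\<Union>x\<in>F. snball n x e)" by (rule subsetD)
          then obtain x where x: "x \<in> F" "y \<in> snball n x e" by (rule UN_E)
          have "y \<in> \<Union>(f x)" using f[rule_format, OF x(1)] x(2) y by (elim conjE) (rule subsetD, assumption, rule IntI)
          with x(1) show "y \<in> \<Union>(\<Union>x\<in>F. f x)" by auto
        qed
        moreover have "finite (\<Union>x\<in>F. f x)" "(\<Union>x\<in>F. f x) \<subseteq> \<U>" using f F(1) by auto
        ultimately have "\<exists>\<F>. finite \<F> \<and> \<F> \<subseteq> \<U> \<and> B \<subseteq> \<Union>\<F>" by (intro exI conjI)
        with \<open>bad B\<close> show False unfolding bad_def by blast
      qed
      have "\<exists>B. \<forall>n. (bad (B n)) \<and> (B (Suc n) \<subseteq> B n \<and>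
          (\<forall>x\<in>B (Suc n). \<forall>y\<in>B (Suc n). snorm S n (x - y) < 1 / real (Suc n)))"
        by (rule dependent_nat_choice[of "\<lambda>_ B. bad B"
            "\<lambda>n B B'. B' \<subseteq> B \<and> (\<forall>x\<in>B'. \<forall>y\<in>B'. snorm S n (x - y) < 1 / real (Suc n))"])
          (use step contr in \<open>auto simp: bad_def\<close>)
      then obtain B where B: "\<And>n. bad (B n)" "\<And>n. B (Suc n) \<subseteq> B n"
        "\<And>n x y. x \<in> B (Suc n) \<Longrightarrow> y \<in> B (Suc n) \<Longrightarrow> snorm S n (x - y) < 1 / real (Suc n)"
        by blast
      have anti: "B n \<subseteq> B m" if "m \<le> n" for m n
        using that by (induction rule: dec_induct) (use B(2) in blast)+
      have "B n \<noteq> {}" for n using B(1)[of n] unfolding bad_def by (metis empty_subsetI finite.emptyI)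
      then obtain \<sigma> where "\<forall>n. \<sigma> n \<in> B n" using choice[of "\<lambda>n x. x \<in> B n"] by blast
      then have \<sigma>: "\<sigma> n \<in> B n" for n by blast
      have BS: "B n \<subseteq> space_of S" for n using B(1)[of n] KS unfolding bad_def by auto
      have small: "snorm S n (x - y) < 1 / real (Suc p)" if "n \<le> p" "x \<in> B (Suc p)" "y \<in> B (Suc p)" for n p x y
        using snorm_mono[OF diff_mem[of x y] that(1)] B(3)[OF that(2,3)] that BS by (meson le_less_trans subsetD)
      have "\<exists>x\<in>space_of S. \<forall>n. (\<lambda>i. snorm S n (\<sigma> i - x)) \<longlonglongrightarrow> 0"
      proof (rule complete)
        show "range \<sigma> \<subseteq> space_of S" using \<sigma> BS by blast
        fix n and e :: real assume "0 < e"
        then obtain p0 where p0: "1 / real (Suc p0) < e"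
          using nat_approx_posE by blast
        let ?p = "max n p0"
        have "1 / real (Suc ?p) \<le> 1 / real (Suc p0)" by (simp add: frac_le)
        with p0 have lt: "1 / real (Suc ?p) < e" by (rule order.strict_trans1[rotated])
        have "snorm S n (\<sigma> i - \<sigma> j) < e" if "i \<ge> Suc ?p" "j \<ge> Suc ?p" for i j
          using small[of n ?p "\<sigma> i" "\<sigma> j"] \<sigma>[of i] \<sigma>[of j] anti[OF that(1)] anti[OF that(2)] lt
          by (auto intro: less_trans)
        then have "\<forall>i\<ge>Suc ?p. \<forall>j\<ge>Suc ?p. snorm S n (\<sigma> i - \<sigma> j) < e"
          by blast
        then show "\<exists>N. \<forall>i\<ge>N. \<forall>j\<ge>N. snorm S n (\<sigma> i - \<sigma> j) < e" by blast
      qed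
      then obtain x where x: "x \<in> space_of S" and lim: "\<And>n. (\<lambda>i. snorm S n (\<sigma> i - x)) \<longlonglongrightarrow> 0" by blast
      have "x \<in> ?T closure_of K"
        unfolding in_closure_of
      proof (intro conjI allI impI)
        show "x \<in> topspace ?T" by (simp add: x topspace_seminorm)
        fix U assume U: "x \<in> U \<and> openin ?T U"
        then obtain n e where ne: "0 < e" "snball n x e \<subseteq> U" unfolding openin_seminorm_iff by blast
        have "eventually (\<lambda>i. snorm S n (\<sigma> i - x) < e) sequentially"
          using lim[of n] ne(1) by (rule order_tendstoD)
        then obtain i where "snorm S n (\<sigma> i - x) < e" by (auto simp: eventually_sequentially)
        then have "\<sigma> i \<in> U" using ne BS \<sigma> by (auto simp: snball_def)
        moreover have "\<sigma> i \<in> K" using \<sigma>[of i] B(1)[of i] unfolding bad_def by auto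
        ultimately show "\<exists>y. y \<in> K \<and> y \<in> U" by blast
      qed
      then have "x \<in> K" by (simp add: K_def)
      with \<U> obtain U where U: "U \<in> \<U>" "x \<in> U" "openin ?T U" by blast
      then obtain n e where ne: "0 < e" "snball n x e \<subseteq> U" unfolding openin_seminorm_iff by blast
      have ev: "eventually (\<lambda>i. snorm S n (\<sigma> i - x) < e/2) sequentially"
        using lim[of n] ne(1) by (intro order_tendstoD) auto
      obtain p0 where p0: "1 / real (Suc p0) < e/2"
        using nat_approx_posE[of "e/2"] ne(1) by auto
      obtain i0 where i0: "\<And>i. i \<ge> i0 \<Longrightarrow> snorm S n (\<sigma> i - x) < e/2"
        using ev by (auto simp: eventually_sequentially)
      \<comment> \<open>With this \<open>p\<close> the diameter of \<open>B (Suc p)\<close> in the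
        n-th seminorm and the distance of \<open>\<sigma> (Suc p)\<close> from \<open>x\<close> are
        both below e/2, so all of \<open>B (Suc p)\<close> lies in the single set
        \<open>U\<close>.\<close>
      define p where "p = max (max n p0) i0"
      have "1 / real (Suc p) \<le> 1 / real (Suc p0)" by (simp add: frac_le p_def)
      then have p: "n \<le> p" "i0 \<le> Suc p" "1 / real (Suc p) < e/2" using p0 by (auto simp: p_def)
      have "B (Suc p) \<subseteq> U"
      proof
        fix y assume y: "y \<in> B (Suc p)"
        have "snorm S n (y - x) \<le> snorm S n (y - \<sigma> (Suc p)) + snorm S n (\<sigma> (Suc p) - x)"
          using y \<sigma> BS x by (intro snorm_diff_triangle) auto
        also have "\<dots> < e" using small[OF p(1) y \<sigma>[of "Suc p"]] p(3) i0[OF p(2)] by linarith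
        finally show "y \<in> U" using ne y BS by (auto simp: snball_def)
      qed
      moreover have "\<not> B (Suc p) \<subseteq> \<Union>{U}" using B(1)[of "Suc p"] U(1) unfolding bad_def
        by (metis empty_subsetI finite.emptyI finite_insert insert_subset)
      ultimately show False by simp
    qed
  qed
  then show ?thesis
    unfolding relatively_compact_in_def K_def using C by (simp add: topspace_seminorm)
qed

section \<open>Operations that preserve total boundedness\<close>

lemma precompact_in_subset: "precompact_in n C \<Longrightarrow> D \<subseteq> C \<Longrightarrow> precompact_in n D"
  unfolding precompact_in_def by (meson order_trans)

text \<open>A net of radius e/2 for \<open>D\<close> is a net of radius e for \<open>C\<close>. The
  set \<open>D\<close> may depend on \<open>e\<close>; later it consists of combinations of
  translates over a grid that is refined with \<open>e\<close>.\<close>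

lemma precompact_in_approx:
  assumes "\<And>e. 0 < e \<Longrightarrow> \<exists>D. D \<subseteq> space_of S \<and> precompact_in n D \<and> (\<forall>x\<in>C. \<exists>y\<in>D. snorm S n (x - y) < e)"
    and CS: "C \<subseteq> space_of S"
  shows "precompact_in n C"
  unfolding precompact_in_def
proof (intro allI impI)
  fix e :: real assume "0 < e"
  then obtain D where D: "D \<subseteq> space_of S" "precompact_in n D" "\<And>x. x \<in> C \<Longrightarrow> \<exists>y\<in>D. snorm S n (x - y) < e/2"
    using assms(1)[of "e/2"] by auto
  obtain F where F: "finite F" "F \<subseteq> space_of S" "D \<subseteq> (\<Union>x\<in>F. snball n x (e/2))"
    using precompact_inD[OF D(2) half_gt_zero[OF \<open>0 < e\<close>]] by blast
  have "C \<subseteq> (\<Union>x\<in>F. snball n x e)"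
  proof
    fix x assume x: "x \<in> C"
    then obtain y z where yz: "y \<in> D" "snorm S n (x - y) < e/2" "z \<in> F" "y \<in> snball n z (e/2)"
      using D(3) F(3) by blast
    then have "snorm S n (x - z) < e"
      using snorm_diff_triangle[of x y z n] x CS D(1) F(2) subsetD[of C "space_of S" x]
      subsetD[of F "space_of S" z] by (auto simp: snball_def)
    with yz x CS show "x \<in> (\<Union>x\<in>F. snball n x e)" by (auto simp: snball_def)
  qed
  with F show "\<exists>F. finite F \<and> F \<subseteq> space_of S \<and> C \<subseteq> (\<Union>x\<in>F. snball n x e)" by blast
qed

lemma precompact_in_zero: "precompact_in n {0}"
  unfolding precompact_in_def
  by (intro allI impI exI[of _ "{0}"]) (use zero_mem in \<open>auto intro: snball_mem\<close>)

lemma precompact_in_add: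
  assumes "precompact_in n C" "precompact_in n D"
  shows "precompact_in n {x + y | x y. x \<in> C \<and> y \<in> D}"
  unfolding precompact_in_def
proof (intro allI impI)
  fix e :: real assume "0 < e"
  then obtain F G where F: "finite F" "F \<subseteq> space_of S" "C \<subseteq> (\<Union>x\<in>F. snball n x (e/2))"
    and G: "finite G" "G \<subseteq> space_of S" "D \<subseteq> (\<Union>x\<in>G. snball n x (e/2))"
    using precompact_inD[OF assms(1) half_gt_zero] precompact_inD[OF assms(2) half_gt_zero] by metis
  have "{x + y | x y. x \<in> C \<and> y \<in> D} \<subseteq> (\<Union>z\<in>(\<lambda>(a,b). a + b) ` (F \<times> G). snball n z e)"
  proof safe
    fix x y assume "x \<in> C" "y \<in> D"
    then obtain a b where ab: "a \<in> F" "b \<in> G" "x \<in> snball n a (e/2)" "y \<in> snball n b (e/2)"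
      using F(3) G(3) by blast
    from ab F G have mem: "a \<in> space_of S" "b \<in> space_of S" "x \<in> space_of S" "y \<in> space_of S"
      by (auto simp: snball_def)
    have eq: "x + y - (a + b) = (x - a) + (y - b)" by simp
    have "snorm S n (x + y - (a + b)) \<le> snorm S n (x - a) + snorm S n (y - b)"
      unfolding eq using mem by (intro snorm_triangle diff_mem)
    with ab have "snorm S n (x + y - (a + b)) < e" by (simp add: snball_def)
    with ab mem show "x + y \<in> (\<Union>z\<in>(\<lambda>(a,b). a + b) ` (F \<times> G). snball n z e)"
      by (auto simp: snball_def add_mem intro!: bexI[of _ "(a, b)"])
  qed
  with F(1,2) G(1,2) show "\<exists>F. finite F \<and> F \<subseteq> space_of S \<and> {x + y | x y. x \<in> C \<and> y \<in> D} \<subseteq> (\<Union>x\<in>F. snball n x e)"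
    by (intro exI[of _ "(\<lambda>(a,b). a + b) ` (F \<times> G)"]) (auto intro!: add_mem)
qed

lemma precompact_in_sum:
  assumes "finite J" "\<And>j. j \<in> J \<Longrightarrow> precompact_in n (C j)"
  shows "precompact_in n {\<Sum>j\<in>J. v j | v. \<forall>j\<in>J. v j \<in> C j}"
  using assms
proof (induction J)
  case empty
  then show ?case using precompact_in_zero by simp
next
  case (insert i J)
  have "{\<Sum>j\<in>insert i J. v j | v. \<forall>j\<in>insert i J. v j \<in> C j} \<subseteq>
     {x + y | x y. x \<in> C i \<and> y \<in> {\<Sum>j\<in>J. v j | v. \<forall>j\<in>J. v j \<in> C j}}"
    using insert.hyps by (auto; blast)
  then show ?case
    using precompact_in_add[of n "C i" "{\<Sum>j\<in>J. v j | v. \<forall>j\<in>J. v j \<in> C j}"] insert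
    by (auto intro: precompact_in_subset)
qed

section \<open>Continuous functionals and the weak topology\<close>

lemma dual_spaceI:
  assumes add: "\<And>x y. x \<in> space_of S \<Longrightarrow> y \<in> space_of S \<Longrightarrow> \<phi> (x + y) = \<phi> x + \<phi> y"
    and scale: "\<And>c x. x \<in> space_of S \<Longrightarrow> \<phi> (scale S c x) = c * \<phi> x"
    and bound: "\<And>x. x \<in> space_of S \<Longrightarrow> cmod (\<phi> x) \<le> K * snorm S n x"
  shows "\<phi> \<in> dual_space S"
proof -
  have diff: "\<phi> (x - y) = \<phi> x - \<phi> y" if "x \<in> space_of S" "y \<in> space_of S" for x y
    using add[of "x - y" y] that by (simp add: diff_mem)
  have "openin (seminorm_topology S) {x \<in> space_of S. \<phi> x \<in> U}" if "open U" for U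
    unfolding openin_seminorm_iff
  proof (intro conjI ballI)
    fix x assume x: "x \<in> {x \<in> space_of S. \<phi> x \<in> U}"
    with \<open>open U\<close> obtain e where e: "0 < e" "ball (\<phi> x) e \<subseteq> U" by (auto simp: open_contains_ball)
    \<comment> \<open>\<open>K\<close> is an arbitrary real number; the maximum makes the radius
      \<open>e / K'\<close> positive.\<close>
    define K' where "K' = max K 1"
    have K': "0 < K'" by (simp add: K'_def)
    have "snball n x (e / K') \<subseteq> {x \<in> space_of S. \<phi> x \<in> U}"
    proof
      fix y assume y: "y \<in> snball n x (e / K')"
      then have yS: "y \<in> space_of S" by (simp add: snball_def)
      have "cmod (\<phi> y - \<phi> x) \<le> K * snorm S n (y - x)"
        using bound[of "y - x"] diff[of y x] x yS by (simp add: diff_mem)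
      also have "\<dots> \<le> K' * snorm S n (y - x)"
        by (intro mult_right_mono) (use x yS in \<open>auto simp: K'_def intro: snorm_nonneg diff_mem\<close>)
      also have "\<dots> < e" using y K' by (simp add: snball_def field_simps)
      finally have "\<phi> y \<in> ball (\<phi> x) e" by (simp add: dist_norm norm_minus_commute)
      with e yS show "y \<in> {x \<in> space_of S. \<phi> x \<in> U}" by auto
    qed
    then show "\<exists>n e. 0 < e \<and> snball n x e \<subseteq> {x \<in> space_of S. \<phi> x \<in> U}"
      using e K' by (intro exI[of _ n] exI[of _ "e / K'"]) auto
  qed auto
  then have "continuous_map (seminorm_topology S) euclidean \<phi>"
    by (simp add: continuous_map_def topspace_seminorm)
  with add scale show ?thesis by (simp add: dual_space_def)
qed

lemma topspace_weak: "topspace (weak_topology S) = space_of S"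
proof -
  \<comment> \<open>The zero functional makes the whole space a subbasic open set.\<close>
  have "(\<lambda>_. 0) \<in> dual_space S" by (simp add: dual_space_def)
  then have "space_of S \<in> {{y \<in> space_of S. \<phi> y \<in> U} |\<phi> U. \<phi> \<in> dual_space S \<and> open U}"
    by (auto intro!: exI[of _ "\<lambda>_. 0"] exI[of _ UNIV])
  then show ?thesis unfolding weak_topology_def topology_generated_by_topspace by blast
qed

lemma openin_weak:
  "\<phi> \<in> dual_space S \<Longrightarrow> open U \<Longrightarrow> openin (weak_topology S) {y \<in> space_of S. \<phi> y \<in> U}"
  unfolding weak_topology_def by (rule topology_generated_by_Basis) blast

lemma openin_weak_imp_seminorm:
  assumes "openin (weak_topology S) U" shows "openin (seminorm_topology S) U"
  using assms unfolding weak_topology_def openin_topology_generated_by_iff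
proof induction
  case (Basis s)
  then obtain \<phi> U where "s = {y \<in> space_of S. \<phi> y \<in> U}" "\<phi> \<in> dual_space S" "open U" by blast
  then show ?case
    using openin_continuous_map_preimage[of "seminorm_topology S" euclidean \<phi> U]
    by (simp add: dual_space_def topspace_seminorm)
qed auto

lemma Hausdorff_weak:
  assumes "\<And>x y. x \<in> space_of S \<Longrightarrow> y \<in> space_of S \<Longrightarrow> x \<noteq> y \<Longrightarrow> \<exists>\<phi>\<in>dual_space S. \<phi> x \<noteq> \<phi> y"
  shows "Hausdorff_space (weak_topology S)"
  unfolding Hausdorff_space_def topspace_weak
proof (intro allI impI)
  fix x y assume xy: "x \<in> space_of S \<and> y \<in> space_of S \<and> x \<noteq> y"
  then obtain \<phi> where \<phi>: "\<phi> \<in> dual_space S" "\<phi> x \<noteq> \<phi> y" using assms by blast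
  then obtain U V where "open U" "open V" "\<phi> x \<in> U" "\<phi> y \<in> V" "U \<inter> V = {}" by (meson hausdorff)
  then show "\<exists>U V. openin (weak_topology S) U \<and> openin (weak_topology S) V \<and> x \<in> U \<and> y \<in> V \<and> disjnt U V"
    using openin_weak[OF \<phi>(1)] xy
    by (intro exI[of _ "{z \<in> space_of S. \<phi> z \<in> U}"] exI[of _ "{z \<in> space_of S. \<phi> z \<in> V}"])
      (auto simp: disjnt_def)
qed

text \<open>The two notions refer to closures in different topologies. The closure in the seminorm
  topology is compact in the coarser weak topology, hence weakly closed because functionals separate
  points. It therefore contains the weak closure of \<open>C\<close>, which is a closed subset of a
  compact set.\<close>

lemma relatively_compact_weak:
  assumes sep: "\<And>x y. x \<in> space_of S \<Longrightarrow> y \<in> space_of S \<Longrightarrow> x \<noteq> y \<Longrightarrow> \<exists>\<phi>\<in>dual_space S. \<phi> x \<noteq> \<phi> y"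
    and C: "relatively_compact_in (seminorm_topology S) C"
  shows "relatively_compact_in (weak_topology S) C"
proof -
  let ?K = "seminorm_topology S closure_of C"
  have comp: "compactin (weak_topology S) ?K"
    unfolding compactin_def
  proof (intro conjI allI impI)
    show "?K \<subseteq> topspace (weak_topology S)"
      using closure_of_subset_topspace[of "seminorm_topology S" C] by (simp add: topspace_weak topspace_seminorm)
    fix \<U> assume \<U>: "(\<forall>U\<in>\<U>. openin (weak_topology S) U) \<and> ?K \<subseteq> \<Union>\<U>"
    have "compactin (seminorm_topology S) ?K" using C by (simp add: relatively_compact_in_def)
    moreover have "(\<forall>U\<in>\<U>. openin (seminorm_topology S) U) \<and> ?K \<subseteq> \<Union>\<U>"
      using \<U> by (intro conjI ballI openin_weak_imp_seminorm) auto
    ultimately show "\<exists>\<F>. finite \<F> \<and> \<F> \<subseteq> \<U> \<and> ?K \<subseteq> \<Union>\<F>"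
      unfolding compactin_def by (elim conjE allE) (erule impE, rule conjI, assumption+)
  qed
  have "Hausdorff_space (weak_topology S)" by (rule Hausdorff_weak) (rule sep)
  then have closed: "closedin (weak_topology S) ?K" using comp by (rule compactin_imp_closedin)
  have CS: "C \<subseteq> space_of S" using C by (simp add: relatively_compact_in_def topspace_seminorm)
  then have "C \<subseteq> ?K" by (simp add: closure_of_subset topspace_seminorm)
  then have "compactin (weak_topology S) (weak_topology S closure_of C)"
    by (intro closed_compactin[OF comp] closure_of_minimal closed closedin_closure_of)
  with CS show ?thesis by (simp add: relatively_compact_in_def topspace_weak)
qed

lemma Montel_imp_weakly_Montel:
  assumes "\<And>x y. x \<in> space_of S \<Longrightarrow> y \<in> space_of S \<Longrightarrow> x \<noteq> y \<Longrightarrow> \<exists>\<phi>\<in>dual_space S. \<phi> x \<noteq> \<phi> y"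
    and "Montel S' S T"
  shows "weakly_Montel S' S T"
  unfolding weakly_Montel_def
proof (intro conjI allI impI)
  show "linear_operator S' S T" using assms(2) by (simp add: Montel_def)
  fix C assume "bounded_subset S' C"
  with assms(2) have "relatively_compact_in (seminorm_topology S) (T ` C)" by (simp add: Montel_def)
  then show "relatively_compact_in (weak_topology S) (T ` C)"
    using assms(1) by (rule relatively_compact_weak[rotated])
qed

text \<open>Compactness of the closure yields a cluster point of the sequence, not a convergent
  subsequence. This is enough: if the values of a functional converge along the whole sequence, its
  value at a cluster point must be the limit.\<close>

lemma weak_cluster_point:
  assumes C: "relatively_compact_in (weak_topology S) C" and \<sigma>: "\<And>k::nat. \<sigma> k \<in> C"
  shows "\<exists>y\<in>space_of S. \<forall>\<phi>\<in>dual_space S. \<forall>l. (\<lambda>k. \<phi> (\<sigma> k)) \<longlonglongrightarrow> l \<longrightarrow> \<phi> y = l"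
proof -
  let ?T = "weak_topology S"
  let ?K = "?T closure_of C"
  have CS: "C \<subseteq> space_of S" using C by (simp add: relatively_compact_in_def topspace_weak)
  have comp: "compactin ?T ?K" using C by (simp add: relatively_compact_in_def)
  have \<sigma>K: "\<sigma> k \<in> ?K" for k using \<sigma> closure_of_subset[of C ?T] CS by (auto simp: topspace_weak)
  have "\<exists>y\<in>?K. \<forall>U. openin ?T U \<and> y \<in> U \<longrightarrow> (\<exists>\<^sub>F k in sequentially. \<sigma> k \<in> U)"
  proof (rule ccontr)
    assume "\<not> ?thesis"
    then have *: "\<And>y. y \<in> ?K \<Longrightarrow> \<exists>U. openin ?T U \<and> y \<in> U \<and> (\<forall>\<^sub>F k in sequentially. \<sigma> k \<notin> U)"
      by (auto simp: not_frequently)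
    \<comment> \<open>If no point of the closure were a cluster point, these sets would cover it.
      Finitely many of them would do, and the sequence would eventually avoid all of these, although
      it stays in the closure.\<close>
    define \<U> where "\<U> = {U. openin ?T U \<and> (\<forall>\<^sub>F k in sequentially. \<sigma> k \<notin> U)}"
    have "(\<forall>U\<in>\<U>. openin ?T U) \<and> ?K \<subseteq> \<Union>\<U>" using * unfolding \<U>_def by blast
    then obtain \<F> where \<F>: "finite \<F>" "\<F> \<subseteq> \<U>" "?K \<subseteq> \<Union>\<F>"
      using comp unfolding compactin_def by blast
    have "\<forall>\<^sub>F k in sequentially. \<forall>U\<in>\<F>. \<sigma> k \<notin> U"
      using \<F> by (intro eventually_ball_finite) (auto simp: \<U>_def)
    then have "\<exists>k. \<forall>U\<in>\<F>. \<sigma> k \<notin> U" by (auto simp: eventually_sequentially)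
    with \<F>(3) \<sigma>K show False by blast
  qed
  then obtain y where y: "y \<in> ?K" "\<And>U. openin ?T U \<Longrightarrow> y \<in> U \<Longrightarrow> \<exists>\<^sub>F k in sequentially. \<sigma> k \<in> U" by blast
  have yS: "y \<in> space_of S" using y(1) closure_of_subset_topspace[of ?T C] by (auto simp: topspace_weak)
  have "\<phi> y = l" if \<phi>: "\<phi> \<in> dual_space S" and lim: "(\<lambda>k. \<phi> (\<sigma> k)) \<longlonglongrightarrow> l" for \<phi> l
  proof (rule ccontr)
    assume "\<phi> y \<noteq> l"
    then obtain U V where UV: "open U" "open V" "\<phi> y \<in> U" "l \<in> V" "U \<inter> V = {}" by (meson hausdorff)
    have "\<exists>\<^sub>F k in sequentially. \<sigma> k \<in> {z \<in> space_of S. \<phi> z \<in> U}"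
      using UV yS by (intro y(2) openin_weak \<phi>) auto
    moreover have "\<forall>\<^sub>F k in sequentially. \<phi> (\<sigma> k) \<in> V" using lim UV by (auto simp: topological_tendstoD)
    then have "\<forall>\<^sub>F k in sequentially. \<sigma> k \<notin> {z \<in> space_of S. \<phi> z \<in> U}"
      by eventually_elim (use UV in auto)
    ultimately show False by (simp add: frequently_def)
  qed
  with yS show ?thesis by blast
qed

end

section \<open>Total variation and Jordan decomposition\<close>

lemma sets_borel_plus_iff: "E \<in> sets borel_plus \<longleftrightarrow> E \<in> sets borel \<and> E \<subseteq> {0..}"
  by (simp add: sets_restrict_space_iff conj_commute)

lemma sets_lborel_plus [simp]: "sets lborel_plus = sets borel_plus"
  by (rule sets_restrict_space_cong) simp

lemma space_borel_plus: "space borel_plus = {0..}"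
  by (simp add: space_restrict_space)

lemma sigma_algebra_borel_plus: "sigma_algebra {0..} (sets borel_plus)"
  using sets.sigma_algebra_axioms[of borel_plus] by (simp add: space_borel_plus)

lemma bounded_borel_sets: "E \<in> bounded_borel \<Longrightarrow> E \<in> sets borel_plus"
  by (simp add: bounded_borel_def)

lemma bounded_borel_subset: "E \<in> bounded_borel \<Longrightarrow> F \<in> sets borel_plus \<Longrightarrow> F \<subseteq> E \<Longrightarrow> F \<in> bounded_borel"
  by (auto simp: bounded_borel_def intro: bounded_subset)

lemma bounded_borel_empty [simp]: "{} \<in> bounded_borel"
  by (simp add: bounded_borel_def)

lemma bounded_borel_Un: "E \<in> bounded_borel \<Longrightarrow> F \<in> bounded_borel \<Longrightarrow> E \<union> F \<in> bounded_borel"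
  unfolding bounded_borel_def by (auto intro: sets.Un)

lemma bounded_borel_Int: "E \<in> bounded_borel \<Longrightarrow> F \<in> sets borel_plus \<Longrightarrow> E \<inter> F \<in> bounded_borel"
  by (rule bounded_borel_subset) (auto simp: bounded_borel_def)

lemma bounded_borel_Diff: "E \<in> bounded_borel \<Longrightarrow> F \<in> sets borel_plus \<Longrightarrow> E - F \<in> bounded_borel"
  by (rule bounded_borel_subset) (auto simp: bounded_borel_def)

lemma bounded_borel_interval: "{0..<y} \<in> bounded_borel"
  by (simp add: bounded_borel_def sets_borel_plus_iff bounded_subset[of "{0..y}"] subset_eq)

lemma bounded_borel_boundE:
  assumes "E \<in> bounded_borel" obtains b where "E \<subseteq> {0..b}" "0 \<le> b"
proof -
  obtain b where "\<forall>x\<in>E. norm x \<le> b" using assms by (auto simp: bounded_borel_def bounded_iff)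
  moreover have "E \<subseteq> {0..}" using assms by (simp add: bounded_borel_def sets_borel_plus_iff)
  ultimately have "E \<subseteq> {0..max b 0}" by fastforce
  then show ?thesis by (rule that) simp
qed

text \<open>The common part of the proofs that the total and the positive variation are measures.
  \<open>V E\<close> collects the competing values whose supremum is the measure of
  \<open>E\<close>. Uniting competitors on disjoint sets gives superadditivity; the hypothesis
  \<open>sub\<close>, proved later by cutting one competitor along the pieces, gives countable
  subadditivity.\<close>

lemma measure_space_Sup:
  fixes V :: "'a set \<Rightarrow> ennreal set"
  assumes A: "sigma_algebra \<Omega> \<A>"
    and zero: "Sup (V {}) = 0"
    and mono: "\<And>A B. A \<in> \<A> \<Longrightarrow> B \<in> \<A> \<Longrightarrow> A \<subseteq> B \<Longrightarrow> V A \<subseteq> V B"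
    and ne: "\<And>A. V A \<noteq> {}"
    and super: "\<And>A B a b. A \<in> \<A> \<Longrightarrow> B \<in> \<A> \<Longrightarrow> A \<inter> B = {} \<Longrightarrow> a \<in> V A \<Longrightarrow> b \<in> V B \<Longrightarrow> a + b \<in> V (A \<union> B)"
    and sub: "\<And>E a. range E \<subseteq> \<A> \<Longrightarrow> disjoint_family E \<Longrightarrow> a \<in> V (\<Union>i. E i) \<Longrightarrow> a \<le> (\<Sum>i. Sup (V (E i)))"
  shows "measure_space \<Omega> \<A> (\<lambda>E. Sup (V E))"
  unfolding measure_space_def
proof (intro conjI A)
  interpret sigma_algebra \<Omega> \<A> by (rule A)
  show "positive \<A> (\<lambda>E. Sup (V E))" by (simp add: positive_def zero)
  \<comment> \<open>The sum of two suprema is the supremum of the sums, one variable at a time; this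
    needs the sets \<open>V A\<close> and \<open>V B\<close> to be nonempty.\<close>
  have super2: "Sup (V A) + Sup (V B) \<le> Sup (V (A \<union> B))" if "A \<in> \<A>" "B \<in> \<A>" "A \<inter> B = {}" for A B
  proof -
    have "Sup (V A) + Sup (V B) = (SUP a\<in>V A. a + (SUP b\<in>V B. b))"
      using ennreal_SUP_add_left[OF ne[of A], of "\<lambda>a. a" "Sup (V B)"] by simp
    also have "\<dots> = (SUP a\<in>V A. SUP b\<in>V B. a + b)"
      by (intro SUP_cong refl ennreal_SUP_add_right ne)
    also have "\<dots> \<le> Sup (V (A \<union> B))"
      using super[OF that] by (intro SUP_least Sup_upper)
    finally show ?thesis .
  qed
  show "countably_additive \<A> (\<lambda>E. Sup (V E))"
  proof (rule countably_additiveI)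
    fix E :: "nat \<Rightarrow> 'a set" assume E: "range E \<subseteq> \<A>" "disjoint_family E" "(\<Union>i. E i) \<in> \<A>"
    have fin: "(\<Union>i<n. E i) \<in> \<A>" for n using E(1) by auto
    have part: "(\<Sum>i<n. Sup (V (E i))) \<le> Sup (V (\<Union>i<n. E i))" for n
    proof (induction n)
      case 0 then show ?case by simp
    next
      case (Suc n)
      have "(\<Union>i<n. E i) \<inter> E n = {}"
        using E(2) by (auto simp: disjoint_family_on_def, metis IntI empty_iff less_irrefl)
      then have "Sup (V (\<Union>i<n. E i)) + Sup (V (E n)) \<le> Sup (V ((\<Union>i<n. E i) \<union> E n))"
        using E(1) by (intro super2 fin) auto
      moreover have "(\<Union>i<n. E i) \<union> E n = (\<Union>i<Suc n. E i)" by (simp add: lessThan_Suc Un_commute)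
      ultimately have "Sup (V (\<Union>i<n. E i)) + Sup (V (E n)) \<le> Sup (V (\<Union>i<Suc n. E i))" by metis
      with add_right_mono[OF Suc, of "Sup (V (E n))"] have
        "(\<Sum>i<n. Sup (V (E i))) + Sup (V (E n)) \<le> Sup (V (\<Union>i<Suc n. E i))" by (rule order_trans)
      then show ?case unfolding sum.lessThan_Suc .
    qed
    show "(\<Sum>i. Sup (V (E i))) = Sup (V (\<Union>i. E i))"
    proof (rule antisym)
      show "(\<Sum>i. Sup (V (E i))) \<le> Sup (V (\<Union>i. E i))"
        unfolding suminf_eq_SUP
      proof (rule SUP_least)
        fix n
        have "Sup (V (\<Union>i<n. E i)) \<le> Sup (V (\<Union>i. E i))"
          by (intro Sup_subset_mono mono fin E) auto
        with part[of n] show "(\<Sum>i<n. Sup (V (E i))) \<le> Sup (V (\<Union>i. E i))" by (rule order_trans)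
      qed
      show "Sup (V (\<Union>i. E i)) \<le> (\<Sum>i. Sup (V (E i)))"
        by (rule Sup_least) (rule sub[OF E(1,2)])
    qed
  qed
qed

text \<open>The values may lie in any normed space, so that the notion covers a complex measure as
  well as its real and imaginary parts and their negatives.\<close>

definition locally_countably_additive :: "(real set \<Rightarrow> 'b::real_normed_vector) \<Rightarrow> bool" where
  "locally_countably_additive u \<longleftrightarrow>
     (\<forall>E::nat \<Rightarrow> real set. range E \<subseteq> bounded_borel \<longrightarrow> disjoint_family E \<longrightarrow>
        (\<Union>i. E i) \<in> bounded_borel \<longrightarrow> (\<lambda>i. u (E i)) sums u (\<Union>i. E i))"

lemma locally_countably_additiveD:
  "locally_countably_additive u \<Longrightarrow> (\<And>i::nat. E i \<in> bounded_borel) \<Longrightarrow> disjoint_family E \<Longrightarrow>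
     (\<Union>i. E i) \<in> bounded_borel \<Longrightarrow> (\<lambda>i. u (E i)) sums u (\<Union>i. E i)"
  unfolding locally_countably_additive_def by blast

lemma locally_finite_measure_alt:
  "locally_finite_measure \<nu> \<longleftrightarrow> (\<forall>E. E \<notin> bounded_borel \<longrightarrow> \<nu> E = 0) \<and> locally_countably_additive \<nu>"
  by (simp add: locally_finite_measure_def locally_countably_additive_def)

context
  fixes u :: "real set \<Rightarrow> 'b::real_normed_vector"
  assumes u: "locally_countably_additive u"
begin

text \<open>Additivity on the constant sequence of empty sets makes a series with constant terms
  converge, so its terms tend to 0.\<close>

lemma lca_empty: "u {} = 0"
proof -
  have "(\<lambda>i::nat. u {}) sums u (\<Union>i::nat. {})"
    by (rule locally_countably_additiveD[OF u]) (auto simp: disjoint_family_on_def)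
  then have "(\<lambda>i::nat. u {}) \<longlonglongrightarrow> 0" by (intro summable_LIMSEQ_zero) (auto simp: sums_iff)
  then show ?thesis by (simp add: LIMSEQ_const_iff)
qed

lemma lca_Un:
  assumes "A \<in> bounded_borel" "B \<in> bounded_borel" "A \<inter> B = {}"
  shows "u (A \<union> B) = u A + u B"
proof -
  have "(\<lambda>i. u (binaryset A B i)) sums u (\<Union>i. binaryset A B i)"
    using assms by (intro locally_countably_additiveD[OF u])
      (auto simp: binaryset_def disjoint_family_on_def UN_binaryset_eq[unfolded binaryset_def] bounded_borel_Un)
  moreover have "(\<lambda>i. u (binaryset A B i)) sums (u A + u B)"
    by (rule binaryset_sums) (rule lca_empty)
  ultimately show ?thesis by (simp add: UN_binaryset_eq sums_unique2)
qed

text \<open>The pieces \<open>E i\<close> may be unbounded; only their traces on the bounded set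
  \<open>F\<close> are measured. This is how competitors for a variation are cut along arbitrary
  Borel sets.\<close>

lemma lca_split:
  assumes "F \<in> bounded_borel" "range E \<subseteq> sets borel_plus" "disjoint_family E" "F \<subseteq> (\<Union>i::nat. E i)"
  shows "(\<lambda>i. u (F \<inter> E i)) sums u F"
proof -
  have eq: "(\<Union>i. F \<inter> E i) = F" using assms(4) by blast
  have "(\<lambda>i. u (F \<inter> E i)) sums u (\<Union>i. F \<inter> E i)"
    using assms by (intro locally_countably_additiveD[OF u])
     (auto simp: eq disjoint_family_on_def intro!: bounded_borel_Int)
  then show ?thesis unfolding eq .
qed

end

lemma sums_norm_le_ennreal:
  fixes f :: "nat \<Rightarrow> 'b::real_normed_vector"
  assumes "f sums x" shows "ennreal (norm x) \<le> (\<Sum>i. ennreal (norm (f i)))"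
proof (rule LIMSEQ_le_const2)
  show "(\<lambda>n. ennreal (norm (\<Sum>i<n. f i))) \<longlonglongrightarrow> ennreal (norm x)"
    using assms unfolding sums_def by (intro tendsto_ennrealI tendsto_norm)
  have "ennreal (norm (\<Sum>i<n. f i)) \<le> (\<Sum>i. ennreal (norm (f i)))" for n
  proof -
    have "ennreal (norm (\<Sum>i<n. f i)) \<le> ennreal (\<Sum>i<n. norm (f i))"
      by (intro ennreal_leI norm_sum)
    also have "\<dots> = (\<Sum>i<n. ennreal (norm (f i)))" by (simp add: sum_ennreal)
    also have "\<dots> \<le> (\<Sum>i. ennreal (norm (f i)))" by (intro sum_le_suminf) auto
    finally show ?thesis .
  qed
  then show "\<exists>N. \<forall>n\<ge>N. ennreal (norm (\<Sum>i<n. f i)) \<le> (\<Sum>i. ennreal (norm (f i)))" by blast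
qed

lemma sums_le_ennreal:
  assumes "f sums (x::real)" shows "ennreal x \<le> (\<Sum>i. ennreal (f i))"
proof (rule LIMSEQ_le_const2)
  show "(\<lambda>n. ennreal (\<Sum>i<n. f i)) \<longlonglongrightarrow> ennreal x"
    using assms unfolding sums_def by (intro tendsto_ennrealI)
  have "ennreal (\<Sum>i<n. f i) \<le> (\<Sum>i. ennreal (f i))" for n
  proof -
    \<comment> \<open>\<open>ennreal\<close> sends negative numbers to 0 and is additive only on
      nonnegative ones, so the terms are first replaced by their positive parts.\<close>
    have "ennreal (\<Sum>i<n. f i) \<le> ennreal (\<Sum>i<n. max 0 (f i))"
      by (intro ennreal_leI sum_mono) simp
    also have "\<dots> = (\<Sum>i<n. ennreal (f i))"
      by (simp add: sum_ennreal[symmetric] ennreal_max_0)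
    also have "\<dots> \<le> (\<Sum>i. ennreal (f i))" by (intro sum_le_suminf) auto
    finally show ?thesis .
  qed
  then show "\<exists>N. \<forall>n\<ge>N. ennreal (\<Sum>i<n. f i) \<le> (\<Sum>i. ennreal (f i))" by blast
qed

section \<open>The variations as measures\<close>

lemma sets_total_variation [simp]: "sets (total_variation \<nu>) = sets borel_plus"
  unfolding total_variation_def
  by (rule sigma_algebra.sets_measure_of_eq[OF sigma_algebra_borel_plus])

lemma space_total_variation [simp]: "space (total_variation \<nu>) = {0..}"
  unfolding total_variation_def
  by (rule sigma_algebra.space_measure_of_eq[OF sigma_algebra_borel_plus])

lemma sets_positive_variation [simp]: "sets (positive_variation u) = sets borel_plus"
  unfolding positive_variation_def
  by (rule sigma_algebra.sets_measure_of_eq[OF sigma_algebra_borel_plus])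

lemma space_positive_variation [simp]: "space (positive_variation u) = {0..}"
  unfolding positive_variation_def
  by (rule sigma_algebra.space_measure_of_eq[OF sigma_algebra_borel_plus])

text \<open>\<open>measure_of\<close> yields this supremum only once it is known to be countably
  additive. Families inside disjoint sets are united, and a family inside a union is cut along the
  pieces by means of the countable additivity of \<nu>.\<close>

lemma emeasure_total_variation:
  assumes u: "locally_countably_additive \<nu>" and E: "E \<in> sets borel_plus"
  shows "emeasure (total_variation \<nu>) E =
    (SUP P \<in> {P. finite P \<and> P \<subseteq> bounded_borel \<and> disjoint P \<and> \<Union>P \<subseteq> E}. \<Sum>F\<in>P. ennreal (cmod (\<nu> F)))"
proof -
  define V where "V E = (\<lambda>P. \<Sum>F\<in>P. ennreal (cmod (\<nu> F))) `
     {P. finite P \<and> P \<subseteq> bounded_borel \<and> disjoint P \<and> \<Union>P \<subseteq> E}" for E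
  have "measure_space {0..} (sets borel_plus) (\<lambda>E. Sup (V E))"
  proof (rule measure_space_Sup[OF sigma_algebra_borel_plus])
    have "x = 0" if "x \<in> V {}" for x
    proof -
      from that obtain P where P: "x = (\<Sum>F\<in>P. ennreal (cmod (\<nu> F)))" "\<Union>P \<subseteq> {}" by (auto simp: V_def)
      then show "x = 0" unfolding P(1) by (intro sum.neutral) (use lca_empty[OF u] in auto)
    qed
    moreover have "0 \<in> V {}" unfolding V_def by (rule image_eqI[of _ _ "{}"]) auto
    ultimately have "V {} = {0}" by blast
    then show "Sup (V {}) = 0" by simp
    show "V A \<subseteq> V B" if "A \<subseteq> B" for A B using that unfolding V_def by (intro image_mono) auto
    show "V A \<noteq> {}" for A unfolding V_def by (auto intro!: exI[of _ "{}"])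
    show "a + b \<in> V (A \<union> B)" if "A \<inter> B = {}" "a \<in> V A" "b \<in> V B" for A B a b
    proof -
      from that obtain P Q where P: "a = (\<Sum>F\<in>P. ennreal (cmod (\<nu> F)))" "finite P" "P \<subseteq> bounded_borel" "disjoint P" "\<Union>P \<subseteq> A"
        and Q: "b = (\<Sum>F\<in>Q. ennreal (cmod (\<nu> F)))" "finite Q" "Q \<subseteq> bounded_borel" "disjoint Q" "\<Union>Q \<subseteq> B"
        unfolding V_def by blast
      \<comment> \<open>The two families can share only the empty set, whose contribution is 0, so
        the sum over their union is the sum of the two sums.\<close>
      have "F = {}" if "F \<in> P \<inter> Q" for F using that P Q \<open>A \<inter> B = {}\<close> by blast
      then have "(\<Sum>F\<in>P \<inter> Q. ennreal (cmod (\<nu> F))) = 0"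
        using lca_empty[OF u] by (intro sum.neutral) auto
      then have "a + b = (\<Sum>F\<in>P \<union> Q. ennreal (cmod (\<nu> F)))"
        using sum.union_inter[OF P(2) Q(2), of "\<lambda>F. ennreal (cmod (\<nu> F))"] P(1) Q(1) by simp
      moreover have "\<Union>P \<inter> \<Union>Q = {}" using P(5) Q(5) \<open>A \<inter> B = {}\<close> by blast
      then have "disjoint (P \<union> Q)" using P(4) Q(4) by (intro disjoint_union)
      ultimately show ?thesis using P Q unfolding V_def by (intro image_eqI[of _ _ "P \<union> Q"]) auto
    qed
    show "a \<le> (\<Sum>i. Sup (V (E i)))"
      if E: "range E \<subseteq> sets borel_plus" "disjoint_family E" and a: "a \<in> V (\<Union>i. E i)" for E a
    proof -
      from a obtain P where P: "a = (\<Sum>F\<in>P. ennreal (cmod (\<nu> F)))" "finite P" "P \<subseteq> bounded_borel"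
        "disjoint P" "\<Union>P \<subseteq> (\<Union>i. E i)" unfolding V_def by blast
      have "a \<le> (\<Sum>F\<in>P. \<Sum>i. ennreal (cmod (\<nu> (F \<inter> E i))))"
        unfolding P(1) by (intro sum_mono sums_norm_le_ennreal lca_split[OF u _ E]) (use P in auto)
      also have "\<dots> = (\<Sum>i. \<Sum>F\<in>P. ennreal (cmod (\<nu> (F \<inter> E i))))"
        by (rule suminf_sum[symmetric]) auto
      also have "\<dots> \<le> (\<Sum>i. Sup (V (E i)))"
      proof (rule suminf_le)
        fix i
        \<comment> \<open>Intersecting with \<open>E i\<close> can send several members of
          \<open>P\<close> to the empty set; since they are disjoint, this is the only possible
          coincidence, and there the value is 0.\<close>
        have "(\<Sum>F\<in>(\<lambda>F. F \<inter> E i) ` P. ennreal (cmod (\<nu> F))) = (\<Sum>F\<in>P. ennreal (cmod (\<nu> (F \<inter> E i))))"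
        proof (subst sum.reindex_nontrivial[OF P(2)])
          fix F G assume "F \<in> P" "G \<in> P" "F \<noteq> G" "F \<inter> E i = G \<inter> E i"
          then have "F \<inter> E i = {}" using P(4) unfolding disjoint_def by blast
          then show "ennreal (cmod (\<nu> (F \<inter> E i))) = 0" using lca_empty[OF u] by simp
        qed simp
        moreover have "disjoint ((\<lambda>F. F \<inter> E i) ` P)" using P(4) unfolding disjoint_def by blast
        then have "(\<Sum>F\<in>(\<lambda>F. F \<inter> E i) ` P. ennreal (cmod (\<nu> F))) \<in> V (E i)"
          unfolding V_def using P E(1) by (intro imageI) (auto intro!: bounded_borel_Int)
        ultimately show "(\<Sum>F\<in>P. ennreal (cmod (\<nu> (F \<inter> E i)))) \<le> Sup (V (E i))"
          by (simp add: Sup_upper)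
      qed auto
      finally show ?thesis .
    qed
  qed
  then show ?thesis
    unfolding total_variation_def V_def measure_space_def
    by (intro emeasure_measure_of_sigma) (use E in auto)
qed

lemma emeasure_positive_variation:
  assumes u: "locally_countably_additive u" and E: "E \<in> sets borel_plus"
  shows "emeasure (positive_variation u) E = (SUP F \<in> {F \<in> bounded_borel. F \<subseteq> E}. ennreal (u F))"
proof -
  define V where "V E = (\<lambda>F. ennreal (u F)) ` {F \<in> bounded_borel. F \<subseteq> E}" for E
  have sup0: "Sup (V E) = (SUP F \<in> {F \<in> bounded_borel. F \<subseteq> E}. ennreal (u F))" for E by (simp add: V_def)
  text \<open>\<^const>\<open>ennreal\<close> is additive only on nonnegative numbers, so a set with negative value is
    replaced by the empty set.\<close>
  have neg: "\<exists>F\<in>bounded_borel. F \<subseteq> A \<and> a = ennreal (u F) \<and> 0 \<le> u F" if "a \<in> V A" for a A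
  proof -
    from that obtain F where F: "F \<in> bounded_borel" "F \<subseteq> A" "a = ennreal (u F)" by (auto simp: V_def)
    show ?thesis
    proof (cases "0 \<le> u F")
      case False
      then show ?thesis using F lca_empty[OF u] by (intro bexI[of _ "{}"]) (auto simp: ennreal_neg)
    qed (use F in auto)
  qed
  have "measure_space {0..} (sets borel_plus) (\<lambda>E. Sup (V E))"
  proof (rule measure_space_Sup[OF sigma_algebra_borel_plus])
    have "V {} = {0}" using lca_empty[OF u] by (auto simp: V_def image_iff intro: exI[of _ "{}"])
    then show "Sup (V {}) = 0" by simp
    show "V A \<subseteq> V B" if "A \<subseteq> B" for A B using that unfolding V_def by (intro image_mono) auto
    show "V A \<noteq> {}" for A unfolding V_def by (auto intro!: exI[of _ "{}"])
    show "a + b \<in> V (A \<union> B)" if AB: "A \<inter> B = {}" and "a \<in> V A" "b \<in> V B" for A B a b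
    proof -
      from neg[OF that(2)] neg[OF that(3)] obtain F G where
        F: "F \<in> bounded_borel" "F \<subseteq> A" "a = ennreal (u F)" "0 \<le> u F" and
        G: "G \<in> bounded_borel" "G \<subseteq> B" "b = ennreal (u G)" "0 \<le> u G" by blast
      have "u (F \<union> G) = u F + u G" using F G AB by (intro lca_Un[OF u]) auto
      with F G have "a + b = ennreal (u (F \<union> G))" by simp
      then show ?thesis using F G unfolding V_def by (intro image_eqI[of _ _ "F \<union> G"]) (auto intro: bounded_borel_Un)
    qed
    show "a \<le> (\<Sum>i. Sup (V (E i)))"
      if E: "range E \<subseteq> sets borel_plus" "disjoint_family E" and a: "a \<in> V (\<Union>i. E i)" for E a
    proof -
      from a obtain F where F: "a = ennreal (u F)" "F \<in> bounded_borel" "F \<subseteq> (\<Union>i. E i)"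
        unfolding V_def by blast
      have "a \<le> (\<Sum>i. ennreal (u (F \<inter> E i)))"
        unfolding F(1) by (intro sums_le_ennreal lca_split[OF u _ E] F)
      also have "\<dots> \<le> (\<Sum>i. Sup (V (E i)))"
        by (intro suminf_le Sup_upper) (use F E in \<open>auto simp: V_def intro!: imageI bounded_borel_Int\<close>)
      finally show ?thesis .
    qed
  qed
  then show ?thesis
    unfolding positive_variation_def sup0 measure_space_def
    by (intro emeasure_measure_of_sigma) (use E in auto)
qed

text \<open>For F inside E, additivity gives v(F) = v(E) - v(E - F), which is at most v(E) plus the
  positive variation of -v on E. The supremum over F gives one inequality; applying it to
  \<open>u\<close> and to \<open>- u\<close> gives equality.\<close>

lemma Jordan_decomposition:
  assumes u: "locally_countably_additive u" and E: "E \<in> bounded_borel"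
    and P: "emeasure (positive_variation u) E < \<infinity>" and N: "emeasure (positive_variation (\<lambda>E. - u E)) E < \<infinity>"
  shows "u E = measure (positive_variation u) E - measure (positive_variation (\<lambda>E. - u E)) E"
proof -
  have le: "measure (positive_variation v) E \<le> v E + measure (positive_variation (\<lambda>E. - v E)) E"
    if v: "locally_countably_additive v"
      and fin: "emeasure (positive_variation (\<lambda>E. - v E)) E < \<infinity>" for v :: "real set \<Rightarrow> real"
  proof -
    let ?n = "measure (positive_variation (\<lambda>E. - v E)) E"
    have v': "locally_countably_additive (\<lambda>E. - v E)"
      using v unfolding locally_countably_additive_def by (auto intro: sums_minus)
    have bd: "v F \<le> v E + ?n" if F: "F \<in> bounded_borel" "F \<subseteq> E" for F
    proof -
      have EF: "E - F \<in> bounded_borel" using E F by (auto intro: bounded_borel_Diff bounded_borel_sets)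
      have "ennreal (- v (E - F)) \<le> emeasure (positive_variation (\<lambda>E. - v E)) E"
        unfolding emeasure_positive_variation[OF v' bounded_borel_sets[OF E]]
        using EF by (intro SUP_upper) auto
      also have "\<dots> = ennreal ?n" using fin by (intro emeasure_eq_ennreal_measure) simp
      finally have "- v (E - F) \<le> ?n" by (simp add: ennreal_le_iff)
      moreover have "v E = v F + v (E - F)"
        using lca_Un[OF v F(1) EF] F(2) by (simp add: Un_absorb1)
      ultimately show ?thesis by simp
    qed
    have "emeasure (positive_variation v) E \<le> ennreal (v E + ?n)"
      unfolding emeasure_positive_variation[OF v bounded_borel_sets[OF E]]
      using bd by (intro SUP_least ennreal_leI) auto
    moreover have "0 \<le> v E + ?n" using bd[of "{}"] lca_empty[OF v] by simp
    ultimately show ?thesis unfolding measure_def by (simp add: enn2real_leI)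
  qed
  have u': "locally_countably_additive (\<lambda>E. - u E)"
    using u unfolding locally_countably_additive_def by (auto intro: sums_minus)
  show ?thesis using le[OF u N] le[OF u'] P by simp
qed

section \<open>Representation of measures by integrable densities\<close>

text \<open>These intervals form an intersection-stable generator; for this reason measures are
  compared on intervals \<open>{0..<y}\<close> throughout.\<close>

lemma sets_borel_plus_sigma: "sets borel_plus = sigma_sets {0..} (range (\<lambda>y. {0..<y::real}))"
proof -
  have "sets borel_plus = (\<inter>) {0..} ` sigma_sets UNIV (range lessThan)"
    unfolding sets_restrict_space by (subst borel_Iio) simp
  also have "\<dots> = sigma_sets {0..} ((\<inter>) {0..} ` range lessThan)"
  proof (rule sigma_sets_Int)
    have "{0..} \<in> sets (borel :: real measure)" by simp
    then show "{0::real..} \<in> sigma_sets UNIV (range lessThan)" by (subst (asm) borel_Iio) simp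
  qed simp
  also have "(\<inter>) {0..} ` range lessThan = range (\<lambda>y. {0..<y::real})"
    by (auto simp: image_image atLeastLessThan_def)
  finally show ?thesis .
qed

section \<open>Bounded integrands against an integrable density\<close>

lemma integrable_bounded_mult:
  fixes H :: "'a \<Rightarrow> complex"
  assumes T[measurable]: "T \<in> measurable M borel_plus" and H: "integrable M H"
    and \<phi>[measurable]: "\<phi> \<in> borel_measurable borel_plus" and B: "\<And>t. 0 \<le> t \<Longrightarrow> cmod (\<phi> t) \<le> B"
  shows "integrable M (\<lambda>x. \<phi> (T x) * H x)"
proof (rule Bochner_Integration.integrable_bound)
  show "integrable M (\<lambda>x. B * cmod (H x))" using H by simp
  show "(\<lambda>x. \<phi> (T x) * H x) \<in> borel_measurable M" using H by measurable
  have "0 \<le> B" using B[of 0] norm_ge_zero[of "\<phi> 0"] by linarith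
  moreover have "0 \<le> T x" if "x \<in> space M" for x using measurable_space[OF T that] by (simp add: space_borel_plus)
  ultimately show "AE x in M. norm (\<phi> (T x) * H x) \<le> norm (B * cmod (H x))"
    by (intro AE_I2) (auto simp: norm_mult intro!: mult_right_mono B)
qed

lemma integral_bounded_mult_tendsto:
  fixes H :: "'a \<Rightarrow> complex"
  assumes T[measurable]: "T \<in> measurable M borel_plus" and H: "integrable M H"
    and \<phi>[measurable]: "\<phi> \<in> borel_measurable borel_plus" "\<And>n. \<psi> n \<in> borel_measurable borel_plus"
    and B: "\<And>n t. 0 \<le> t \<Longrightarrow> cmod (\<psi> n t) \<le> B"
    and lim: "\<And>t. 0 \<le> t \<Longrightarrow> (\<lambda>n. \<psi> n t) \<longlonglongrightarrow> \<phi> t"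
  shows "(\<lambda>n. \<integral>x. \<psi> n (T x) * H x \<partial>M) \<longlonglongrightarrow> (\<integral>x. \<phi> (T x) * H x \<partial>M)"
proof (rule integral_dominated_convergence)
  have T0: "0 \<le> T x" if "x \<in> space M" for x using measurable_space[OF T that] by (simp add: space_borel_plus)
  have [measurable]: "H \<in> borel_measurable M" using H by simp
  show "integrable M (\<lambda>x. B * cmod (H x))" using H by simp
  show "(\<lambda>x. \<phi> (T x) * H x) \<in> borel_measurable M" "\<And>n. (\<lambda>x. \<psi> n (T x) * H x) \<in> borel_measurable M"
    by measurable
  show "AE x in M. (\<lambda>n. \<psi> n (T x) * H x) \<longlonglongrightarrow> \<phi> (T x) * H x"
    using T0 by (intro AE_I2 tendsto_mult lim tendsto_const)
  show "AE x in M. norm (\<psi> n (T x) * H x) \<le> B * cmod (H x)" for n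
    using T0 by (intro AE_I2) (auto simp: norm_mult intro!: mult_right_mono B)
qed

lemma indicator_borel_plus_measurable:
  "E \<in> sets borel_plus \<Longrightarrow> (indicator E :: real \<Rightarrow> complex) \<in> borel_measurable borel_plus"
  by (rule borel_measurable_indicator)

lemma cmod_indicator_le: "cmod (indicator E t) \<le> 1"
  by (simp add: indicator_def)

lemma integral_indicator_sums:
  fixes H :: "'a \<Rightarrow> complex"
  assumes T: "T \<in> measurable M borel_plus" and H: "integrable M H"
    and A: "range A \<subseteq> sets borel_plus" "disjoint_family A"
  shows "(\<lambda>i::nat. \<integral>x. indicator (A i) (T x) * H x \<partial>M) sums (\<integral>x. indicator (\<Union>i. A i) (T x) * H x \<partial>M)"
proof -
  have int: "integrable M (\<lambda>x. indicator (A i) (T x) * H x)" for i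
    using A(1) by (intro integrable_bounded_mult[OF T H, where B=1] indicator_borel_plus_measurable cmod_indicator_le) auto
  have "(\<lambda>n. \<integral>x. indicator (\<Union>i<n. A i) (T x) * H x \<partial>M) \<longlonglongrightarrow> (\<integral>x. indicator (\<Union>i. A i) (T x) * H x \<partial>M)"
    using A(1) by (intro integral_bounded_mult_tendsto[OF T H, where B=1] indicator_borel_plus_measurable
      cmod_indicator_le LIMSEQ_indicator_UN) auto
  moreover have "(\<integral>x. indicator (\<Union>i<n. A i) (T x) * H x \<partial>M) = (\<Sum>i<n. \<integral>x. indicator (A i) (T x) * H x \<partial>M)" for n
  proof -
    have "disjoint_family_on A {..<n}" using A(2) by (rule disjoint_family_on_mono[rotated]) simp
    then have "(\<integral>x. indicator (\<Union>i<n. A i) (T x) * H x \<partial>M) = (\<integral>x. (\<Sum>i<n. indicator (A i) (T x) * H x) \<partial>M)"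
      by (simp add: indicator_UN_disjoint sum_distrib_right)
    also have "\<dots> = (\<Sum>i<n. \<integral>x. indicator (A i) (T x) * H x \<partial>M)"
      by (rule Bochner_Integration.integral_sum) (rule int)
    finally show ?thesis .
  qed
  ultimately show ?thesis by (simp add: sums_def)
qed

text \<open>Agreement passes from intervals to Borel sets by a Dynkin argument, to simple functions
  by linearity, and to bounded Borel functions by dominated convergence.\<close>

lemma integral_unique_of_intervals:
  fixes H :: "'a \<Rightarrow> complex" and K :: "'b \<Rightarrow> complex"
  assumes T: "T \<in> measurable M borel_plus" and H: "integrable M H"
    and S: "S \<in> measurable N borel_plus" and K: "integrable N K"
    and eq: "\<And>y. (\<integral>x. indicator {0..<y} (T x) * H x \<partial>M) = (\<integral>x. indicator {0..<y} (S x) * K x \<partial>N)"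
    and \<phi>: "\<phi> \<in> borel_measurable borel_plus" and B: "\<And>t. 0 \<le> t \<Longrightarrow> cmod (\<phi> t) \<le> B"
  shows "(\<integral>x. \<phi> (T x) * H x \<partial>M) = (\<integral>x. \<phi> (S x) * K x \<partial>N)"
proof -
  let ?I = "\<lambda>\<phi>. \<integral>x. \<phi> (T x) * H x \<partial>M" and ?J = "\<lambda>\<phi>. \<integral>x. \<phi> (S x) * K x \<partial>N"
  have ind: "(indicator {0..<y} :: real \<Rightarrow> complex) \<in> borel_measurable borel_plus" for y :: real
    using bounded_borel_sets[OF bounded_borel_interval[of y]] by (rule indicator_borel_plus_measurable)
  have lim1: "(\<lambda>n. indicator {0..<real n} t :: complex) \<longlonglongrightarrow> 1" if "0 \<le> t" for t
  proof (rule tendsto_eventually)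
    obtain n0 where "t < real n0" using reals_Archimedean2 by blast
    then show "\<forall>\<^sub>F n in sequentially. indicator {0..<real n} t = (1::complex)"
      using that by (auto simp: eventually_sequentially intro!: exI[of _ n0])
  qed
  \<comment> \<open>The complement case of the induction needs equal total masses; they are the
    limits of the values on \<open>{0..<real n}\<close>.\<close>
  have total: "?I (\<lambda>_. 1) = ?J (\<lambda>_. 1)"
  proof (rule LIMSEQ_unique)
    show "(\<lambda>n. ?I (indicator {0..<real n})) \<longlonglongrightarrow> ?I (\<lambda>_. 1)"
      by (rule integral_bounded_mult_tendsto[OF T H _ ind cmod_indicator_le lim1]) simp
    show "(\<lambda>n. ?I (indicator {0..<real n})) \<longlonglongrightarrow> ?J (\<lambda>_. 1)"
      unfolding eq by (rule integral_bounded_mult_tendsto[OF S K _ ind cmod_indicator_le lim1]) simp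
  qed
  have sets: "?I (indicator E) = ?J (indicator E)" if "E \<in> sets borel_plus" for E
  proof -
    have "Int_stable (range (\<lambda>y. {0..<y::real}))"
      by (auto simp: Int_stable_def)
    moreover have "range (\<lambda>y. {0..<y::real}) \<subseteq> Pow {0..}" by auto
    moreover have "E \<in> sigma_sets {0..} (range (\<lambda>y. {0..<y::real}))" using that by (simp add: sets_borel_plus_sigma)
    ultimately show ?thesis
    proof (induction rule: sigma_sets_induct_disjoint)
      case (basic A)
      then show ?case using eq by auto
    next
      case empty
      then show ?case by simp
    next
      case (compl A)
      have A: "A \<in> sets borel_plus" using compl by (simp add: sets_borel_plus_sigma)
      have dec: "(\<integral>x. indicator ({0..} - A) (T x) * H x \<partial>M) = (\<integral>x. 1 * H x \<partial>M) - (\<integral>x. indicator A (T x) * H x \<partial>M)"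
        if T: "T \<in> measurable M borel_plus" and H: "integrable M H"
        for T :: "'c \<Rightarrow> real" and H :: "'c \<Rightarrow> complex" and M
      proof -
        have "(\<integral>x. indicator ({0..} - A) (T x) * H x \<partial>M) = (\<integral>x. 1 * H x - indicator A (T x) * H x \<partial>M)"
          using measurable_space[OF T] by (intro Bochner_Integration.integral_cong) (auto simp: indicator_def space_borel_plus)
        also have "\<dots> = (\<integral>x. 1 * H x \<partial>M) - (\<integral>x. indicator A (T x) * H x \<partial>M)"
          by (rule Bochner_Integration.integral_diff)
            (use H integrable_bounded_mult[OF T H indicator_borel_plus_measurable[OF A] cmod_indicator_le] in auto)
        finally show ?thesis .
      qed
      show ?case using dec[OF T H] dec[OF S K] compl total by simp
    next
      case (union A)
      then have A: "range A \<subseteq> sets borel_plus" by (simp add: sets_borel_plus_sigma)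
      show ?case
        using integral_indicator_sums[OF T H A union(1)] integral_indicator_sums[OF S K A union(1)] union(3)
        by (simp add: sums_unique2)
    qed
  qed
  have simple: "?I s = ?J s" if s: "simple_function borel_plus s" for s :: "real \<Rightarrow> complex"
  proof -
    have expand: "(\<integral>x. s (T x) * H x \<partial>M) =
        (\<Sum>y\<in>s ` {0..}. y * (\<integral>x. indicator (s -` {y} \<inter> {0..}) (T x) * H x \<partial>M))"
      if T: "T \<in> measurable M borel_plus" and H: "integrable M H"
      for T :: "'c \<Rightarrow> real" and H :: "'c \<Rightarrow> complex" and M
    proof -
      have fin: "finite (s ` {0..})" using simple_functionD(1)[OF s] by (simp add: space_borel_plus)
      have lev: "s -` {y} \<inter> {0..} \<in> sets borel_plus" for y
        using simple_functionD(2)[OF s, of "{y}"] by (simp add: space_borel_plus)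
      have ex: "s (T x) = (\<Sum>y\<in>s ` {0..}. y * indicator (s -` {y} \<inter> {0..}) (T x))" if "x \<in> space M" for x
        using fin measurable_space[OF T that]
        by (subst sum.remove[of _ "s (T x)"]) (auto simp: space_borel_plus indicator_def intro!: sum.neutral)
      have "(\<integral>x. s (T x) * H x \<partial>M) = (\<integral>x. (\<Sum>y\<in>s ` {0..}. y * (indicator (s -` {y} \<inter> {0..}) (T x) * H x)) \<partial>M)"
        by (intro Bochner_Integration.integral_cong refl) (simp only: ex sum_distrib_right mult.assoc)
      also have "\<dots> = (\<Sum>y\<in>s ` {0..}. \<integral>x. y * (indicator (s -` {y} \<inter> {0..}) (T x) * H x) \<partial>M)"
        by (intro Bochner_Integration.integral_sum integrable_mult_right
          integrable_bounded_mult[OF T H indicator_borel_plus_measurable[OF lev] cmod_indicator_le])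
      finally show ?thesis by simp
    qed
    have lev: "s -` {y} \<inter> {0..} \<in> sets borel_plus" for y
        using simple_functionD(2)[OF s, of "{y}"] by (simp add: space_borel_plus)
    show ?thesis unfolding expand[OF T H] expand[OF S K] using sets[OF lev] by simp
  qed
  \<comment> \<open>The approximating simple functions are bounded by twice \<open>\<phi>\<close>,
    hence by \<open>2 * B\<close>, which supplies the dominating function.\<close>
  obtain F where F0: "\<forall>i. simple_function borel_plus (F i)" "\<forall>x\<in>{0..}. (\<lambda>i. F i x) \<longlonglongrightarrow> \<phi> x"
    "\<forall>i. \<forall>x\<in>{0..}. cmod (F i x) \<le> 2 * cmod (\<phi> x)"
    using borel_measurable_implies_sequence_metric[OF \<phi>, of 0] unfolding space_borel_plus dist_0_norm dist_norm diff_0_right by blast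
  have F: "simple_function borel_plus (F i)" "0 \<le> x \<Longrightarrow> (\<lambda>i. F i x) \<longlonglongrightarrow> \<phi> x"
    "0 \<le> x \<Longrightarrow> cmod (F i x) \<le> 2 * cmod (\<phi> x)" for i x using F0 by auto
  have F2: "cmod (F i x) \<le> 2 * B" if "0 \<le> x" for i x using F(3)[OF that, of i] B[OF that] by simp
  show ?thesis
  proof (rule LIMSEQ_unique)
    show "(\<lambda>n. ?I (F n)) \<longlonglongrightarrow> ?I \<phi>"
      by (rule integral_bounded_mult_tendsto[OF T H \<phi> _ F2 F(2)]) (auto intro: borel_measurable_simple_function F)
    show "(\<lambda>n. ?I (F n)) \<longlonglongrightarrow> ?J \<phi>"
      unfolding simple[OF F(1)]
      by (rule integral_bounded_mult_tendsto[OF S K \<phi> _ F2 F(2)]) (auto intro: borel_measurable_simple_function F)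
  qed
qed

text \<open>Sigma-finiteness is included for the sake of Fubini on products. Integrability of
  \<open>H\<close> forces finite total variation, and the value 0 off \<open>bounded_borel\<close>
  matches the convention that makes a locally finite measure unique.\<close>

definition represents ::
    "(real set \<Rightarrow> complex) \<Rightarrow> 'a measure \<Rightarrow> ('a \<Rightarrow> real) \<Rightarrow> ('a \<Rightarrow> complex) \<Rightarrow> bool" where
  "represents \<nu> M T H \<longleftrightarrow> sigma_finite_measure M \<and> T \<in> measurable M borel_plus \<and> integrable M H \<and>
     (\<forall>E. \<nu> E = (if E \<in> bounded_borel then \<integral>x. indicator E (T x) * H x \<partial>M else 0))"

lemma representsD:
  assumes "represents \<nu> M T H"
  shows "sigma_finite_measure M" "T \<in> measurable M borel_plus" "integrable M H"
    "E \<in> bounded_borel \<Longrightarrow> \<nu> E = (\<integral>x. indicator E (T x) * H x \<partial>M)"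
    "E \<notin> bounded_borel \<Longrightarrow> \<nu> E = 0"
  using assms by (auto simp: represents_def)

text \<open>Integrals depend only on the measure and not on its representation. Since the hypothesis
  concerns intervals only, the lemma serves at the same time to prove that two measures are
  equal.\<close>

lemma represents_unique:
  assumes r: "represents \<nu> M T H" "represents \<nu>' N S K" and eq: "\<And>y. \<nu> {0..<y} = \<nu>' {0..<y}"
    and "\<phi> \<in> borel_measurable borel_plus" "\<And>t. 0 \<le> t \<Longrightarrow> cmod (\<phi> t) \<le> B"
  shows "(\<integral>x. \<phi> (T x) * H x \<partial>M) = (\<integral>x. \<phi> (S x) * K x \<partial>N)"
  using representsD(2,3)[OF r(1)] representsD(2,3)[OF r(2)] _ assms(4,5)
proof (rule integral_unique_of_intervals)
  fix y :: real
  show "(\<integral>x. indicator {0..<y} (T x) * H x \<partial>M) = (\<integral>x. indicator {0..<y} (S x) * K x \<partial>N)"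
    using eq[of y] representsD(4)[OF r(1) bounded_borel_interval] representsD(4)[OF r(2) bounded_borel_interval] by simp
qed

lemma locally_finite_measure_represents:
  assumes r: "represents \<nu> M T H" shows "locally_finite_measure \<nu>"
  unfolding locally_finite_measure_alt locally_countably_additive_def
proof (intro conjI allI impI)
  fix E :: "nat \<Rightarrow> real set" assume E: "range E \<subseteq> bounded_borel" "disjoint_family E" "(\<Union>i. E i) \<in> bounded_borel"
  have "(\<lambda>i. \<integral>x. indicator (E i) (T x) * H x \<partial>M) sums (\<integral>x. indicator (\<Union>i. E i) (T x) * H x \<partial>M)"
    using E by (intro integral_indicator_sums representsD[OF r]) (auto dest: bounded_borel_sets)
  then show "(\<lambda>i. \<nu> (E i)) sums \<nu> (\<Union>i. E i)"
    using E(1,3) by (simp add: representsD(4)[OF r] image_subset_iff)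
qed (use representsD(5)[OF r] in auto)

text \<open>Each value of \<nu> is bounded in modulus by the image of the measure with density |H|,
  so |\<nu>| is below that image. Equality can fail, because \<open>T\<close> may merge points at
  which the values of \<open>H\<close> cancel.\<close>

lemma nn_integral_total_variation_le:
  assumes r: "represents \<nu> M T H" and w: "w \<in> borel_measurable borel_plus"
  shows "(\<integral>\<^sup>+t. w t \<partial>total_variation \<nu>) \<le> (\<integral>\<^sup>+x. ennreal (cmod (H x)) * w (T x) \<partial>M)"
proof -
  note T[measurable] = representsD(2)[OF r] and H = representsD(3)[OF r]
  have Hm[measurable]: "H \<in> borel_measurable M" using H by simp
  note w[measurable]
  \<comment> \<open>The image under \<open>T\<close> of the positive measure with density
    |H|.\<close>
  define Q where "Q = distr (density M (\<lambda>x. ennreal (cmod (H x)))) borel_plus T"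
  have setsQ: "sets Q = sets borel_plus" by (simp add: Q_def)
  have Q: "emeasure Q E = (\<integral>\<^sup>+x. ennreal (cmod (indicator E (T x) * H x)) \<partial>M)" if "E \<in> sets borel_plus" for E
  proof -
    have [measurable]: "E \<in> sets borel_plus" by fact
    have "emeasure Q E = (\<integral>\<^sup>+x. ennreal (cmod (H x)) * indicator (T -` E \<inter> space M) x \<partial>M)"
      unfolding Q_def using that by (simp add: emeasure_distr emeasure_density)
    also have "\<dots> = (\<integral>\<^sup>+x. ennreal (cmod (indicator E (T x) * H x)) \<partial>M)"
      by (intro nn_integral_cong) (auto simp: indicator_def)
    finally show ?thesis .
  qed
  have lca: "locally_countably_additive \<nu>"
    using locally_finite_measure_represents[OF r] by (simp add: locally_finite_measure_alt)
  have "total_variation \<nu> \<le> Q"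
    unfolding le_measure[OF setsQ[symmetric, folded sets_total_variation[of \<nu>]]]
  proof safe
    fix E assume "E \<in> sets (total_variation \<nu>)"
    then have E: "E \<in> sets borel_plus" by simp
    show "emeasure (total_variation \<nu>) E \<le> emeasure Q E"
      unfolding emeasure_total_variation[OF lca E]
    proof (rule SUP_least)
      fix P assume "P \<in> {P. finite P \<and> P \<subseteq> bounded_borel \<and> disjoint P \<and> \<Union>P \<subseteq> E}"
      then have P: "finite P" "P \<subseteq> bounded_borel" "disjoint P" "\<Union>P \<subseteq> E" by auto
      have "(\<Sum>F\<in>P. ennreal (cmod (\<nu> F))) \<le> (\<Sum>F\<in>P. emeasure Q F)"
      proof (rule sum_mono)
        fix F assume "F \<in> P"
        then have F: "F \<in> bounded_borel" using P by auto
        have int: "integrable M (\<lambda>x. indicator F (T x) * H x)"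
          by (intro integrable_bounded_mult[OF T H, where B=1] indicator_borel_plus_measurable bounded_borel_sets F cmod_indicator_le)
        show "ennreal (cmod (\<nu> F)) \<le> emeasure Q F"
          unfolding Q[OF bounded_borel_sets[OF F]] representsD(4)[OF r F]
          by (rule integral_norm_bound_ennreal[OF int])
      qed
      also have "\<dots> = emeasure Q (\<Union>F\<in>P. F)"
        using P bounded_borel_sets by (intro sum_emeasure) (auto simp: setsQ disjoint_family_on_def disjoint_def)
      also have "\<dots> \<le> emeasure Q E"
        using P E by (intro emeasure_mono) (auto simp: setsQ)
      finally show "(\<Sum>F\<in>P. ennreal (cmod (\<nu> F))) \<le> emeasure Q E" .
    qed
  qed
  then have "(\<integral>\<^sup>+t. w t \<partial>total_variation \<nu>) \<le> (\<integral>\<^sup>+t. w t \<partial>Q)"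
    by (intro nn_integral_mono_measure) (simp_all add: setsQ)
  also have "\<dots> = (\<integral>\<^sup>+x. ennreal (cmod (H x)) * w (T x) \<partial>M)"
    unfolding Q_def by (simp add: nn_integral_distr nn_integral_density)
  finally show ?thesis .
qed

section \<open>Measures of finite total variation and their canonical density\<close>

definition finite_variation :: "(real set \<Rightarrow> complex) \<Rightarrow> bool" where
  "finite_variation \<nu> \<longleftrightarrow> locally_finite_measure \<nu> \<and> emeasure (total_variation \<nu>) {0..} < \<infinity>"

lemma finite_variation_represents:
  assumes r: "represents \<nu> M T H" shows "finite_variation \<nu>"
  unfolding finite_variation_def
proof
  show "locally_finite_measure \<nu>" by (rule locally_finite_measure_represents[OF r])
  have "emeasure (total_variation \<nu>) {0..} = (\<integral>\<^sup>+t. 1 \<partial>total_variation \<nu>)" by simp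
  also have "\<dots> \<le> (\<integral>\<^sup>+x. ennreal (cmod (H x)) * 1 \<partial>M)"
    by (rule nn_integral_total_variation_le[OF r]) simp
  also have "\<dots> < \<infinity>" using representsD(3)[OF r] by (simp add: integrable_iff_bounded)
  finally show "emeasure (total_variation \<nu>) {0..} < \<infinity>" .
qed

text \<open>Domination gives absolute continuity; since \<open>P\<close> is finite as well, the
  Radon-Nikodym derivative can be taken real-valued and integrable.\<close>

lemma density_of_le:
  assumes m: "finite_measure m" and s: "sets P = sets m"
    and le: "\<And>E. E \<in> sets m \<Longrightarrow> emeasure P E \<le> emeasure m E"
  obtains p :: "'a \<Rightarrow> real" where "p \<in> borel_measurable m" "\<And>x. 0 \<le> p x" "P = density m (\<lambda>x. ennreal (p x))" "integrable m p"
proof -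
  interpret finite_measure m by (rule m)
  have sp: "space P = space m" using s by (rule sets_eq_imp_space_eq)
  have "emeasure P (space P) \<le> emeasure m (space m)" using le[of "space m"] by (simp add: sp)
  moreover have "emeasure m (space m) < \<infinity>" using emeasure_finite[of "space m"] by (simp only: less_top infinity_ennreal_def)
  ultimately have Pfin: "emeasure P (space P) < \<infinity>" by (rule le_less_trans)
  then have finP: "finite_measure P" by (intro finite_measureI) simp
  have ac: "absolutely_continuous m P"
    unfolding absolutely_continuous_def using s le by (auto simp: null_sets_def) (metis le_zero_eq)
  obtain p where p: "p \<in> borel_measurable m" "AE x in m. RN_deriv m P x = ennreal (p x)" "\<And>x. 0 \<le> p x"
    using real_RN_deriv[OF finP ac s] by metis
  have P: "P = density m (\<lambda>x. ennreal (p x))"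
    using density_RN_deriv[OF ac s] density_cong[OF borel_measurable_RN_deriv _ p(2)] p(1) by simp
  have "(\<integral>\<^sup>+x. ennreal (norm (p x)) \<partial>m) = emeasure P (space P)"
    unfolding P using p(1,3) by (simp add: emeasure_density cong: nn_integral_cong)
  with Pfin p(1) have "integrable m p" by (simp add: integrable_iff_bounded)
  with p P show ?thesis using that by blast
qed

lemma emeasure_positive_variation_le:
  assumes \<nu>: "locally_countably_additive \<nu>" and u: "locally_countably_additive u"
    and le: "\<And>F. u F \<le> cmod (\<nu> F)" and E: "E \<in> sets borel_plus"
  shows "emeasure (positive_variation u) E \<le> emeasure (total_variation \<nu>) E"
  unfolding emeasure_positive_variation[OF u E] emeasure_total_variation[OF \<nu> E]
proof (rule SUP_least)
  fix F assume F: "F \<in> {F \<in> bounded_borel. F \<subseteq> E}"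
  have "ennreal (u F) \<le> (\<Sum>F\<in>{F}. ennreal (cmod (\<nu> F)))" using le by (simp add: ennreal_leI)
  also have "\<dots> \<le> (SUP P\<in>{P. finite P \<and> P \<subseteq> bounded_borel \<and> disjoint P \<and> \<Union> P \<subseteq> E}. \<Sum>F\<in>P. ennreal (cmod (\<nu> F)))"
    using F by (intro SUP_upper) auto
  finally show "ennreal (u F) \<le> (SUP P\<in>{P. finite P \<and> P \<subseteq> bounded_borel \<and> disjoint P \<and> \<Union> P \<subseteq> E}. \<Sum>F\<in>P. ennreal (cmod (\<nu> F)))" .
qed

text \<open>The factor 4 arises because the Jordan decompositions of the real and the imaginary part
  contribute four positive measures, each dominated by the total variation.\<close>

lemma finite_variation_canonical:
  assumes \<nu>: "finite_variation \<nu>"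
  obtains h where "represents \<nu> (total_variation \<nu>) (\<lambda>t. t) h"
    "\<And>\<phi> B. \<phi> \<in> borel_measurable borel_plus \<Longrightarrow> (\<And>t. 0 \<le> t \<Longrightarrow> cmod (\<phi> t) \<le> B) \<Longrightarrow>
        measure_integral \<nu> \<phi> = (\<integral>t. \<phi> t * h t \<partial>total_variation \<nu>)"
    "\<And>w. w \<in> borel_measurable borel_plus \<Longrightarrow>
        (\<integral>\<^sup>+t. ennreal (cmod (h t)) * w t \<partial>total_variation \<nu>) \<le> 4 * (\<integral>\<^sup>+t. w t \<partial>total_variation \<nu>)"
proof -
  define m where "m = total_variation \<nu>"
  have sm[measurable_cong, simp]: "sets m = sets borel_plus" by (simp add: m_def)
  have spm: "space m = {0..}" by (simp add: m_def)
  have "finite_measure m" using \<nu> by (intro finite_measureI) (simp add: m_def finite_variation_def less_top)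
  then interpret finite_measure m .
  have lca: "locally_countably_additive \<nu>" using \<nu> by (simp add: finite_variation_def locally_finite_measure_alt)
  have bdd: "\<nu> E = 0" if "E \<notin> bounded_borel" for E using \<nu> that by (simp add: finite_variation_def locally_finite_measure_alt)
  have sumsRe: "locally_countably_additive (\<lambda>E. Re (\<nu> E))" "locally_countably_additive (\<lambda>E. Im (\<nu> E))"
    using lca unfolding locally_countably_additive_def by (auto intro: sums_Re sums_Im)
  have neg: "locally_countably_additive (\<lambda>E. - v E)" if "locally_countably_additive v" for v :: "real set \<Rightarrow> real"
    using that unfolding locally_countably_additive_def by (auto intro: sums_minus)
  note ulca = sumsRe sumsRe[THEN neg]
  have ule: "Re (\<nu> F) \<le> cmod (\<nu> F)" "- Re (\<nu> F) \<le> cmod (\<nu> F)" "Im (\<nu> F) \<le> cmod (\<nu> F)" "- Im (\<nu> F) \<le> cmod (\<nu> F)" for F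
    using abs_Re_le_cmod[of "\<nu> F"] abs_Im_le_cmod[of "\<nu> F"] by auto
  \<comment> \<open>Each of the four Jordan parts is dominated by the total variation, hence has a
    density with respect to it.\<close>
  have dens: "\<exists>p. p \<in> borel_measurable m \<and> (\<forall>x. 0 \<le> p x) \<and> positive_variation v = density m (\<lambda>x. ennreal (p x)) \<and> integrable m p"
    if v: "locally_countably_additive v" "\<And>F. v F \<le> cmod (\<nu> F)" for v :: "real set \<Rightarrow> real"
    using density_of_le[OF \<open>finite_measure m\<close>, of "positive_variation v"]
      emeasure_positive_variation_le[OF lca v] by (metis m_def sets_positive_variation sm)
  obtain p1 where p1: "p1 \<in> borel_measurable m" "\<And>x. 0 \<le> p1 x" "positive_variation (\<lambda>E. Re (\<nu> E)) = density m (\<lambda>x. ennreal (p1 x))" "integrable m p1"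
    using dens[OF ulca(1) ule(1)] by blast
  obtain n1 where n1: "n1 \<in> borel_measurable m" "\<And>x. 0 \<le> n1 x" "positive_variation (\<lambda>E. - Re (\<nu> E)) = density m (\<lambda>x. ennreal (n1 x))" "integrable m n1"
    using dens[OF ulca(3) ule(2)] by blast
  obtain p2 where p2: "p2 \<in> borel_measurable m" "\<And>x. 0 \<le> p2 x" "positive_variation (\<lambda>E. Im (\<nu> E)) = density m (\<lambda>x. ennreal (p2 x))" "integrable m p2"
    using dens[OF ulca(2) ule(3)] by blast
  obtain n2 where n2: "n2 \<in> borel_measurable m" "\<And>x. 0 \<le> n2 x" "positive_variation (\<lambda>E. - Im (\<nu> E)) = density m (\<lambda>x. ennreal (n2 x))" "integrable m n2"
    using dens[OF ulca(4) ule(4)] by blast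
  define h where "h t = (complex_of_real (p1 t) - complex_of_real (n1 t)) + \<i> * (complex_of_real (p2 t) - complex_of_real (n2 t))" for t
  have hint: "integrable m h"
    unfolding h_def using p1 n1 p2 n2 by (intro Bochner_Integration.integrable_add Bochner_Integration.integrable_diff integrable_mult_right) auto
  have meas: "measure_integral \<nu> \<phi> = (\<integral>t. \<phi> t * h t \<partial>m)"
    if \<phi>[measurable]: "\<phi> \<in> borel_measurable borel_plus" and B: "\<And>t. 0 \<le> t \<Longrightarrow> cmod (\<phi> t) \<le> B" for \<phi> B
  proof -
    \<comment> \<open>\<open>measure_integral\<close> is defined through the four Jordan parts;
      replacing each by its density merges the four integrals into a single one against
      \<open>h\<close>.\<close>
    have \<phi>m: "\<phi> \<in> borel_measurable m" by simp
    have id: "(\<lambda>t. t) \<in> measurable m borel_plus" by (simp add: measurable_ident_sets)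
    have I: "integrable m (\<lambda>t. \<phi> t * complex_of_real (p t))" if "integrable m p" for p
      by (rule integrable_bounded_mult[OF id _ \<phi> B]) (use that in auto)
    have D: "(\<integral>t. \<phi> t \<partial>density m (\<lambda>x. ennreal (p x))) = (\<integral>t. \<phi> t * complex_of_real (p t) \<partial>m)"
      if "p \<in> borel_measurable m" "\<And>x. 0 \<le> p x" for p
      using that by (subst integral_density[OF \<phi>m]) (auto simp: scaleR_conv_of_real mult.commute)
    have "(\<integral>t. \<phi> t * h t \<partial>m) = (\<integral>t. (\<phi> t * p1 t - \<phi> t * n1 t) + \<i> * (\<phi> t * p2 t - \<phi> t * n2 t) \<partial>m)"
      by (intro Bochner_Integration.integral_cong) (auto simp: h_def algebra_simps)
    also have "\<dots> = (\<integral>t. \<phi> t * p1 t \<partial>m) - (\<integral>t. \<phi> t * n1 t \<partial>m) + \<i> * ((\<integral>t. \<phi> t * p2 t \<partial>m) - (\<integral>t. \<phi> t * n2 t \<partial>m))"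
      using I[OF p1(4)] I[OF n1(4)] I[OF p2(4)] I[OF n2(4)] by simp
    finally show ?thesis
      unfolding measure_integral_def p1(3) n1(3) p2(3) n2(3) D[OF p1(1,2)] D[OF n1(1,2)] D[OF p2(1,2)] D[OF n2(1,2)] by simp
  qed
  have val: "measure_integral \<nu> (indicator E) = \<nu> E" if E: "E \<in> bounded_borel" for E
  proof -
    have fin: "emeasure (positive_variation v) E < \<infinity>" if v: "locally_countably_additive v" "\<And>F. v F \<le> cmod (\<nu> F)" for v :: "real set \<Rightarrow> real"
    proof -
      have "emeasure (positive_variation v) E \<le> emeasure m E"
        unfolding m_def using emeasure_positive_variation_le[OF lca v] bounded_borel_sets[OF E] by blast
      moreover have "emeasure m E < \<infinity>" using emeasure_finite[of E] by (simp only: less_top infinity_ennreal_def)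
      ultimately show ?thesis by (rule le_less_trans)
    qed
    have L: "(\<integral>t. indicator E t \<partial>positive_variation v) = complex_of_real (measure (positive_variation v) E)" for v :: "real set \<Rightarrow> real"
    proof -
      have "(\<integral>t. indicator E t \<partial>positive_variation v) = (\<integral>t. complex_of_real (indicator E t) \<partial>positive_variation v)"
        by (intro Bochner_Integration.integral_cong) (auto simp: indicator_def)
      also have "\<dots> = complex_of_real (measure (positive_variation v) (E \<inter> {0..}))"
        unfolding integral_complex_of_real by simp
      also have "E \<inter> {0..} = E" using bounded_borel_sets[OF E] by (auto simp: sets_borel_plus_iff)
      finally show ?thesis .
    qed
    have "Re (\<nu> E) = measure (positive_variation (\<lambda>E. Re (\<nu> E))) E - measure (positive_variation (\<lambda>E. - Re (\<nu> E))) E"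
      by (rule Jordan_decomposition[OF ulca(1) E fin[OF ulca(1) ule(1)] fin[OF ulca(3) ule(2)]])
    moreover have "Im (\<nu> E) = measure (positive_variation (\<lambda>E. Im (\<nu> E))) E - measure (positive_variation (\<lambda>E. - Im (\<nu> E))) E"
      by (rule Jordan_decomposition[OF ulca(2) E fin[OF ulca(2) ule(3)] fin[OF ulca(4) ule(4)]])
    ultimately show ?thesis unfolding measure_integral_def L by (simp add: complex_eq_iff)
  qed
  have rep: "represents \<nu> m (\<lambda>t. t) h"
    unfolding represents_def
  proof (intro conjI allI)
    show "sigma_finite_measure m" by unfold_locales
    show "(\<lambda>t. t) \<in> measurable m borel_plus" by (simp add: measurable_ident_sets)
    show "\<nu> E = (if E \<in> bounded_borel then \<integral>x. indicator E x * h x \<partial>m else 0)" for E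
      using bdd[of E] val[of E] meas[OF indicator_borel_plus_measurable[OF bounded_borel_sets] cmod_indicator_le, of E] by auto
  qed (rule hint)
  have wt: "(\<integral>\<^sup>+t. ennreal (cmod (h t)) * w t \<partial>m) \<le> 4 * (\<integral>\<^sup>+t. w t \<partial>m)"
    if w[measurable]: "w \<in> borel_measurable borel_plus" for w
  proof -
    have le: "(\<integral>\<^sup>+t. ennreal (p t) * w t \<partial>m) \<le> (\<integral>\<^sup>+t. w t \<partial>m)"
      if v: "locally_countably_additive v" "\<And>F. v F \<le> cmod (\<nu> F)"
        and p: "p \<in> borel_measurable m" "positive_variation v = density m (\<lambda>x. ennreal (p x))" for v :: "real set \<Rightarrow> real" and p
    proof -
      have "(\<integral>\<^sup>+t. ennreal (p t) * w t \<partial>m) = (\<integral>\<^sup>+t. w t \<partial>positive_variation v)"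
        unfolding p(2) using p(1) by (subst nn_integral_density) auto
      also have "\<dots> \<le> (\<integral>\<^sup>+t. w t \<partial>m)"
      proof (rule nn_integral_mono_measure)
        show "positive_variation v \<le> m"
          using emeasure_positive_variation_le[OF lca v] by (subst le_measure) (auto simp: m_def)
      qed simp
      finally show ?thesis .
    qed
    have "(\<integral>\<^sup>+t. ennreal (cmod (h t)) * w t \<partial>m) \<le>
        (\<integral>\<^sup>+t. (ennreal (p1 t) * w t + ennreal (n1 t) * w t) + (ennreal (p2 t) * w t + ennreal (n2 t) * w t) \<partial>m)"
    proof (rule nn_integral_mono)
      fix t
      have "cmod (h t) \<le> cmod (complex_of_real (p1 t) - complex_of_real (n1 t)) + cmod (\<i> * (complex_of_real (p2 t) - complex_of_real (n2 t)))"
        unfolding h_def by (rule norm_triangle_ineq)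
      also have "\<dots> = \<bar>p1 t - n1 t\<bar> + \<bar>p2 t - n2 t\<bar>"
        by (simp add: norm_mult flip: of_real_diff)
      also have "\<dots> \<le> (p1 t + n1 t) + (p2 t + n2 t)" using p1(2)[of t] n1(2)[of t] p2(2)[of t] n2(2)[of t] by linarith
      finally have "ennreal (cmod (h t)) \<le> (ennreal (p1 t) + ennreal (n1 t)) + (ennreal (p2 t) + ennreal (n2 t))"
        using p1(2)[of t] n1(2)[of t] p2(2)[of t] n2(2)[of t] by (simp add: ennreal_leI flip: ennreal_plus)
      from mult_right_mono[OF this, of "w t"]
      show "ennreal (cmod (h t)) * w t \<le> (ennreal (p1 t) * w t + ennreal (n1 t) * w t) + (ennreal (p2 t) * w t + ennreal (n2 t) * w t)"
        by (simp add: distrib_right)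
    qed
    also have "\<dots> = ((\<integral>\<^sup>+t. ennreal (p1 t) * w t \<partial>m) + (\<integral>\<^sup>+t. ennreal (n1 t) * w t \<partial>m)) +
        ((\<integral>\<^sup>+t. ennreal (p2 t) * w t \<partial>m) + (\<integral>\<^sup>+t. ennreal (n2 t) * w t \<partial>m))"
      using p1(1) n1(1) p2(1) n2(1) by (simp add: nn_integral_add)
    also have "\<dots> \<le> ((\<integral>\<^sup>+t. w t \<partial>m) + (\<integral>\<^sup>+t. w t \<partial>m)) + ((\<integral>\<^sup>+t. w t \<partial>m) + (\<integral>\<^sup>+t. w t \<partial>m))"
      using le[OF ulca(1) ule(1) p1(1,3)] le[OF ulca(3) ule(2) n1(1,3)] le[OF ulca(2) ule(3) p2(1,3)] le[OF ulca(4) ule(4) n2(1,3)]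
      by (intro add_mono)
    also have "\<dots> = 4 * (\<integral>\<^sup>+t. w t \<partial>m)"
      by (simp only: mult_2[symmetric] mult.assoc[symmetric]) simp
    finally show ?thesis .
  qed
  show ?thesis by (rule that[of h, folded m_def]) (use rep meas wt in auto)
qed

text \<open>The canonical density computes the integral defined by Jordan decomposition, and by
  uniqueness every other representation gives the same result. Jordan decompositions need not be
  handled again after this point.\<close>

lemma measure_integral_eq:
  assumes r: "represents \<nu> M T H"
    and \<phi>: "\<phi> \<in> borel_measurable borel_plus" "\<And>t. 0 \<le> t \<Longrightarrow> cmod (\<phi> t) \<le> B"
  shows "measure_integral \<nu> \<phi> = (\<integral>x. \<phi> (T x) * H x \<partial>M)"
proof -
  obtain h where h: "represents \<nu> (total_variation \<nu>) (\<lambda>t. t) h"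
    "measure_integral \<nu> \<phi> = (\<integral>t. \<phi> t * h t \<partial>total_variation \<nu>)"
    using finite_variation_canonical[OF finite_variation_represents[OF r]] \<phi> by metis
  show ?thesis unfolding h(2) by (rule represents_unique[OF h(1) r refl \<phi>])
qed

section \<open>The convolution algebra of measures\<close>

lemma represents_eqI:
  assumes r: "represents \<nu> M T H" "represents \<nu>' N S K" and eq: "\<And>y. \<nu> {0..<y} = \<nu>' {0..<y}"
  shows "\<nu> = \<nu>'"
proof
  fix E show "\<nu> E = \<nu>' E"
  proof (cases "E \<in> bounded_borel")
    case True
    with represents_unique[OF r eq indicator_borel_plus_measurable[OF bounded_borel_sets[OF True]] cmod_indicator_le]
    show ?thesis by (simp add: representsD(4)[OF r(1)] representsD(4)[OF r(2)])
  qed (simp add: representsD(5)[OF r(1)] representsD(5)[OF r(2)])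
qed

lemma measure_integral_shift:
  assumes r: "represents \<mu> N S K"
    and \<phi>: "\<phi> \<in> borel_measurable borel" and B: "\<And>t. cmod (\<phi> t) \<le> B"
  shows "measure_integral \<mu> (\<lambda>s. \<phi> (t + s)) = (\<integral>y. \<phi> (t + S y) * K y \<partial>N)"
proof (rule measure_integral_eq[OF r, where B=B])
  have "(\<lambda>s. \<phi> (t + s)) \<in> borel_measurable borel" using \<phi> by measurable
  then show "(\<lambda>s. \<phi> (t + s)) \<in> borel_measurable borel_plus" by (rule measurable_restrict_space1)
qed (rule B)

lemma measurable_borel_plus_borel: "T \<in> measurable M borel_plus \<Longrightarrow> T \<in> borel_measurable M"
  by (simp add: measurable_restrict_space2_iff)

text \<open>The inner integral of a convolution is a bounded Borel function of the shift, which
  makes it an admissible integrand for the outer measure.\<close>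

lemma measure_integral_shift_measurable:
  assumes r: "represents \<mu> N S K"
    and \<phi>: "\<phi> \<in> borel_measurable borel" and B: "\<And>t. cmod (\<phi> t) \<le> B"
  shows "(\<lambda>t. measure_integral \<mu> (\<lambda>s. \<phi> (t + s))) \<in> borel_measurable borel"
    and "cmod (measure_integral \<mu> (\<lambda>s. \<phi> (t + s))) \<le> B * (\<integral>y. cmod (K y) \<partial>N)"
proof -
  interpret N: sigma_finite_measure N by (rule representsD[OF r])
  have [measurable]: "S \<in> borel_measurable N" "K \<in> borel_measurable N"
    using representsD(2,3)[OF r] by (auto intro: measurable_borel_plus_borel)
  note \<phi>[measurable]
  have "(\<lambda>t. \<integral>y. \<phi> (t + S y) * K y \<partial>N) \<in> borel_measurable borel" by measurable
  then show "(\<lambda>t. measure_integral \<mu> (\<lambda>s. \<phi> (t + s))) \<in> borel_measurable borel"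
    unfolding measure_integral_shift[OF r \<phi> B] .
  have K: "integrable N K" by (rule representsD[OF r])
  have le: "cmod (\<phi> (t + S y) * K y) \<le> B * cmod (K y)" for y
    by (simp add: norm_mult mult_right_mono B)
  have int: "integrable N (\<lambda>y. \<phi> (t + S y) * K y)"
  proof (rule Bochner_Integration.integrable_bound)
    show "integrable N (\<lambda>y. B * cmod (K y))" using K by simp
    show "AE y in N. norm (\<phi> (t + S y) * K y) \<le> norm (B * cmod (K y))"
      using le by (intro AE_I2) (metis abs_ge_self order_trans real_norm_def)
  qed measurable
  have "cmod (\<integral>y. \<phi> (t + S y) * K y \<partial>N) \<le> (\<integral>y. cmod (\<phi> (t + S y) * K y) \<partial>N)"
    by (rule integral_norm_bound)
  also have "\<dots> \<le> (\<integral>y. B * cmod (K y) \<partial>N)"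
    using int K le by (intro integral_mono) auto
  finally have "cmod (\<integral>y. \<phi> (t + S y) * K y \<partial>N) \<le> (\<integral>y. B * cmod (K y) \<partial>N)" .
  then show "cmod (measure_integral \<mu> (\<lambda>s. \<phi> (t + s))) \<le> B * (\<integral>y. cmod (K y) \<partial>N)"
    unfolding measure_integral_shift[OF r \<phi> B] by simp
qed

lemma integrable_tensor:
  fixes H :: "'a \<Rightarrow> complex" and K :: "'b \<Rightarrow> complex"
  assumes "sigma_finite_measure M" "sigma_finite_measure N" and H: "integrable M H" and K: "integrable N K"
  shows "integrable (M \<Otimes>\<^sub>M N) (\<lambda>z. H (fst z) * K (snd z))"
proof -
  interpret pair_sigma_finite M N using assms(1,2) by (rule pair_sigma_finite.intro)
  have [measurable]: "H \<in> borel_measurable M" "K \<in> borel_measurable N" using H K by auto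
  show ?thesis
    by (rule Fubini_integrable) (use H K in \<open>auto simp: norm_mult\<close>)
qed

lemma integral_tensor_shift:
  fixes H :: "'a \<Rightarrow> complex" and K :: "'b \<Rightarrow> complex" and T :: "'a \<Rightarrow> real" and S :: "'b \<Rightarrow> real"
    and \<phi> :: "real \<Rightarrow> complex"
  assumes "sigma_finite_measure M" "sigma_finite_measure N" and H: "integrable M H" and K: "integrable N K"
    and T: "T \<in> borel_measurable M" and S: "S \<in> borel_measurable N"
    and \<phi>: "\<phi> \<in> borel_measurable borel" and B: "\<And>t. cmod (\<phi> t) \<le> B"
  shows "integrable (M \<Otimes>\<^sub>M N) (\<lambda>z. \<phi> (T (fst z) + S (snd z)) * (H (fst z) * K (snd z)))"
    and "(\<integral>z. \<phi> (T (fst z) + S (snd z)) * (H (fst z) * K (snd z)) \<partial>(M \<Otimes>\<^sub>M N)) =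
         (\<integral>x. (\<integral>y. \<phi> (T x + S y) * K y \<partial>N) * H x \<partial>M)"
proof -
  interpret pair_sigma_finite M N using assms(1,2) by (rule pair_sigma_finite.intro)
  note T[measurable] S[measurable] \<phi>[measurable]
  have [measurable]: "H \<in> borel_measurable M" "K \<in> borel_measurable N" using H K by auto
  have HK: "integrable (M \<Otimes>\<^sub>M N) (\<lambda>z. H (fst z) * K (snd z))"
    by (rule integrable_tensor[OF assms(1,2) H K])
  show int: "integrable (M \<Otimes>\<^sub>M N) (\<lambda>z. \<phi> (T (fst z) + S (snd z)) * (H (fst z) * K (snd z)))"
  proof (rule Bochner_Integration.integrable_bound)
    show "integrable (M \<Otimes>\<^sub>M N) (\<lambda>z. B * cmod (H (fst z) * K (snd z)))" using HK by (intro integrable_mult_right integrable_norm)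
    have "0 \<le> B" using B[of 0] norm_ge_zero[of "\<phi> 0"] by linarith
    then show "AE z in M \<Otimes>\<^sub>M N. norm (\<phi> (T (fst z) + S (snd z)) * (H (fst z) * K (snd z))) \<le> norm (B * cmod (H (fst z) * K (snd z)))"
      by (intro AE_I2) (simp add: norm_mult mult_right_mono B)
  qed measurable
  have "(\<integral>x. (\<integral>y. \<phi> (T x + S y) * K y \<partial>N) * H x \<partial>M) = (\<integral>x. (\<integral>y. \<phi> (T x + S y) * (H x * K y) \<partial>N) \<partial>M)"
  proof (intro Bochner_Integration.integral_cong refl)
    fix x
    have "(\<integral>y. \<phi> (T x + S y) * (H x * K y) \<partial>N) = (\<integral>y. H x * (\<phi> (T x + S y) * K y) \<partial>N)"
      by (simp add: ac_simps)
    then show "(\<integral>y. \<phi> (T x + S y) * K y \<partial>N) * H x = (\<integral>y. \<phi> (T x + S y) * (H x * K y) \<partial>N)" by simp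
  qed
  with integral_fst'[OF int]
  show "(\<integral>z. \<phi> (T (fst z) + S (snd z)) * (H (fst z) * K (snd z)) \<partial>(M \<Otimes>\<^sub>M N)) =
         (\<integral>x. (\<integral>y. \<phi> (T x + S y) * K y \<partial>N) * H x \<partial>M)" by simp
qed

lemma indicator_bounded_borel_measurable:
  "E \<in> bounded_borel \<Longrightarrow> (indicator E :: real \<Rightarrow> complex) \<in> borel_measurable borel"
  by (intro borel_measurable_indicator) (auto dest!: bounded_borel_sets simp: sets_borel_plus_iff)

text \<open>By Fubini the iterated integral defining the convolution is an integral over the product
  space, in which the coordinate map is the sum of the two coordinate maps.\<close>

lemma represents_conv:
  assumes r1: "represents \<nu> M T H" and r2: "represents \<mu> N S K"
  shows "represents (measure_conv \<nu> \<mu>) (M \<Otimes>\<^sub>M N) (\<lambda>z. T (fst z) + S (snd z)) (\<lambda>z. H (fst z) * K (snd z))"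
  unfolding represents_def
proof (intro conjI allI)
  note sf = representsD(1)[OF r1] representsD(1)[OF r2]
  interpret pair_sigma_finite M N using sf by (rule pair_sigma_finite.intro)
  show "sigma_finite_measure (M \<Otimes>\<^sub>M N)" by unfold_locales
  have TS[measurable]: "T \<in> borel_measurable M" "S \<in> borel_measurable N"
    using representsD(2)[OF r1] representsD(2)[OF r2] by (auto intro: measurable_borel_plus_borel)
  have "0 \<le> T x" "0 \<le> S y" if "x \<in> space M" "y \<in> space N" for x y
    using measurable_space[OF representsD(2)[OF r1] that(1)] measurable_space[OF representsD(2)[OF r2] that(2)]
    by (auto simp: space_borel_plus)
  then show "(\<lambda>z. T (fst z) + S (snd z)) \<in> measurable (M \<Otimes>\<^sub>M N) borel_plus"
    by (intro measurable_restrict_space2) (auto simp: space_pair_measure)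
  show "integrable (M \<Otimes>\<^sub>M N) (\<lambda>z. H (fst z) * K (snd z))"
    by (rule integrable_tensor[OF sf representsD(3)[OF r1] representsD(3)[OF r2]])
  fix E
  show "measure_conv \<nu> \<mu> E = (if E \<in> bounded_borel then
      \<integral>z. indicator E (T (fst z) + S (snd z)) * (H (fst z) * K (snd z)) \<partial>(M \<Otimes>\<^sub>M N) else 0)"
  proof (cases "E \<in> bounded_borel")
    case True
    note ind = indicator_bounded_borel_measurable[OF True]
    have "measure_conv \<nu> \<mu> E = measure_integral \<nu> (\<lambda>t. measure_integral \<mu> (\<lambda>s. indicator E (t + s)))"
      using True by (simp add: measure_conv_def)
    also have "\<dots> = (\<integral>x. measure_integral \<mu> (\<lambda>s. indicator E (T x + s)) * H x \<partial>M)"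
      by (rule measure_integral_eq[OF r1 measurable_restrict_space1[OF
            measure_integral_shift_measurable(1)[OF r2 ind cmod_indicator_le]]
          measure_integral_shift_measurable(2)[OF r2 ind cmod_indicator_le]])
    also have "\<dots> = (\<integral>x. (\<integral>y. indicator E (T x + S y) * K y \<partial>N) * H x \<partial>M)"
      unfolding measure_integral_shift[OF r2 ind cmod_indicator_le] ..
    also have "\<dots> = (\<integral>z. indicator E (T (fst z) + S (snd z)) * (H (fst z) * K (snd z)) \<partial>(M \<Otimes>\<^sub>M N))"
      by (rule integral_tensor_shift(2)[OF sf representsD(3)[OF r1] representsD(3)[OF r2] TS ind cmod_indicator_le, symmetric])
    finally show ?thesis using True by simp
  qed (simp add: measure_conv_def)
qed

lemma finite_variation_conv:
  "finite_variation \<nu> \<Longrightarrow> finite_variation \<mu> \<Longrightarrow> finite_variation (measure_conv \<nu> \<mu>)"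
  by (elim finite_variation_canonical) (rule finite_variation_represents, rule represents_conv)

text \<open>\<open>measure_conv\<close> imposes the defining formula of convolution on indicators
  only; here it is extended to bounded Borel integrands, as needed for triple products.\<close>

lemma measure_integral_conv:
  assumes "finite_variation \<nu>" "finite_variation \<mu>"
    and \<phi>: "\<phi> \<in> borel_measurable borel" and B: "\<And>t. cmod (\<phi> t) \<le> B"
  shows "measure_integral (measure_conv \<nu> \<mu>) \<phi> = measure_integral \<nu> (\<lambda>t. measure_integral \<mu> (\<lambda>s. \<phi> (t + s)))"
proof -
  obtain h where r1: "represents \<nu> (total_variation \<nu>) (\<lambda>t. t) h" using finite_variation_canonical[OF assms(1)] .
  obtain k where r2: "represents \<mu> (total_variation \<mu>) (\<lambda>t. t) k" using finite_variation_canonical[OF assms(2)] .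
  let ?M = "total_variation \<nu>" and ?N = "total_variation \<mu>"
  have TS: "(\<lambda>t. t) \<in> borel_measurable ?M" "(\<lambda>t. t) \<in> borel_measurable ?N"
    using representsD(2)[OF r1] representsD(2)[OF r2] by (auto intro: measurable_borel_plus_borel)
  have "measure_integral (measure_conv \<nu> \<mu>) \<phi> = (\<integral>z. \<phi> (fst z + snd z) * (h (fst z) * k (snd z)) \<partial>(?M \<Otimes>\<^sub>M ?N))"
    by (rule measure_integral_eq[OF represents_conv[OF r1 r2] measurable_restrict_space1[OF \<phi>] B])
  also have "\<dots> = (\<integral>x. (\<integral>y. \<phi> (x + y) * k y \<partial>?N) * h x \<partial>?M)"
    by (rule integral_tensor_shift(2)[OF representsD(1)[OF r1] representsD(1)[OF r2] representsD(3)[OF r1] representsD(3)[OF r2] TS \<phi> B])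
  also have "\<dots> = (\<integral>x. measure_integral \<mu> (\<lambda>s. \<phi> (x + s)) * h x \<partial>?M)"
    unfolding measure_integral_shift[OF r2 \<phi> B] ..
  also have "\<dots> = measure_integral \<nu> (\<lambda>t. measure_integral \<mu> (\<lambda>s. \<phi> (t + s)))"
    by (rule measure_integral_eq[OF r1 measurable_restrict_space1[OF measure_integral_shift_measurable(1)[OF r2 \<phi> B]]
          measure_integral_shift_measurable(2)[OF r2 \<phi> B], symmetric])
  finally show ?thesis .
qed

text \<open>Both sides unfold to the same triple integral of the indicator of \<open>E\<close> at t
  + s + r. On the left, the inner integral over \<rho> is the bounded integrand to which the
  extended formula applies.\<close>

lemma measure_conv_assoc:
  assumes "finite_variation \<nu>" "finite_variation \<mu>" "finite_variation \<rho>"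
  shows "measure_conv (measure_conv \<nu> \<mu>) \<rho> = measure_conv \<nu> (measure_conv \<mu> \<rho>)"
proof
  fix E
  show "measure_conv (measure_conv \<nu> \<mu>) \<rho> E = measure_conv \<nu> (measure_conv \<mu> \<rho>) E"
  proof (cases "E \<in> bounded_borel")
    case True
    note ind = indicator_bounded_borel_measurable[OF True]
    obtain k where r: "represents \<rho> (total_variation \<rho>) (\<lambda>t. t) k" using finite_variation_canonical[OF assms(3)] .
    have "measure_conv (measure_conv \<nu> \<mu>) \<rho> E =
        measure_integral (measure_conv \<nu> \<mu>) (\<lambda>t. measure_integral \<rho> (\<lambda>r. indicator E (t + r)))"
      using True by (simp add: measure_conv_def)
    also have "\<dots> = measure_integral \<nu> (\<lambda>t. measure_integral \<mu> (\<lambda>s. measure_integral \<rho> (\<lambda>r. indicator E (t + s + r))))"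
      by (rule measure_integral_conv[OF assms(1,2) measure_integral_shift_measurable[OF r ind cmod_indicator_le]])
    also have "\<dots> = measure_integral \<nu> (\<lambda>t. measure_integral (measure_conv \<mu> \<rho>) (\<lambda>s. indicator E (t + s)))"
    proof -
      have "measure_integral (measure_conv \<mu> \<rho>) (\<lambda>s. indicator E (t + s)) =
        measure_integral \<mu> (\<lambda>s. measure_integral \<rho> (\<lambda>r. indicator E (t + (s + r))))" for t
        by (rule measure_integral_conv[OF assms(2,3) _ cmod_indicator_le]) (use ind in measurable)
      then show ?thesis by (simp add: add.assoc)
    qed
    also have "\<dots> = measure_conv \<nu> (measure_conv \<mu> \<rho>) E" using True by (simp add: measure_conv_def)
    finally show ?thesis .
  qed (simp add: measure_conv_def)
qed

lemma measure_conv_commute: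
  assumes "finite_variation \<nu>" "finite_variation \<mu>"
  shows "measure_conv \<nu> \<mu> = measure_conv \<mu> \<nu>"
proof -
  obtain h where r1: "represents \<nu> (total_variation \<nu>) (\<lambda>t. t) h" using finite_variation_canonical[OF assms(1)] .
  obtain k where r2: "represents \<mu> (total_variation \<mu>) (\<lambda>t. t) k" using finite_variation_canonical[OF assms(2)] .
  let ?M = "total_variation \<nu>" and ?N = "total_variation \<mu>"
  interpret pair_sigma_finite ?M ?N using representsD(1)[OF r1] representsD(1)[OF r2] by (rule pair_sigma_finite.intro)
  have [measurable]: "(\<lambda>t. t) \<in> borel_measurable ?M" "(\<lambda>t. t) \<in> borel_measurable ?N" "h \<in> borel_measurable ?M" "k \<in> borel_measurable ?N"
    using representsD(2,3)[OF r1] representsD(2,3)[OF r2] by (auto intro: measurable_borel_plus_borel)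
  show ?thesis
  proof (rule represents_eqI[OF represents_conv[OF r1 r2] represents_conv[OF r2 r1]])
    fix y :: real
    note E = bounded_borel_interval[of y]
    note ind[measurable] = indicator_bounded_borel_measurable[OF E]
    have m: "(\<lambda>z. indicator {0..<y} (fst z + snd z) * (h (fst z) * k (snd z))) \<in> borel_measurable (?M \<Otimes>\<^sub>M ?N)"
      by measurable
    have "measure_conv \<nu> \<mu> {0..<y} = (\<integral>z. indicator {0..<y} (fst z + snd z) * (h (fst z) * k (snd z)) \<partial>(?M \<Otimes>\<^sub>M ?N))"
      by (rule representsD(4)[OF represents_conv[OF r1 r2] E])
    also have "\<dots> = (\<integral>z. indicator {0..<y} (fst z + snd z) * (k (fst z) * h (snd z)) \<partial>(?N \<Otimes>\<^sub>M ?M))"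
      unfolding integral_product_swap[OF m, symmetric]
      by (intro Bochner_Integration.integral_cong) (auto simp: add.commute mult.commute)
    also have "\<dots> = measure_conv \<mu> \<nu> {0..<y}"
      by (rule representsD(4)[OF represents_conv[OF r2 r1] E, symmetric])
    finally show "measure_conv \<nu> \<mu> {0..<y} = measure_conv \<mu> \<nu> {0..<y}" .
  qed
qed

text \<open>On a bounded set the factor t is bounded, so the integral can be computed from the
  representation. Integrability of the new density is a hypothesis because t is unbounded on the
  whole half-line.\<close>

lemma represents_X:
  assumes r: "represents \<nu> M T H" and TH: "integrable M (\<lambda>x. complex_of_real (T x) * H x)"
  shows "represents (measure_X \<nu>) M T (\<lambda>x. complex_of_real (T x) * H x)"
  unfolding represents_def
proof (intro conjI allI representsD(1,2)[OF r] TH)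
  fix E
  show "measure_X \<nu> E = (if E \<in> bounded_borel then \<integral>x. indicator E (T x) * (complex_of_real (T x) * H x) \<partial>M else 0)"
  proof (cases "E \<in> bounded_borel")
    case True
    obtain b where b: "E \<subseteq> {0..b}" "0 \<le> b" using bounded_borel_boundE[OF True] .
    note [measurable] = indicator_bounded_borel_measurable[OF True]
    have "measure_integral \<nu> (\<lambda>t. indicator E t * complex_of_real t) = (\<integral>x. (indicator E (T x) * complex_of_real (T x)) * H x \<partial>M)"
    proof (rule measure_integral_eq[OF r, where B=b])
      show "(\<lambda>t. indicator E t * complex_of_real t) \<in> borel_measurable borel_plus"
        by (rule measurable_restrict_space1) measurable
      show "cmod (indicator E t * complex_of_real t) \<le> b" if "0 \<le> t" for t
        using b that by (auto simp: indicator_def)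
    qed
    then show ?thesis using True by (simp add: measure_X_def mult.assoc)
  qed (simp add: measure_X_def)
qed

text \<open>The coordinate of a product representation is the sum \<open>T + S\<close>, and
  multiplication by a sum distributes. This Leibniz rule is the origin of the derivation
  property.\<close>

lemma measure_X_conv:
  assumes r1: "represents \<nu> M T H" and r2: "represents \<mu> N S K"
    and TH: "integrable M (\<lambda>x. complex_of_real (T x) * H x)" and SK: "integrable N (\<lambda>x. complex_of_real (S x) * K x)"
  shows "measure_X (measure_conv \<nu> \<mu>) = measure_conv (measure_X \<nu>) \<mu> + measure_conv \<nu> (measure_X \<mu>)"
proof
  fix E
  note a = represents_conv[OF represents_X[OF r1 TH] r2] and b = represents_conv[OF r1 represents_X[OF r2 SK]]
  note c = represents_conv[OF r1 r2]
  have "integrable (M \<Otimes>\<^sub>M N) (\<lambda>z. complex_of_real (T (fst z)) * H (fst z) * K (snd z) + H (fst z) * (complex_of_real (S (snd z)) * K (snd z)))"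
    using representsD(3)[OF a] representsD(3)[OF b] by simp
  then have i: "integrable (M \<Otimes>\<^sub>M N) (\<lambda>z. complex_of_real (T (fst z) + S (snd z)) * (H (fst z) * K (snd z)))"
    by (rule Bochner_Integration.integrable_cong[THEN iffD1, rotated 2]) (auto simp: algebra_simps)
  note d = represents_X[OF c i]
  show "measure_X (measure_conv \<nu> \<mu>) E = (measure_conv (measure_X \<nu>) \<mu> + measure_conv \<nu> (measure_X \<mu>)) E"
  proof (cases "E \<in> bounded_borel")
    case True
    note ind = indicator_borel_plus_measurable[OF bounded_borel_sets[OF True]]
    have "measure_X (measure_conv \<nu> \<mu>) E =
        (\<integral>z. indicator E (T (fst z) + S (snd z)) * (complex_of_real (T (fst z)) * H (fst z) * K (snd z)) +
             indicator E (T (fst z) + S (snd z)) * (H (fst z) * (complex_of_real (S (snd z)) * K (snd z))) \<partial>(M \<Otimes>\<^sub>M N))"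
      unfolding representsD(4)[OF d True] by (intro Bochner_Integration.integral_cong) (auto simp: algebra_simps)
    also have "\<dots> = measure_conv (measure_X \<nu>) \<mu> E + measure_conv \<nu> (measure_X \<mu>) E"
      unfolding representsD(4)[OF a True] representsD(4)[OF b True]
      using integrable_bounded_mult[OF representsD(2,3)[OF a] ind cmod_indicator_le]
        integrable_bounded_mult[OF representsD(2,3)[OF b] ind cmod_indicator_le]
      by (rule Bochner_Integration.integral_add)
    finally show ?thesis by simp
  qed (simp add: measure_X_def measure_conv_def)
qed

text \<open>Both measures are given densities with respect to their sum. Densities over one common
  measure can be added, so sums of complex measures become representable and comparable.\<close>

lemma common_dominating_measure:
  assumes P: "finite_measure P" "sets P = sets borel_plus" and Q: "finite_measure Q" "sets Q = sets borel_plus"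
  obtains m :: "real measure" and p q :: "real \<Rightarrow> real" where "finite_measure m" "sets m = sets borel_plus"
    "p \<in> borel_measurable m" "\<And>x. 0 \<le> p x" "P = density m (\<lambda>x. ennreal (p x))"
    "q \<in> borel_measurable m" "\<And>x. 0 \<le> q x" "Q = density m (\<lambda>x. ennreal (q x))"
proof -
  interpret P: finite_measure P by (rule P)
  interpret Q: finite_measure Q by (rule Q)
  define m where "m = measure_of {0..} (sets borel_plus) (\<lambda>E. emeasure P E + emeasure Q E)"
  have sm: "sets m = sets borel_plus" unfolding m_def
    by (rule sigma_algebra.sets_measure_of_eq[OF sigma_algebra_borel_plus])
  have em: "emeasure m E = emeasure P E + emeasure Q E" if "E \<in> sets borel_plus" for E
    unfolding m_def
  proof (rule emeasure_measure_of_sigma[OF sigma_algebra_borel_plus _ _ that])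
    show "positive (sets borel_plus) (\<lambda>E. emeasure P E + emeasure Q E)" by (simp add: positive_def)
    show "countably_additive (sets borel_plus) (\<lambda>E. emeasure P E + emeasure Q E)"
    proof (rule countably_additiveI)
      fix A :: "nat \<Rightarrow> real set" assume "range A \<subseteq> sets borel_plus" "disjoint_family A"
      then show "(\<Sum>i. emeasure P (A i) + emeasure Q (A i)) = emeasure P (\<Union>i. A i) + emeasure Q (\<Union>i. A i)"
        using P(2) Q(2) by (simp add: suminf_add[symmetric] suminf_emeasure)
    qed
  qed
  have "emeasure m (space m) \<noteq> \<infinity>" using em[of "space m"] sm by (metis P.emeasure_finite Q.emeasure_finite ennreal_add_eq_top infinity_ennreal_def sets.top)
  then have fm: "finite_measure m" by (rule finite_measureI)
  obtain p :: "real \<Rightarrow> real" where p: "p \<in> borel_measurable m" "\<And>x. 0 \<le> p x" "P = density m (\<lambda>x. ennreal (p x))"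
    using density_of_le[OF fm, of P] P(2) sm em by (metis le_iff_add)
  obtain q :: "real \<Rightarrow> real" where q: "q \<in> borel_measurable m" "\<And>x. 0 \<le> q x" "Q = density m (\<lambda>x. ennreal (q x))"
    using density_of_le[OF fm, of Q] Q(2) sm em by (metis le_iff_add add.commute)
  show ?thesis by (rule that[OF fm sm p q])
qed

section \<open>Sums and scalar multiples of measures\<close>

lemma finite_measure_total_variation: "finite_variation \<nu> \<Longrightarrow> finite_measure (total_variation \<nu>)"
  by (intro finite_measureI) (simp add: finite_variation_def less_top)

lemma represents_density:
  assumes r: "represents \<nu> (density m (\<lambda>x. ennreal (p x))) (\<lambda>t. t) h"
    and m: "finite_measure m" "sets m = sets borel_plus" and p: "p \<in> borel_measurable m" "\<And>x. 0 \<le> p x"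
  shows "represents \<nu> m (\<lambda>t. t) (\<lambda>t. complex_of_real (p t) * h t)"
proof -
  interpret finite_measure m by (rule m)
  have h[measurable]: "h \<in> borel_measurable m" using representsD(3)[OF r] by auto
  note p(1)[measurable]
  have int: "integrable m (\<lambda>t. complex_of_real (p t) * h t)"
    using representsD(3)[OF r] p by (simp add: integrable_density scaleR_conv_of_real)
  have "(\<integral>t. indicator E t * h t \<partial>density m (\<lambda>x. ennreal (p x))) = (\<integral>t. indicator E t * (complex_of_real (p t) * h t) \<partial>m)"
    if "E \<in> bounded_borel" for E
  proof -
    have [measurable]: "E \<in> sets m" using that m(2) by (simp add: bounded_borel_sets)
    show ?thesis using p by (subst integral_density) (auto simp: scaleR_conv_of_real ac_simps)
  qed
  moreover have "sigma_finite_measure m" by unfold_locales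
  ultimately show ?thesis
    using r int m(2) unfolding represents_def by (auto simp: measurable_ident_sets)
qed

lemma represents_add:
  assumes "finite_variation \<nu>" "finite_variation \<mu>"
  obtains m :: "real measure" and h k where "represents \<nu> m (\<lambda>t. t) h" "represents \<mu> m (\<lambda>t. t) k"
    "represents (\<nu> + \<mu>) m (\<lambda>t. t) (\<lambda>t. h t + k t)"
proof -
  obtain m p q where m: "finite_measure m" "sets m = sets borel_plus"
    and p: "p \<in> borel_measurable m" "\<And>x. 0 \<le> p x" "total_variation \<nu> = density m (\<lambda>x. ennreal (p x))"
    and q: "q \<in> borel_measurable m" "\<And>x. 0 \<le> q x" "total_variation \<mu> = density m (\<lambda>x. ennreal (q x))"
    by (rule common_dominating_measure[OF finite_measure_total_variation[OF assms(1)] sets_total_variation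
      finite_measure_total_variation[OF assms(2)] sets_total_variation]) (rule that)
  obtain h0 where r1: "represents \<nu> (total_variation \<nu>) (\<lambda>t. t) h0" using finite_variation_canonical[OF assms(1)] .
  obtain k0 where r2: "represents \<mu> (total_variation \<mu>) (\<lambda>t. t) k0" using finite_variation_canonical[OF assms(2)] .
  have a: "represents \<nu> m (\<lambda>t. t) (\<lambda>t. complex_of_real (p t) * h0 t)"
    using represents_density[OF r1[unfolded p(3)] m p(1,2)] .
  have b: "represents \<mu> m (\<lambda>t. t) (\<lambda>t. complex_of_real (q t) * k0 t)"
    using represents_density[OF r2[unfolded q(3)] m q(1,2)] .
  have "represents (\<nu> + \<mu>) m (\<lambda>t. t) (\<lambda>t. complex_of_real (p t) * h0 t + complex_of_real (q t) * k0 t)"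
    unfolding represents_def
  proof (intro conjI allI representsD(1,2)[OF a] Bochner_Integration.integrable_add representsD(3)[OF a] representsD(3)[OF b])
    fix E
    show "(\<nu> + \<mu>) E = (if E \<in> bounded_borel then \<integral>t. indicator E t * (complex_of_real (p t) * h0 t + complex_of_real (q t) * k0 t) \<partial>m else 0)"
    proof (cases "E \<in> bounded_borel")
      case True
      note ind = indicator_borel_plus_measurable[OF bounded_borel_sets[OF True]]
      show ?thesis
        using True integrable_bounded_mult[OF representsD(2,3)[OF a] ind cmod_indicator_le]
          integrable_bounded_mult[OF representsD(2,3)[OF b] ind cmod_indicator_le]
        by (simp add: representsD(4)[OF a True] representsD(4)[OF b True] distrib_left)
    qed (simp add: representsD(5)[OF a] representsD(5)[OF b])
  qed
  from a b this show ?thesis by (rule that)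
qed

lemma finite_variation_add: "finite_variation \<nu> \<Longrightarrow> finite_variation \<mu> \<Longrightarrow> finite_variation (\<nu> + \<mu>)"
  by (erule (1) represents_add) (rule finite_variation_represents)

lemma measure_integral_add:
  assumes "finite_variation \<nu>" "finite_variation \<mu>"
    and \<phi>: "\<phi> \<in> borel_measurable borel_plus" and B: "\<And>t. 0 \<le> t \<Longrightarrow> cmod (\<phi> t) \<le> B"
  shows "measure_integral (\<nu> + \<mu>) \<phi> = measure_integral \<nu> \<phi> + measure_integral \<mu> \<phi>"
proof -
  obtain m h k where r: "represents \<nu> m (\<lambda>t. t) h" "represents \<mu> m (\<lambda>t. t) k"
    "represents (\<nu> + \<mu>) m (\<lambda>t. t) (\<lambda>t. h t + k t)" using represents_add[OF assms(1,2)] .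
  have e: "measure_integral \<nu> \<phi> = (\<integral>t. \<phi> t * h t \<partial>m)" "measure_integral \<mu> \<phi> = (\<integral>t. \<phi> t * k t \<partial>m)"
    "measure_integral (\<nu> + \<mu>) \<phi> = (\<integral>t. \<phi> t * (h t + k t) \<partial>m)"
    by (rule measure_integral_eq[OF r(1) \<phi> B] measure_integral_eq[OF r(2) \<phi> B] measure_integral_eq[OF r(3) \<phi> B]; assumption)+
  show ?thesis
    unfolding e
    using integrable_bounded_mult[OF representsD(2,3)[OF r(1)] \<phi> B] integrable_bounded_mult[OF representsD(2,3)[OF r(2)] \<phi> B]
    by (simp add: distrib_left)
qed

lemma measure_conv_add_left:
  assumes "finite_variation \<nu>" "finite_variation \<nu>'" "finite_variation \<mu>"
  shows "measure_conv (\<nu> + \<nu>') \<mu> = measure_conv \<nu> \<mu> + measure_conv \<nu>' \<mu>"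
proof
  fix E
  show "measure_conv (\<nu> + \<nu>') \<mu> E = (measure_conv \<nu> \<mu> + measure_conv \<nu>' \<mu>) E"
  proof (cases "E \<in> bounded_borel")
    case True
    note ind = indicator_bounded_borel_measurable[OF True]
    obtain k where r: "represents \<mu> (total_variation \<mu>) (\<lambda>t. t) k" using finite_variation_canonical[OF assms(3)] .
    show ?thesis using True
      by (simp add: measure_conv_def measure_integral_add[OF assms(1,2) measurable_restrict_space1[OF
         measure_integral_shift_measurable(1)[OF r ind cmod_indicator_le]]
         measure_integral_shift_measurable(2)[OF r ind cmod_indicator_le]])
  qed (simp add: measure_conv_def)
qed

lemma measure_X_add:
  assumes "finite_variation \<nu>" "finite_variation \<nu>'"
  shows "measure_X (\<nu> + \<nu>') = measure_X \<nu> + measure_X \<nu>'"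
proof
  fix E
  show "measure_X (\<nu> + \<nu>') E = (measure_X \<nu> + measure_X \<nu>') E"
  proof (cases "E \<in> bounded_borel")
    case True
    obtain b where b: "E \<subseteq> {0..b}" "0 \<le> b" using bounded_borel_boundE[OF True] .
    note [measurable] = indicator_bounded_borel_measurable[OF True]
    have "measure_integral (\<nu> + \<nu>') (\<lambda>t. indicator E t * complex_of_real t) =
      measure_integral \<nu> (\<lambda>t. indicator E t * complex_of_real t) + measure_integral \<nu>' (\<lambda>t. indicator E t * complex_of_real t)"
    proof (rule measure_integral_add[OF assms, where B=b])
      show "(\<lambda>t. indicator E t * complex_of_real t) \<in> borel_measurable borel_plus"
        by (rule measurable_restrict_space1) measurable
      show "cmod (indicator E t * complex_of_real t) \<le> b" if "0 \<le> t" for t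
        using b that by (auto simp: indicator_def)
    qed
    then show ?thesis using True by (simp add: measure_X_def)
  qed (simp add: measure_X_def)
qed

lemma represents_scale:
  assumes r: "represents \<nu> M T H" shows "represents (\<lambda>E. c * \<nu> E) M T (\<lambda>x. c * H x)"
proof -
  have "(\<integral>x. indicator E (T x) * (c * H x) \<partial>M) = c * (\<integral>x. indicator E (T x) * H x \<partial>M)" for E
    by (subst integral_mult_right_zero[symmetric]) (simp add: ac_simps)
  then show ?thesis using r by (auto simp: represents_def)
qed

lemma measure_integral_scale:
  assumes "finite_variation \<nu>"
    and \<phi>: "\<phi> \<in> borel_measurable borel_plus" and B: "\<And>t. 0 \<le> t \<Longrightarrow> cmod (\<phi> t) \<le> B"
  shows "measure_integral (\<lambda>E. c * \<nu> E) \<phi> = c * measure_integral \<nu> \<phi>"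
proof -
  obtain h where r: "represents \<nu> (total_variation \<nu>) (\<lambda>t. t) h" using finite_variation_canonical[OF assms(1)] .
  have e: "measure_integral \<nu> \<phi> = (\<integral>t. \<phi> t * h t \<partial>total_variation \<nu>)"
    by (rule measure_integral_eq[OF r \<phi> B])
  have e': "measure_integral (\<lambda>E. c * \<nu> E) \<phi> = (\<integral>t. \<phi> t * (c * h t) \<partial>total_variation \<nu>)"
    by (rule measure_integral_eq[OF represents_scale[OF r] \<phi> B])
  show ?thesis
    unfolding e e' by (subst integral_mult_right_zero[symmetric]) (simp add: ac_simps)
qed

lemma measure_conv_scale_left:
  assumes "finite_variation \<nu>" "finite_variation \<mu>"
  shows "measure_conv (\<lambda>E. c * \<nu> E) \<mu> = (\<lambda>E. c * measure_conv \<nu> \<mu> E)"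
proof
  fix E
  show "measure_conv (\<lambda>E. c * \<nu> E) \<mu> E = c * measure_conv \<nu> \<mu> E"
  proof (cases "E \<in> bounded_borel")
    case True
    note ind = indicator_bounded_borel_measurable[OF True]
    obtain k where r: "represents \<mu> (total_variation \<mu>) (\<lambda>t. t) k" using finite_variation_canonical[OF assms(2)] .
    show ?thesis using True
      by (simp add: measure_conv_def measure_integral_scale[OF assms(1) measurable_restrict_space1[OF
         measure_integral_shift_measurable(1)[OF r ind cmod_indicator_le]]
         measure_integral_shift_measurable(2)[OF r ind cmod_indicator_le]])
  qed (simp add: measure_conv_def)
qed

lemma measure_X_scale:
  assumes "finite_variation \<nu>"
  shows "measure_X (\<lambda>E. c * \<nu> E) = (\<lambda>E. c * measure_X \<nu> E)"
proof
  fix E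
  show "measure_X (\<lambda>E. c * \<nu> E) E = c * measure_X \<nu> E"
  proof (cases "E \<in> bounded_borel")
    case True
    obtain b where b: "E \<subseteq> {0..b}" "0 \<le> b" using bounded_borel_boundE[OF True] .
    note [measurable] = indicator_bounded_borel_measurable[OF True]
    have "measure_integral (\<lambda>E. c * \<nu> E) (\<lambda>t. indicator E t * complex_of_real t) =
      c * measure_integral \<nu> (\<lambda>t. indicator E t * complex_of_real t)"
    proof (rule measure_integral_scale[OF assms, where B=b])
      show "(\<lambda>t. indicator E t * complex_of_real t) \<in> borel_measurable borel_plus"
        by (rule measurable_restrict_space1) measurable
      show "cmod (indicator E t * complex_of_real t) \<le> b" if "0 \<le> t" for t
        using b that by (auto simp: indicator_def)
    qed
    then show ?thesis using True by (simp add: measure_X_def)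
  qed (simp add: measure_X_def)
qed

text \<open>The variation of the sum lies below the sum of the variations. That sum is realised as
  the density p + q over a common measure, so a comparison of measures turns into one of weighted
  integrals.\<close>

lemma measure_norm_add:
  assumes fv: "finite_variation \<nu>" "finite_variation \<mu>" and w: "w \<in> borel_measurable borel_plus"
  shows "measure_norm w (\<nu> + \<mu>) \<le> measure_norm w \<nu> + measure_norm w \<mu>"
proof -
  obtain m p q where m: "finite_measure m" "sets m = sets borel_plus"
    and p: "p \<in> borel_measurable m" "\<And>x. 0 \<le> p x" "total_variation \<nu> = density m (\<lambda>x. ennreal (p x))"
    and q: "q \<in> borel_measurable m" "\<And>x. 0 \<le> q x" "total_variation \<mu> = density m (\<lambda>x. ennreal (q x))"
    by (rule common_dominating_measure[OF finite_measure_total_variation[OF fv(1)] sets_total_variation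
      finite_measure_total_variation[OF fv(2)] sets_total_variation]) (rule that)
  have lca: "locally_countably_additive \<nu>" "locally_countably_additive \<mu>" "locally_countably_additive (\<nu> + \<mu>)"
    using fv finite_variation_add[OF fv] by (auto simp: finite_variation_def locally_finite_measure_alt)
  define Q where "Q = density m (\<lambda>x. ennreal (p x) + ennreal (q x))"
  have sQ: "sets Q = sets borel_plus" by (simp add: Q_def m)
  have pm[measurable]: "p \<in> borel_measurable m" "q \<in> borel_measurable m" using p q by auto
  have wm[measurable]: "w \<in> borel_measurable m" using w by (simp add: measurable_cong_sets[OF m(2) refl])
  have "total_variation (\<nu> + \<mu>) \<le> Q"
  proof (subst le_measure)
    show "sets (total_variation (\<nu> + \<mu>)) = sets Q" by (simp add: sQ)
    show "\<forall>E\<in>sets (total_variation (\<nu> + \<mu>)). emeasure (total_variation (\<nu> + \<mu>)) E \<le> emeasure Q E"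
    proof
      fix E assume "E \<in> sets (total_variation (\<nu> + \<mu>))"
      then have E: "E \<in> sets borel_plus" by simp
      have "emeasure (total_variation (\<nu> + \<mu>)) E \<le> emeasure (total_variation \<nu>) E + emeasure (total_variation \<mu>) E"
        unfolding emeasure_total_variation[OF lca(3) E]
      proof (rule SUP_least)
        fix P assume P: "P \<in> {P. finite P \<and> P \<subseteq> bounded_borel \<and> disjoint P \<and> \<Union>P \<subseteq> E}"
        have "(\<Sum>F\<in>P. ennreal (cmod ((\<nu> + \<mu>) F))) \<le> (\<Sum>F\<in>P. ennreal (cmod (\<nu> F)) + ennreal (cmod (\<mu> F)))"
          by (intro sum_mono) (simp add: norm_triangle_ineq flip: ennreal_plus)
        also have "\<dots> = (\<Sum>F\<in>P. ennreal (cmod (\<nu> F))) + (\<Sum>F\<in>P. ennreal (cmod (\<mu> F)))" by (rule sum.distrib)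
        also have "\<dots> \<le> emeasure (total_variation \<nu>) E + emeasure (total_variation \<mu>) E"
          unfolding emeasure_total_variation[OF lca(1) E] emeasure_total_variation[OF lca(2) E]
          by (intro add_mono SUP_upper P)
        finally show "(\<Sum>F\<in>P. ennreal (cmod ((\<nu> + \<mu>) F))) \<le> emeasure (total_variation \<nu>) E + emeasure (total_variation \<mu>) E" .
      qed
      also have "\<dots> = emeasure Q E"
        unfolding p(3) q(3) Q_def using E m(2) by (simp add: emeasure_density nn_integral_add distrib_right)
      finally show "emeasure (total_variation (\<nu> + \<mu>)) E \<le> emeasure Q E" .
    qed
  qed
  then have "measure_norm w (\<nu> + \<mu>) \<le> (\<integral>\<^sup>+t. ennreal (w t) \<partial>Q)"
    unfolding measure_norm_def by (intro nn_integral_mono_measure) (simp add: sQ)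
  also have "\<dots> = measure_norm w \<nu> + measure_norm w \<mu>"
    unfolding measure_norm_def p(3) q(3) Q_def by (simp add: nn_integral_density nn_integral_add distrib_right)
  finally show ?thesis .
qed

lemma total_variation_uminus: "total_variation (- \<nu>) = total_variation \<nu>"
  by (simp add: total_variation_def)

lemma total_variation_zero: "emeasure (total_variation 0) E = 0"
proof (cases "E \<in> sets borel_plus")
  case True
  have "locally_countably_additive (0 :: real set \<Rightarrow> complex)" by (simp add: locally_countably_additive_def)
  from emeasure_total_variation[OF this True] show ?thesis by (simp add: SUP_constant bot_ennreal)
qed (simp add: emeasure_notin_sets)

lemma measure_norm_zero: "measure_norm w 0 = 0"
proof -
  have "total_variation 0 = null_measure borel_plus"
    by (rule measure_eqI) (auto simp: total_variation_zero)
  then show ?thesis by (simp add: measure_norm_def)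
qed

lemma norm_le_total_variation:
  assumes "finite_variation \<nu>" "E \<in> bounded_borel"
  shows "ennreal (cmod (\<nu> E)) \<le> emeasure (total_variation \<nu>) E"
proof -
  have lca: "locally_countably_additive \<nu>" using assms by (simp add: finite_variation_def locally_finite_measure_alt)
  have "(\<Sum>F\<in>{E}. ennreal (cmod (\<nu> F))) \<le> emeasure (total_variation \<nu>) E"
    unfolding emeasure_total_variation[OF lca bounded_borel_sets[OF assms(2)]]
    using assms(2) by (intro SUP_upper) auto
  then show ?thesis by simp
qed

section \<open>Weight sequences\<close>

lemma one_le_ennreal_mult:
  assumes "0 < C" "1 \<le> C * x" shows "1 \<le> ennreal C * ennreal x"
proof -
  have "ennreal 1 \<le> ennreal (C * x)" using assms(2) by (rule ennreal_leI)
  then show ?thesis using assms(1) by (simp add: ennreal_mult')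
qed

text \<open>Submultiplicativity of the weight bounds the integrand by a product of functions of one
  variable each, to which Tonelli applies. This is the submultiplicativity of the weighted norm
  under convolution.\<close>

lemma nn_integral_tensor_weight_le:
  fixes H :: "'a \<Rightarrow> complex" and K :: "'b \<Rightarrow> complex"
  assumes "sigma_finite_measure N" and [measurable]: "H \<in> borel_measurable M" "K \<in> borel_measurable N"
    and T: "T \<in> measurable M borel_plus" and S: "S \<in> measurable N borel_plus"
    and w: "w \<in> borel_measurable borel_plus" "\<And>s t. 0 \<le> s \<Longrightarrow> 0 \<le> t \<Longrightarrow> w (s + t) \<le> w s * w t"
    and w0: "\<And>t. 0 \<le> t \<Longrightarrow> 0 \<le> (w t :: real)"
  shows "(\<integral>\<^sup>+z. ennreal (cmod (H (fst z) * K (snd z))) * ennreal (w (T (fst z) + S (snd z))) \<partial>(M \<Otimes>\<^sub>M N)) \<le>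
    (\<integral>\<^sup>+x. ennreal (cmod (H x)) * ennreal (w (T x)) \<partial>M) * (\<integral>\<^sup>+y. ennreal (cmod (K y)) * ennreal (w (S y)) \<partial>N)"
proof -
  interpret N: sigma_finite_measure N by fact
  note T[measurable] S[measurable] w(1)[measurable]
  have pos: "0 \<le> T x" "0 \<le> S y" if "x \<in> space M" "y \<in> space N" for x y
    using measurable_space[OF T that(1)] measurable_space[OF S that(2)] by (auto simp: space_borel_plus)
  have "(\<integral>\<^sup>+z. ennreal (cmod (H (fst z) * K (snd z))) * ennreal (w (T (fst z) + S (snd z))) \<partial>(M \<Otimes>\<^sub>M N)) \<le>
      (\<integral>\<^sup>+z. (ennreal (cmod (H (fst z))) * ennreal (w (T (fst z)))) * (ennreal (cmod (K (snd z))) * ennreal (w (S (snd z)))) \<partial>(M \<Otimes>\<^sub>M N))"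
  proof (rule nn_integral_mono)
    fix z assume "z \<in> space (M \<Otimes>\<^sub>M N)"
    then have p: "0 \<le> T (fst z)" "0 \<le> S (snd z)" using pos by (auto simp: space_pair_measure)
    have "cmod (H (fst z) * K (snd z)) * w (T (fst z) + S (snd z)) \<le> cmod (H (fst z) * K (snd z)) * (w (T (fst z)) * w (S (snd z)))"
      by (intro mult_left_mono w p) simp
    also have "\<dots> = (cmod (H (fst z)) * w (T (fst z))) * (cmod (K (snd z)) * w (S (snd z)))"
      by (simp add: norm_mult)
    finally show "ennreal (cmod (H (fst z) * K (snd z))) * ennreal (w (T (fst z) + S (snd z))) \<le>
      (ennreal (cmod (H (fst z))) * ennreal (w (T (fst z)))) * (ennreal (cmod (K (snd z))) * ennreal (w (S (snd z))))"
      using p w0 by (simp add: ennreal_leI flip: ennreal_mult)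
  qed
  also have "\<dots> = (\<integral>\<^sup>+x. ennreal (cmod (H x)) * ennreal (w (T x)) \<partial>M) * (\<integral>\<^sup>+y. ennreal (cmod (K y)) * ennreal (w (S y)) \<partial>N)"
    by (subst N.nn_integral_fst[symmetric]) (auto simp: nn_integral_cmult nn_integral_multc)
  finally show ?thesis .
qed

locale weight_sequence =
  fixes \<omega> :: "nat \<Rightarrow> real \<Rightarrow> real"
  assumes weights: "\<And>n. algebra_weight (\<omega> n)"
    and increasing: "\<And>n t. 0 \<le> t \<Longrightarrow> \<omega> n t \<le> \<omega> (Suc n) t"
    and tends_infinity: "\<And>n. filterlim (\<omega> n) at_top at_top"
    and ratio_limit: "\<And>n. \<exists>m. ((\<lambda>t. t * \<omega> n t / \<omega> m t) \<longlongrightarrow> 0) at_top"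
begin

lemma weight_measurable [measurable]: "\<omega> n \<in> borel_measurable borel_plus"
  and weight_pos: "0 \<le> t \<Longrightarrow> 0 < \<omega> n t"
  and weight_submult: "0 \<le> s \<Longrightarrow> 0 \<le> t \<Longrightarrow> \<omega> n (s + t) \<le> \<omega> n s * \<omega> n t"
  using weights[of n] by (auto simp: algebra_weight_def)

lemma weight_nonneg: "0 \<le> t \<Longrightarrow> 0 \<le> \<omega> n t"
  using weight_pos[of t n] by simp

lemma weight_bounded: obtains K where "0 < K" "\<And>t. 0 \<le> t \<Longrightarrow> t \<le> b \<Longrightarrow> \<omega> n t \<le> K"
proof -
  have "bounded (\<omega> n ` {0..b})" using weights[of n] by (simp add: algebra_weight_def)
  then obtain K where "\<forall>x\<in>\<omega> n ` {0..b}. norm x \<le> K" by (auto simp: bounded_iff)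
  then have "norm (\<omega> n t) \<le> K" if "0 \<le> t" "t \<le> b" for t using that by auto
  then have "\<omega> n t \<le> max K 1" if "0 \<le> t" "t \<le> b" for t using that abs_ge_self[of "\<omega> n t"]
    unfolding real_norm_def by (meson max.coboundedI1 order_trans)
  then show ?thesis by (intro that[of "max K 1"]) auto
qed

lemma inverse_weight_bounded: obtains K where "0 < K" "\<And>t. 0 \<le> t \<Longrightarrow> t \<le> b \<Longrightarrow> 1 \<le> K * \<omega> n t"
proof -
  have "bounded ((\<lambda>t. 1 / \<omega> n t) ` {0..b})" using weights[of n] by (simp add: algebra_weight_def)
  then obtain K where K: "\<forall>x\<in>(\<lambda>t. 1 / \<omega> n t) ` {0..b}. norm x \<le> K" by (auto simp: bounded_iff)
  have "1 \<le> max K 1 * \<omega> n t" if "0 \<le> t" "t \<le> b" for t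
  proof -
    have "norm (1 / \<omega> n t) \<le> K" by (rule K[rule_format]) (use that in auto)
    then have "1 / \<omega> n t \<le> max K 1" using abs_ge_self[of "1 / \<omega> n t"] unfolding real_norm_def by linarith
    then show ?thesis using weight_pos[of t n] that by (simp add: divide_le_eq)
  qed
  then show ?thesis by (intro that[of "max K 1"]) auto
qed

text \<open>Far out the weight is at least 1 because it tends to infinity, and on a bounded interval
  1/w is bounded. Consequently every weighted norm dominates the total mass.\<close>

lemma weight_lower_bound: obtains C where "0 < C" "\<And>t. 0 \<le> t \<Longrightarrow> 1 \<le> C * \<omega> n t"
proof -
  have "eventually (\<lambda>t. 1 \<le> \<omega> n t) at_top" using tends_infinity[of n] by (simp add: filterlim_at_top)
  then obtain b where b: "\<And>t. b \<le> t \<Longrightarrow> 1 \<le> \<omega> n t" by (auto simp: eventually_at_top_linorder)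
  obtain K where K: "0 < K" "\<And>t. 0 \<le> t \<Longrightarrow> t \<le> b \<Longrightarrow> 1 \<le> K * \<omega> n t" by (rule inverse_weight_bounded[of b n]) (rule that)
  have "1 \<le> max K 1 * \<omega> n t" if "0 \<le> t" for t
  proof (cases "t \<le> b")
    case True
    have "K * \<omega> n t \<le> max K 1 * \<omega> n t" by (intro mult_right_mono) (use weight_nonneg[OF that] in auto)
    with K(2)[OF that True] show ?thesis by linarith
  next
    case False
    have "1 * \<omega> n t \<le> max K 1 * \<omega> n t" by (intro mult_right_mono) (use weight_nonneg[OF that] in auto)
    with b[of t] False show ?thesis by linarith
  qed
  then show ?thesis by (intro that[of "max K 1"]) auto
qed

text \<open>Beyond some \<open>b\<close> the ratio in the hypothesis is below 1; on [0, b] the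
  weights and their inverses are bounded. The estimate makes X continuous from the m-th norm to the
  n-th.\<close>

lemma weight_moment: obtains m C where "0 < C" "\<And>t. 0 \<le> t \<Longrightarrow> t * \<omega> n t \<le> C * \<omega> m t"
proof -
  obtain m where "((\<lambda>t. t * \<omega> n t / \<omega> m t) \<longlongrightarrow> 0) at_top" using ratio_limit by blast
  then have "eventually (\<lambda>t. t * \<omega> n t / \<omega> m t < 1) at_top" by (rule order_tendstoD) simp
  then obtain b where b: "\<And>t. b \<le> t \<Longrightarrow> t * \<omega> n t / \<omega> m t < 1" by (auto simp: eventually_at_top_linorder)
  obtain K where K: "0 < K" "\<And>t. 0 \<le> t \<Longrightarrow> t \<le> b \<Longrightarrow> \<omega> n t \<le> K" by (rule weight_bounded[of b n]) (rule that)
  obtain L where L: "0 < L" "\<And>t. 0 \<le> t \<Longrightarrow> t \<le> b \<Longrightarrow> 1 \<le> L * \<omega> m t" by (rule inverse_weight_bounded[of b m]) (rule that)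
  \<comment> \<open>The value 1 serves for t beyond \<open>b\<close>, and \<open>b * K * L\<close>
    serves on [0, b].\<close>
  define C where "C = max 1 (b * K * L)"
  have "t * \<omega> n t \<le> C * \<omega> m t" if t: "0 \<le> t" for t
  proof (cases "t \<le> b")
    case True
    have "t * \<omega> n t \<le> b * K" using True t K weight_nonneg[OF t, of n] by (intro mult_mono) auto
    also have "\<dots> \<le> b * K * (L * \<omega> m t)"
    proof -
      have "0 \<le> b * K" using True t K(1) by simp
      from mult_left_mono[OF L(2)[OF t True] this] show ?thesis by simp
    qed
    also have "\<dots> \<le> C * \<omega> m t"
      unfolding mult.assoc[symmetric] C_def by (intro mult_right_mono weight_nonneg t) simp
    finally show ?thesis .
  next
    case False
    then have "t * \<omega> n t \<le> 1 * \<omega> m t" using b[of t] weight_pos[OF t, of m] by (simp add: divide_less_eq)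
    also have "\<dots> \<le> C * \<omega> m t" unfolding C_def by (intro mult_right_mono weight_nonneg t) simp
    finally show ?thesis .
  qed
  then show ?thesis by (intro that[of C m]) (auto simp: C_def)
qed

lemma finite_variation_M_space:
  assumes "locally_finite_measure \<nu>" "measure_norm (\<omega> n) \<nu> < \<infinity>" shows "finite_variation \<nu>"
  unfolding finite_variation_def
proof
  obtain C where C: "0 < C" "\<And>t. 0 \<le> t \<Longrightarrow> 1 \<le> C * \<omega> n t" by (rule weight_lower_bound[of n]) (rule that)
  have [measurable]: "\<omega> n \<in> borel_measurable (total_variation \<nu>)"
    using weight_measurable[of n] by (simp add: measurable_cong_sets[OF sets_total_variation refl])
  have "emeasure (total_variation \<nu>) {0..} = (\<integral>\<^sup>+t. 1 \<partial>total_variation \<nu>)" by simp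
  also have "\<dots> \<le> (\<integral>\<^sup>+t. ennreal C * ennreal (\<omega> n t) \<partial>total_variation \<nu>)"
    using C by (intro nn_integral_mono) (auto intro!: one_le_ennreal_mult)
  also have "\<dots> = ennreal C * measure_norm (\<omega> n) \<nu>"
    unfolding measure_norm_def by (rule nn_integral_cmult) simp
  also have "\<dots> < \<infinity>" using assms(2) by (simp add: ennreal_mult_less_top)
  finally show "emeasure (total_variation \<nu>) {0..} < \<infinity>" .
qed (rule assms)

section \<open>The space B(\<omega>) and its algebra structure\<close>

abbreviation "B \<equiv> space_of (B_algebra \<omega>)"

lemma B_iff: "\<nu> \<in> B \<longleftrightarrow> locally_finite_measure \<nu> \<and> (\<forall>n. measure_norm (\<omega> n) \<nu> < \<infinity>)"
  by (auto simp: B_algebra_def M_space_def)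

lemma B_finite_variation: "\<nu> \<in> B \<Longrightarrow> finite_variation \<nu>"
  using finite_variation_M_space by (auto simp: B_iff)

lemma snorm_B: "snorm (B_algebra \<omega>) n \<nu> = enn2real (measure_norm (\<omega> n) \<nu>)"
  by (simp add: B_algebra_def)

lemma ennreal_snorm_B: "\<nu> \<in> B \<Longrightarrow> ennreal (snorm (B_algebra \<omega>) n \<nu>) = measure_norm (\<omega> n) \<nu>"
  by (simp add: snorm_B B_iff)

lemma B_bound:
  assumes r: "represents \<nu> M T H"
  shows "measure_norm (\<omega> n) \<nu> \<le> (\<integral>\<^sup>+x. ennreal (cmod (H x)) * ennreal (\<omega> n (T x)) \<partial>M)"
  unfolding measure_norm_def by (rule nn_integral_total_variation_le[OF r]) simp

lemma B_memI:
  assumes r: "represents \<nu> M T H"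
    and "\<And>n. (\<integral>\<^sup>+x. ennreal (cmod (H x)) * ennreal (\<omega> n (T x)) \<partial>M) < \<infinity>"
  shows "\<nu> \<in> B"
  using locally_finite_measure_represents[OF r] B_bound[OF r] assms(2) by (auto simp: B_iff intro: le_less_trans)

lemma nn_integral_moment_le:
  assumes "\<And>t. 0 \<le> t \<Longrightarrow> t * \<omega> n t \<le> C * \<omega> m t" "0 \<le> C" and T: "T \<in> measurable M borel_plus" and [measurable]: "H \<in> borel_measurable M"
  shows "(\<integral>\<^sup>+x. ennreal (cmod (complex_of_real (T x) * H x)) * ennreal (\<omega> n (T x)) \<partial>M) \<le>
    ennreal C * (\<integral>\<^sup>+x. ennreal (cmod (H x)) * ennreal (\<omega> m (T x)) \<partial>M)"
proof -
  note T[measurable]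
  have "(\<integral>\<^sup>+x. ennreal (cmod (complex_of_real (T x) * H x)) * ennreal (\<omega> n (T x)) \<partial>M) \<le>
      (\<integral>\<^sup>+x. ennreal C * (ennreal (cmod (H x)) * ennreal (\<omega> m (T x))) \<partial>M)"
  proof (rule nn_integral_mono)
    fix x assume "x \<in> space M"
    then have p: "0 \<le> T x" using measurable_space[OF T] by (auto simp: space_borel_plus)
    have "cmod (H x) * (T x * \<omega> n (T x)) \<le> cmod (H x) * (C * \<omega> m (T x))"
      by (intro mult_left_mono assms p) simp
    then show "ennreal (cmod (complex_of_real (T x) * H x)) * ennreal (\<omega> n (T x)) \<le>
      ennreal C * (ennreal (cmod (H x)) * ennreal (\<omega> m (T x)))"
      using p weight_nonneg[OF p] assms(2) by (simp add: norm_mult ennreal_leI ac_simps flip: ennreal_mult)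
  qed
  also have "\<dots> = ennreal C * (\<integral>\<^sup>+x. ennreal (cmod (H x)) * ennreal (\<omega> m (T x)) \<partial>M)"
    by (rule nn_integral_cmult) measurable
  finally show ?thesis .
qed

lemma integrable_of_weight:
  assumes T: "T \<in> measurable M borel_plus" and H: "H \<in> borel_measurable M"
    and fin: "(\<integral>\<^sup>+x. ennreal (cmod (H x)) * ennreal (\<omega> n (T x)) \<partial>M) < \<infinity>"
  shows "integrable M (H :: _ \<Rightarrow> complex)"
  unfolding integrable_iff_bounded
proof
  note T[measurable] H[measurable]
  obtain C where C: "0 < C" "\<And>t. 0 \<le> t \<Longrightarrow> 1 \<le> C * \<omega> n t" by (rule weight_lower_bound[of n]) (rule that)
  have "(\<integral>\<^sup>+x. ennreal (cmod (H x)) \<partial>M) \<le> (\<integral>\<^sup>+x. ennreal C * (ennreal (cmod (H x)) * ennreal (\<omega> n (T x))) \<partial>M)"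
  proof (rule nn_integral_mono)
    fix x assume "x \<in> space M"
    then have p: "0 \<le> T x" using measurable_space[OF T] by (auto simp: space_borel_plus)
    have "cmod (H x) * 1 \<le> cmod (H x) * (C * \<omega> n (T x))" by (intro mult_left_mono C p) simp
    then show "ennreal (cmod (H x)) \<le> ennreal C * (ennreal (cmod (H x)) * ennreal (\<omega> n (T x)))"
      using C(1) weight_nonneg[OF p] by (simp add: ennreal_leI ac_simps flip: ennreal_mult)
  qed
  also have "\<dots> = ennreal C * (\<integral>\<^sup>+x. ennreal (cmod (H x)) * ennreal (\<omega> n (T x)) \<partial>M)"
    by (rule nn_integral_cmult) measurable
  also have "\<dots> < \<infinity>" using fin by (simp add: ennreal_mult_less_top)
  finally show "(\<integral>\<^sup>+x. ennreal (cmod (H x)) \<partial>M) < \<infinity>" .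
qed (rule H)

text \<open>Finiteness is assumed for all indices at once, since the n-th weighted integral after
  multiplication by t is controlled by the original one for another index m.\<close>

lemma integrable_moment:
  assumes r: "represents \<nu> M T H"
    and fin: "\<And>n. (\<integral>\<^sup>+x. ennreal (cmod (H x)) * ennreal (\<omega> n (T x)) \<partial>M) < \<infinity>"
  shows "(\<integral>\<^sup>+x. ennreal (cmod (complex_of_real (T x) * H x)) * ennreal (\<omega> n (T x)) \<partial>M) < \<infinity>"
    and "integrable M (\<lambda>x. complex_of_real (T x) * H x)"
proof -
  note T = representsD(2)[OF r]
  have H: "H \<in> borel_measurable M" using representsD(3)[OF r] by auto
  show *: "(\<integral>\<^sup>+x. ennreal (cmod (complex_of_real (T x) * H x)) * ennreal (\<omega> n (T x)) \<partial>M) < \<infinity>" for n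
  proof -
    obtain m C where C: "0 < C" "\<And>t. 0 \<le> t \<Longrightarrow> t * \<omega> n t \<le> C * \<omega> m t" by (rule weight_moment[of n]) (rule that)
    have "(\<integral>\<^sup>+x. ennreal (cmod (complex_of_real (T x) * H x)) * ennreal (\<omega> n (T x)) \<partial>M) \<le>
      ennreal C * (\<integral>\<^sup>+x. ennreal (cmod (H x)) * ennreal (\<omega> m (T x)) \<partial>M)"
      using C by (intro nn_integral_moment_le[OF _ _ T H]) auto
    also have "\<dots> < \<infinity>" using fin[of m] by (simp add: ennreal_mult_less_top)
    finally show ?thesis .
  qed
  have "(\<lambda>x. complex_of_real (T x) * H x) \<in> borel_measurable M"
    using H measurable_borel_plus_borel[OF T] by measurable
  then show "integrable M (\<lambda>x. complex_of_real (T x) * H x)" by (rule integrable_of_weight[OF T _ *[of 0]])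
qed

lemma B_canonical:
  assumes "\<nu> \<in> B"
  obtains h where "represents \<nu> (total_variation \<nu>) (\<lambda>t. t) h"
    "\<And>n. (\<integral>\<^sup>+t. ennreal (cmod (h t)) * ennreal (\<omega> n t) \<partial>total_variation \<nu>) \<le> 4 * measure_norm (\<omega> n) \<nu>"
    "\<And>n. (\<integral>\<^sup>+t. ennreal (cmod (h t)) * ennreal (\<omega> n t) \<partial>total_variation \<nu>) < \<infinity>"
proof -
  obtain h where h: "represents \<nu> (total_variation \<nu>) (\<lambda>t. t) h"
    "\<And>w. w \<in> borel_measurable borel_plus \<Longrightarrow>
        (\<integral>\<^sup>+t. ennreal (cmod (h t)) * w t \<partial>total_variation \<nu>) \<le> 4 * (\<integral>\<^sup>+t. w t \<partial>total_variation \<nu>)"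
    by (rule finite_variation_canonical[OF B_finite_variation[OF assms]]) (rule that)
  have le: "(\<integral>\<^sup>+t. ennreal (cmod (h t)) * ennreal (\<omega> n t) \<partial>total_variation \<nu>) \<le> 4 * measure_norm (\<omega> n) \<nu>" for n
    unfolding measure_norm_def by (rule h(2)) simp
  moreover have "4 * measure_norm (\<omega> n) \<nu> < \<infinity>" for n
    using assms by (simp add: B_iff ennreal_mult_less_top)
  ultimately show ?thesis using h(1) by (intro that) (auto intro: le_less_trans)
qed

lemma B_X:
  assumes "\<nu> \<in> B" shows "measure_X \<nu> \<in> B"
proof -
  obtain h where h: "represents \<nu> (total_variation \<nu>) (\<lambda>t. t) h"
    "\<And>n. (\<integral>\<^sup>+t. ennreal (cmod (h t)) * ennreal (\<omega> n t) \<partial>total_variation \<nu>) < \<infinity>"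
    by (rule B_canonical[OF assms]) (rule that)
  show ?thesis
    by (rule B_memI[OF represents_X[OF h(1) integrable_moment(2)[OF h]] integrable_moment(1)[OF h]])
qed

lemma B_conv:
  assumes "\<nu> \<in> B" "\<mu> \<in> B" shows "measure_conv \<nu> \<mu> \<in> B"
proof -
  obtain h where h: "represents \<nu> (total_variation \<nu>) (\<lambda>t. t) h"
    "\<And>n. (\<integral>\<^sup>+t. ennreal (cmod (h t)) * ennreal (\<omega> n t) \<partial>total_variation \<nu>) < \<infinity>"
    by (rule B_canonical[OF assms(1)]) (rule that)
  obtain k where k: "represents \<mu> (total_variation \<mu>) (\<lambda>t. t) k"
    "\<And>n. (\<integral>\<^sup>+t. ennreal (cmod (k t)) * ennreal (\<omega> n t) \<partial>total_variation \<mu>) < \<infinity>"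
    by (rule B_canonical[OF assms(2)]) (rule that)
  have "(\<integral>\<^sup>+z. ennreal (cmod (h (fst z) * k (snd z))) * ennreal (\<omega> n (fst z + snd z)) \<partial>(total_variation \<nu> \<Otimes>\<^sub>M total_variation \<mu>)) \<le>
     (\<integral>\<^sup>+t. ennreal (cmod (h t)) * ennreal (\<omega> n t) \<partial>total_variation \<nu>) * (\<integral>\<^sup>+t. ennreal (cmod (k t)) * ennreal (\<omega> n t) \<partial>total_variation \<mu>)" for n
    using representsD(3)[OF h(1)] representsD(3)[OF k(1)]
    by (intro nn_integral_tensor_weight_le[OF representsD(1)[OF k(1)] _ _ representsD(2)[OF h(1)] representsD(2)[OF k(1)]]
        weight_measurable weight_submult weight_nonneg) auto
  moreover have "(\<integral>\<^sup>+t. ennreal (cmod (h t)) * ennreal (\<omega> n t) \<partial>total_variation \<nu>) * (\<integral>\<^sup>+t. ennreal (cmod (k t)) * ennreal (\<omega> n t) \<partial>total_variation \<mu>) < \<infinity>" for n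
    using h(2)[of n] k(2)[of n] by (simp add: ennreal_mult_less_top)
  ultimately show ?thesis by (intro B_memI[OF represents_conv[OF h(1) k(1)]]) (rule le_less_trans)
qed

lemma B_add: assumes "\<nu> \<in> B" "\<mu> \<in> B" shows "\<nu> + \<mu> \<in> B"
proof -
  note fv = assms[THEN B_finite_variation]
  have "measure_norm (\<omega> n) (\<nu> + \<mu>) < \<infinity>" for n
    by (rule le_less_trans[OF measure_norm_add[OF fv weight_measurable]]) (use assms in \<open>simp add: B_iff\<close>)
  then show ?thesis using finite_variation_add[OF fv] by (simp add: B_iff finite_variation_def)
qed

lemma B_scale: assumes "\<nu> \<in> B" shows "(\<lambda>E. c * \<nu> E) \<in> B"
proof -
  obtain h where h: "represents \<nu> (total_variation \<nu>) (\<lambda>t. t) h"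
    "\<And>n. (\<integral>\<^sup>+t. ennreal (cmod (h t)) * ennreal (\<omega> n t) \<partial>total_variation \<nu>) < \<infinity>"
    by (rule B_canonical[OF assms(1)]) (rule that)
  have [measurable]: "h \<in> borel_measurable (total_variation \<nu>)" using representsD(3)[OF h(1)] by auto
  have [measurable]: "\<omega> n \<in> borel_measurable (total_variation \<nu>)" for n
    using weight_measurable[of n] by (simp add: measurable_cong_sets[OF sets_total_variation refl])
  have "(\<integral>\<^sup>+t. ennreal (cmod (c * h t)) * ennreal (\<omega> n t) \<partial>total_variation \<nu>) =
      ennreal (cmod c) * (\<integral>\<^sup>+t. ennreal (cmod (h t)) * ennreal (\<omega> n t) \<partial>total_variation \<nu>)" for n
    by (subst nn_integral_cmult[symmetric]) (auto simp: norm_mult ennreal_mult mult.assoc)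
  then show ?thesis
    using h(2) by (intro B_memI[OF represents_scale[OF h(1)]]) (simp add: ennreal_mult_less_top)
qed

lemma B_zero: "0 \<in> B"
  unfolding B_iff by (simp add: locally_finite_measure_def measure_norm_zero)

lemma B_uminus: "\<nu> \<in> B \<Longrightarrow> - \<nu> \<in> B"
  using B_scale[of \<nu> "-1"] by (simp add: fun_Compl_def)

sublocale B: seminormed_group "B_algebra \<omega>"
proof
  show "snorm (B_algebra \<omega>) n 0 = 0" for n by (simp add: snorm_B measure_norm_zero)
  show "snorm (B_algebra \<omega>) n (\<nu> + \<mu>) \<le> snorm (B_algebra \<omega>) n \<nu> + snorm (B_algebra \<omega>) n \<mu>"
    if "\<nu> \<in> B" "\<mu> \<in> B" for n \<nu> \<mu>
  proof -
    have "ennreal (snorm (B_algebra \<omega>) n (\<nu> + \<mu>)) \<le> ennreal (snorm (B_algebra \<omega>) n \<nu>) + ennreal (snorm (B_algebra \<omega>) n \<mu>)"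
      unfolding ennreal_snorm_B[OF that(1)] ennreal_snorm_B[OF that(2)] ennreal_snorm_B[OF B_add[OF that]]
      by (rule measure_norm_add[OF that[THEN B_finite_variation] weight_measurable])
    then show ?thesis by (simp add: snorm_B flip: ennreal_plus)
  qed
  show "snorm (B_algebra \<omega>) n (- \<nu>) = snorm (B_algebra \<omega>) n \<nu>" for n \<nu>
    by (simp add: snorm_B measure_norm_def total_variation_uminus)
  show "snorm (B_algebra \<omega>) n \<nu> \<le> snorm (B_algebra \<omega>) (Suc n) \<nu>" if "\<nu> \<in> B" for n \<nu>
  proof -
    have "measure_norm (\<omega> n) \<nu> \<le> measure_norm (\<omega> (Suc n)) \<nu>"
      unfolding measure_norm_def by (intro nn_integral_mono ennreal_leI increasing) simp
    then have "ennreal (snorm (B_algebra \<omega>) n \<nu>) \<le> ennreal (snorm (B_algebra \<omega>) (Suc n) \<nu>)"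
      using that by (simp add: ennreal_snorm_B)
    then show ?thesis by (simp add: snorm_B)
  qed
qed (auto intro: B_zero B_add B_uminus)

text \<open>The value on a set is bounded by the total mass, and this by the weighted norm.
  Evaluations at bounded Borel sets are therefore continuous functionals; they separate points, and
  they are the functionals tested in the weak compactness arguments.\<close>

lemma B_evaluation_bound:
  assumes E: "E \<in> bounded_borel"
  obtains C where "\<And>\<nu>. \<nu> \<in> B \<Longrightarrow> cmod (\<nu> E) \<le> C * snorm (B_algebra \<omega>) 0 \<nu>" "0 \<le> C"
proof -
  obtain C where C: "0 < C" "\<And>t. 0 \<le> t \<Longrightarrow> 1 \<le> C * \<omega> 0 t" by (rule weight_lower_bound[of 0]) (rule that)
  have "cmod (\<nu> E) \<le> C * snorm (B_algebra \<omega>) 0 \<nu>" if \<nu>: "\<nu> \<in> B" for \<nu>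
  proof -
    have [measurable]: "\<omega> n \<in> borel_measurable (total_variation \<nu>)" for n
      using weight_measurable[of n] by (simp add: measurable_cong_sets[OF sets_total_variation refl])
    have "ennreal (cmod (\<nu> E)) \<le> emeasure (total_variation \<nu>) E"
      by (rule norm_le_total_variation[OF B_finite_variation[OF \<nu>] E])
    also have "\<dots> \<le> emeasure (total_variation \<nu>) (space (total_variation \<nu>))" by (rule emeasure_space)
    also have "\<dots> = (\<integral>\<^sup>+t. 1 \<partial>total_variation \<nu>)" by simp
    also have "\<dots> \<le> (\<integral>\<^sup>+t. ennreal C * ennreal (\<omega> 0 t) \<partial>total_variation \<nu>)"
      using C by (intro nn_integral_mono) (auto intro!: one_le_ennreal_mult)
    also have "\<dots> = ennreal C * measure_norm (\<omega> 0) \<nu>"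
      unfolding measure_norm_def by (rule nn_integral_cmult) simp
    also have "\<dots> = ennreal (C * snorm (B_algebra \<omega>) 0 \<nu>)"
      using C \<nu> B.snorm_nonneg[OF \<nu>] by (simp add: ennreal_mult ennreal_snorm_B)
    finally show "cmod (\<nu> E) \<le> C * snorm (B_algebra \<omega>) 0 \<nu>"
      using C B.snorm_nonneg[OF \<nu>] by (simp add: ennreal_le_iff)
  qed
  then show ?thesis using C(1) by (intro that[of C]) auto
qed

lemma B_evaluation_dual:
  assumes E: "E \<in> bounded_borel" shows "(\<lambda>\<nu>. \<nu> E) \<in> dual_space (B_algebra \<omega>)"
proof -
  obtain C where C: "\<And>\<nu>. \<nu> \<in> B \<Longrightarrow> cmod (\<nu> E) \<le> C * snorm (B_algebra \<omega>) 0 \<nu>"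
    by (rule B_evaluation_bound[OF E]) (rule that)
  show ?thesis by (rule B.dual_spaceI[OF _ _ C]) (simp_all add: B_algebra_def)
qed

lemma B_separated:
  assumes "\<nu> \<in> B" "\<nu>' \<in> B" "\<nu> \<noteq> \<nu>'"
  shows "\<exists>\<phi>\<in>dual_space (B_algebra \<omega>). \<phi> \<nu> \<noteq> \<phi> \<nu>'"
proof -
  obtain E where E: "\<nu> E \<noteq> \<nu>' E" using assms(3) by blast
  have "\<nu> F = 0" "\<nu>' F = 0" if "F \<notin> bounded_borel" for F
    using assms(1,2) that unfolding B_iff locally_finite_measure_alt by blast+
  with E have "E \<in> bounded_borel" by metis
  then show ?thesis using E by (intro bexI[of _ "\<lambda>\<nu>. \<nu> E"] B_evaluation_dual)
qed

lemma scale_B: "scale (B_algebra \<omega>) c \<nu> = (\<lambda>E. c * \<nu> E)"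
  by (simp add: B_algebra_def)

lemma mult_B: "mult (B_algebra \<omega>) = measure_conv"
  by (simp add: B_algebra_def)

section \<open>The derivation on B(\<omega>)\<close>

lemma linear_operator_D_bar:
  assumes \<mu>: "\<mu> \<in> B" shows "linear_operator (B_algebra \<omega>) (B_algebra \<omega>) (D_bar \<mu>)"
  unfolding linear_operator_def
proof (intro conjI ballI allI)
  show "D_bar \<mu> ` B \<subseteq> B" unfolding D_bar_def using B_conv[OF B_X \<mu>] by blast
  show "D_bar \<mu> (x + y) = D_bar \<mu> x + D_bar \<mu> y" if "x \<in> B" "y \<in> B" for x y
    unfolding D_bar_def using that \<mu>
    by (simp add: measure_X_add measure_conv_add_left B_finite_variation B_X)
  show "D_bar \<mu> (scale (B_algebra \<omega>) c x) = scale (B_algebra \<omega>) c (D_bar \<mu> x)" if "x \<in> B" for c x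
    unfolding D_bar_def scale_B measure_X_scale[OF B_finite_variation[OF that]]
      measure_conv_scale_left[OF B_finite_variation[OF B_X[OF that]] B_finite_variation[OF \<mu>]] ..
qed

lemma D_bar_conv:
  assumes \<mu>: "\<mu> \<in> B" and \<nu>: "\<nu> \<in> B" and \<rho>: "\<rho> \<in> B"
  shows "D_bar \<mu> (measure_conv \<nu> \<rho>) = measure_conv (D_bar \<mu> \<nu>) \<rho> + measure_conv \<nu> (D_bar \<mu> \<rho>)"
proof -
  note fv = B_finite_variation[OF \<mu>] B_finite_variation[OF \<nu>] B_finite_variation[OF \<rho>]
    B_finite_variation[OF B_X[OF \<nu>]] B_finite_variation[OF B_X[OF \<rho>]]
  obtain h where h: "represents \<nu> (total_variation \<nu>) (\<lambda>t. t) h"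
    "\<And>n. (\<integral>\<^sup>+t. ennreal (cmod (h t)) * ennreal (\<omega> n t) \<partial>total_variation \<nu>) < \<infinity>"
    by (rule B_canonical[OF \<nu>]) (rule that)
  obtain k where k: "represents \<rho> (total_variation \<rho>) (\<lambda>t. t) k"
    "\<And>n. (\<integral>\<^sup>+t. ennreal (cmod (k t)) * ennreal (\<omega> n t) \<partial>total_variation \<rho>) < \<infinity>"
    by (rule B_canonical[OF \<rho>]) (rule that)
  have "measure_X (measure_conv \<nu> \<rho>) = measure_conv (measure_X \<nu>) \<rho> + measure_conv \<nu> (measure_X \<rho>)"
    by (rule measure_X_conv[OF h(1) k(1) integrable_moment(2)[OF h] integrable_moment(2)[OF k]])
  then have "D_bar \<mu> (measure_conv \<nu> \<rho>) =
      measure_conv (measure_conv (measure_X \<nu>) \<rho>) \<mu> + measure_conv (measure_conv \<nu> (measure_X \<rho>)) \<mu>"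
    unfolding D_bar_def by (simp add: measure_conv_add_left finite_variation_conv fv)
  \<comment> \<open>In this summand \<mu> has to move past \<rho> to reach X\<nu>, which uses
    commutativity; the other summand needs only associativity.\<close>
  also have "measure_conv (measure_conv (measure_X \<nu>) \<rho>) \<mu> = measure_conv (D_bar \<mu> \<nu>) \<rho>"
    unfolding D_bar_def measure_conv_assoc[OF fv(4,3,1)] measure_conv_assoc[OF fv(4,1,3)]
    by (simp add: measure_conv_commute[OF fv(3,1)])
  also have "measure_conv (measure_conv \<nu> (measure_X \<rho>)) \<mu> = measure_conv \<nu> (D_bar \<mu> \<rho>)"
    unfolding D_bar_def by (rule measure_conv_assoc[OF fv(2,5,1)])
  finally show ?thesis .
qed

lemma derivation_D_bar: "\<mu> \<in> B \<Longrightarrow> derivation (B_algebra \<omega>) (D_bar \<mu>)"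
  unfolding derivation_def using linear_operator_D_bar D_bar_conv by (simp add: mult_B)

end

section \<open>Functions on the half-line\<close>

text \<open>Representatives that vanish on the negative axis: translations and convolutions can then
  be written as integrals over the whole line.\<close>

definition half_line_fun :: "(real \<Rightarrow> complex) \<Rightarrow> bool" where
  "half_line_fun F \<longleftrightarrow> F \<in> borel_measurable borel \<and> (\<forall>t<0. F t = 0)"

lemma half_line_fun_measurable: "half_line_fun F \<Longrightarrow> F \<in> borel_measurable borel"
  and half_line_fun_neg: "half_line_fun F \<Longrightarrow> t < 0 \<Longrightarrow> F t = 0"
  by (simp_all add: half_line_fun_def)

lemma ae_equal_half_line: "half_line_fun F \<Longrightarrow> ae_equal F F"
  by (simp add: ae_equal_def half_line_fun_def measurable_restrict_space1)

lemma abs_ae_fun_cases: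
  obtains F where "half_line_fun F" "f = abs_ae_fun F"
proof (rule ae_fun.abs_induct[of "\<lambda>x. x = f \<longrightarrow> thesis" f, rule_format, OF _ refl])
  fix g assume g: "ae_equal g g" "abs_ae_fun g = f"
  let ?F = "\<lambda>s. indicator {0..} s *\<^sub>R g s"
  have gm: "g \<in> borel_measurable borel_plus" using g(1) by (simp add: ae_equal_def)
  have F: "half_line_fun ?F" using zero_extension_measurable[OF gm] by (simp add: half_line_fun_def)
  have "ae_equal g ?F"
    using gm F unfolding ae_equal_def half_line_fun_def
    by (auto simp: AE_restrict_space_iff intro!: measurable_restrict_space1)
  then have "abs_ae_fun g = abs_ae_fun ?F" using Quotient3_rel[OF Quotient3_ae_fun] by blast
  with F g(2) show thesis using that by simp
qed

text \<open>A representation requires a coordinate map into the half-line. For functions vanishing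
  on the negative axis, \<open>max 0\<close> on \<open>lborel\<close> serves as the identity
  there.\<close>

lemma measurable_max_0: "max 0 \<in> measurable lborel borel_plus"
proof (rule measurable_restrict_space2)
  have "(\<lambda>x::real. max 0 x) \<in> borel_measurable borel" by (intro borel_measurable_max) auto
  then show "max 0 \<in> borel_measurable (lborel :: real measure)" by simp
qed auto

lemma fun_norm_abs:
  assumes F: "half_line_fun F" and w: "\<And>t. 0 \<le> t \<Longrightarrow> 0 \<le> w t"
  shows "fun_norm w (abs_ae_fun F) = (\<integral>\<^sup>+t. ennreal (cmod (F t)) * ennreal (w (max 0 t)) \<partial>lborel)"
  unfolding fun_norm.abs_eq[OF ae_equal_half_line[OF F]]
  by (subst nn_integral_restrict_space)
    (auto intro!: nn_integral_cong simp: indicator_def half_line_fun_neg[OF F] ennreal_mult w max_def)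

lemma represents_fun_measure:
  assumes F: "half_line_fun F" "integrable lborel F"
  shows "represents (fun_measure (abs_ae_fun F)) lborel (max 0) F"
  unfolding represents_def
proof (intro conjI allI F measurable_max_0)
  show "sigma_finite_measure lborel" by (rule lborel.sigma_finite_measure_axioms)
  fix E
  have "set_lebesgue_integral lborel_plus E F = (\<integral>x. indicator E (max 0 x) * F x \<partial>lborel)" if "E \<in> bounded_borel"
    unfolding set_lebesgue_integral_def using bounded_borel_sets[OF that]
    by (subst integral_restrict_space)
      (auto intro!: Bochner_Integration.integral_cong simp: indicator_def max_def half_line_fun_neg[OF F(1)] sets_borel_plus_iff)
  then show "fun_measure (abs_ae_fun F) E = (if E \<in> bounded_borel then \<integral>x. indicator E (max 0 x) * F x \<partial>lborel else 0)"
    by (simp add: fun_measure.abs_eq[OF ae_equal_half_line[OF F(1)]])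
qed

text \<open>Integrating F - G against its conjugate phase gives the L1 norm of F - G. This integrand
  is bounded, so the integral is determined by the measures and hence is 0.\<close>

lemma abs_ae_fun_eqI:
  assumes F: "half_line_fun F" "integrable lborel F" and G: "half_line_fun G" "integrable lborel G"
    and eq: "fun_measure (abs_ae_fun F) = fun_measure (abs_ae_fun G)"
  shows "abs_ae_fun F = abs_ae_fun G"
proof -
  note r = represents_fun_measure[OF F] represents_fun_measure[OF G]
  note [measurable] = half_line_fun_measurable[OF F(1)] half_line_fun_measurable[OF G(1)]
  define D where "D t = F t - G t" for t
  \<comment> \<open>Where \<open>D t\<close> is 0, division by zero makes \<open>\<phi> t\<close>
    equal to 0, so \<open>\<phi>\<close> is bounded by 1 everywhere.\<close>
  define \<phi> where "\<phi> t = cnj (D t) / complex_of_real (cmod (D t))" for t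
  have [measurable]: "D \<in> borel_measurable borel" unfolding D_def by measurable
  have [measurable]: "(\<lambda>t. cnj (D t)) \<in> borel_measurable borel"
    by (rule borel_measurable_continuous_on[of cnj]) (auto intro!: continuous_intros)
  have \<phi>m: "\<phi> \<in> borel_measurable borel" unfolding \<phi>_def by measurable
  have B: "cmod (\<phi> t) \<le> 1" for t by (simp add: \<phi>_def norm_divide)
  have \<phi>D: "\<phi> (max 0 t) * D t = complex_of_real (cmod (D t))" for t
  proof (cases "t < 0")
    case True
    then show ?thesis by (simp add: D_def half_line_fun_neg[OF F(1)] half_line_fun_neg[OF G(1)])
  next
    case False
    then have "max 0 t = t" by simp
    then show ?thesis using complex_norm_square[of "D t"]
      by (cases "D t = 0") (simp_all add: \<phi>_def power2_eq_square mult.commute nonzero_divide_eq_eq)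
  qed
  note \<phi>p = measurable_restrict_space1[OF \<phi>m, of "{0..}"]
  have i: "integrable lborel (\<lambda>t. \<phi> (max 0 t) * F t)" "integrable lborel (\<lambda>t. \<phi> (max 0 t) * G t)"
    using integrable_bounded_mult[OF representsD(2,3)[OF r(1)] \<phi>p B] integrable_bounded_mult[OF representsD(2,3)[OF r(2)] \<phi>p B] by auto
  have "(\<integral>t. complex_of_real (cmod (D t)) \<partial>lborel) = (\<integral>t. \<phi> (max 0 t) * F t \<partial>lborel) - (\<integral>t. \<phi> (max 0 t) * G t \<partial>lborel)"
  proof -
    have "(\<integral>t. complex_of_real (cmod (D t)) \<partial>lborel) = (\<integral>t. \<phi> (max 0 t) * F t - \<phi> (max 0 t) * G t \<partial>lborel)"
      by (intro Bochner_Integration.integral_cong refl) (metis \<phi>D D_def right_diff_distrib)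
    with i show ?thesis by simp
  qed
  also have "(\<integral>t. \<phi> (max 0 t) * F t \<partial>lborel) = (\<integral>t. \<phi> (max 0 t) * G t \<partial>lborel)"
    by (rule represents_unique[OF r _ \<phi>p B]) (simp add: eq)
  finally have "(\<integral>t. cmod (D t) \<partial>lborel) = 0" by simp
  moreover have "integrable lborel (\<lambda>t. cmod (D t))" unfolding D_def using F G by simp
  ultimately have "AE t in lborel. cmod (D t) = 0"
    by (subst (asm) integral_nonneg_eq_0_iff_AE) auto
  then have "AE t in lborel_plus. F t = G t"
    by (subst AE_restrict_space_iff) (auto simp: D_def elim!: eventually_mono)
  then have "ae_equal F G" using ae_equal_half_line[OF F(1)] ae_equal_half_line[OF G(1)] by (simp add: ae_equal_def)
  then show ?thesis using Quotient3_rel[OF Quotient3_ae_fun] by blast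
qed

section \<open>Convolution of a function with a measure\<close>

lemma ennreal_norm_integral_le:
  fixes f :: "'a \<Rightarrow> complex"
  shows "ennreal (cmod (\<integral>x. f x \<partial>M)) \<le> (\<integral>\<^sup>+x. ennreal (cmod (f x)) \<partial>M)"
  by (cases "integrable M f") (auto simp: integral_norm_bound_ennreal not_integrable_integral_eq)

lemma nn_integral_shift: "f \<in> borel_measurable borel \<Longrightarrow> (\<integral>\<^sup>+x. f x \<partial>lborel) = (\<integral>\<^sup>+x. f (t + x) \<partial>lborel)" for t :: real
  using nn_integral_real_affine[of f 1 t] by simp

text \<open>The integral form of the Minkowski inequality for a weighted L1 norm, by
  Tonelli.\<close>

lemma nn_integral_kernel_le:
  fixes Z :: "real \<Rightarrow> 'b \<Rightarrow> complex" and W :: "real \<Rightarrow> ennreal"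
  assumes N: "sigma_finite_measure N" and [measurable]: "(\<lambda>(x, y). Z x y) \<in> borel_measurable (lborel \<Otimes>\<^sub>M N)"
    "K \<in> borel_measurable N" "W \<in> borel_measurable borel"
  shows "(\<integral>\<^sup>+x. ennreal (cmod (\<integral>y. Z x y * K y \<partial>N)) * W x \<partial>lborel) \<le>
    (\<integral>\<^sup>+y. ennreal (cmod (K y)) * (\<integral>\<^sup>+x. ennreal (cmod (Z x y)) * W x \<partial>lborel) \<partial>N)"
proof -
  interpret N: sigma_finite_measure N by (rule N)
  interpret pair_sigma_finite lborel N by unfold_locales
  have "(\<integral>\<^sup>+x. ennreal (cmod (\<integral>y. Z x y * K y \<partial>N)) * W x \<partial>lborel) \<le>
      (\<integral>\<^sup>+x. (\<integral>\<^sup>+y. ennreal (cmod (Z x y * K y)) * W x \<partial>N) \<partial>lborel)"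
    by (intro nn_integral_mono) (simp add: nn_integral_multc mult_right_mono ennreal_norm_integral_le)
  also have "\<dots> = (\<integral>\<^sup>+y. (\<integral>\<^sup>+x. ennreal (cmod (Z x y * K y)) * W x \<partial>lborel) \<partial>N)"
    by (rule Fubini'[symmetric]) measurable
  also have "\<dots> = (\<integral>\<^sup>+y. ennreal (cmod (K y)) * (\<integral>\<^sup>+x. ennreal (cmod (Z x y)) * W x \<partial>lborel) \<partial>N)"
    by (intro nn_integral_cong) (simp add: norm_mult ennreal_mult ac_simps flip: nn_integral_cmult)
  finally show ?thesis .
qed

lemma nn_integral_conv_le:
  fixes F :: "real \<Rightarrow> complex" and W :: "real \<Rightarrow> ennreal"
  assumes N: "sigma_finite_measure N" and [measurable]: "F \<in> borel_measurable borel" "S \<in> borel_measurable N" "K \<in> borel_measurable N"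
    "W \<in> borel_measurable borel"
  shows "(\<integral>\<^sup>+x. ennreal (cmod (\<integral>y. F (x - S y) * K y \<partial>N)) * W x \<partial>lborel) \<le>
    (\<integral>\<^sup>+y. ennreal (cmod (K y)) * (\<integral>\<^sup>+t. ennreal (cmod (F t)) * W (t + S y) \<partial>lborel) \<partial>N)"
proof -
  have "(\<integral>\<^sup>+x. ennreal (cmod (F (x - c))) * W x \<partial>lborel) = (\<integral>\<^sup>+t. ennreal (cmod (F t)) * W (t + c) \<partial>lborel)" for c
    by (subst nn_integral_shift[of _ c]) (auto simp: add.commute)
  moreover have "(\<integral>\<^sup>+x. ennreal (cmod (\<integral>y. F (x - S y) * K y \<partial>N)) * W x \<partial>lborel) \<le>
      (\<integral>\<^sup>+y. ennreal (cmod (K y)) * (\<integral>\<^sup>+x. ennreal (cmod (F (x - S y))) * W x \<partial>lborel) \<partial>N)"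
    by (rule nn_integral_kernel_le[OF N]) measurable
  ultimately show ?thesis by simp
qed

text \<open>The measure enters through an arbitrary representation, so that the same results serve
  for the convolution of a function with an element of B(\<omega>), with another function (on
  \<open>lborel\<close>), and with X\<nu> (with a density carrying the factor t).\<close>

locale fun_measure_conv =
  fixes F :: "real \<Rightarrow> complex" and \<mu> and N :: "'b measure" and S K
  assumes hl: "half_line_fun F" "integrable lborel F" and r: "represents \<mu> N S K"
begin

text \<open>The density of the convolution of F(t) dt with \<mu>. The integral converges absolutely
  for almost every \<open>x\<close>; where it does not, its value is 0 by convention.\<close>

definition G :: "real \<Rightarrow> complex" where "G x = (\<integral>y. F (x - S y) * K y \<partial>N)"

lemma kernel_measurable [measurable]: "F \<in> borel_measurable borel" "S \<in> borel_measurable N" "K \<in> borel_measurable N"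
  using half_line_fun_measurable[OF hl(1)] measurable_borel_plus_borel[OF representsD(2)[OF r]] representsD(3)[OF r] by auto

lemma S_nonneg: "y \<in> space N \<Longrightarrow> 0 \<le> S y"
  using measurable_space[OF representsD(2)[OF r]] by (simp add: space_borel_plus)

lemma half_line_G: "half_line_fun G"
proof -
  interpret N: sigma_finite_measure N by (rule representsD(1)[OF r])
  have "G \<in> borel_measurable borel" unfolding G_def by measurable
  moreover have "G t = 0" if "t < 0" for t
  proof -
    have "F (t - S y) * K y = 0" if "y \<in> space N" for y
      using S_nonneg[OF that] \<open>t < 0\<close> by (simp add: half_line_fun_neg[OF hl(1)])
    then have "(\<integral>y. F (t - S y) * K y \<partial>N) = (\<integral>y. 0 \<partial>N)" by (intro Bochner_Integration.integral_cong refl)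
    then show ?thesis by (simp add: G_def)
  qed
  ultimately show ?thesis by (simp add: half_line_fun_def)
qed

text \<open>Translating the outer variable by \<open>S y\<close> exposes w(t + S y), which
  submultiplicativity splits. The estimate makes A(\<omega>) an ideal of B(\<omega>), and with
  constant weight 1 it gives integrability of \<open>G\<close>.\<close>

lemma G_weight_le:
  assumes w: "w \<in> borel_measurable borel_plus" "\<And>s t. 0 \<le> s \<Longrightarrow> 0 \<le> t \<Longrightarrow> w (s + t) \<le> w s * w t"
    and w0: "\<And>t. 0 \<le> t \<Longrightarrow> 0 \<le> (w t :: real)"
  shows "(\<integral>\<^sup>+t. ennreal (cmod (G t)) * ennreal (w (max 0 t)) \<partial>lborel) \<le>
    (\<integral>\<^sup>+t. ennreal (cmod (F t)) * ennreal (w (max 0 t)) \<partial>lborel) * (\<integral>\<^sup>+y. ennreal (cmod (K y)) * ennreal (w (S y)) \<partial>N)"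
proof -
  have wS[measurable]: "(\<lambda>y. w (S y)) \<in> borel_measurable N"
    using measurable_compose[OF representsD(2)[OF r] w(1)] .
  have wm[measurable]: "(\<lambda>t. w (max 0 t)) \<in> borel_measurable borel"
    using measurable_compose[OF measurable_max_0 w(1)] by simp
  let ?I = "\<integral>\<^sup>+t. ennreal (cmod (F t)) * ennreal (w (max 0 t)) \<partial>lborel"
  have "(\<integral>\<^sup>+t. ennreal (cmod (G t)) * ennreal (w (max 0 t)) \<partial>lborel) \<le>
    (\<integral>\<^sup>+y. ennreal (cmod (K y)) * (\<integral>\<^sup>+t. ennreal (cmod (F t)) * ennreal (w (max 0 (t + S y))) \<partial>lborel) \<partial>N)"
    unfolding G_def by (rule nn_integral_conv_le[OF representsD(1)[OF r]]) measurable
  also have "\<dots> \<le> (\<integral>\<^sup>+y. (ennreal (cmod (K y)) * ennreal (w (S y))) * ?I \<partial>N)"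
  proof (rule nn_integral_mono)
    fix y assume y: "y \<in> space N"
    have "(\<integral>\<^sup>+t. ennreal (cmod (F t)) * ennreal (w (max 0 (t + S y))) \<partial>lborel) \<le>
      (\<integral>\<^sup>+t. ennreal (w (S y)) * (ennreal (cmod (F t)) * ennreal (w (max 0 t))) \<partial>lborel)"
    proof (rule nn_integral_mono)
      fix t :: real
      show "ennreal (cmod (F t)) * ennreal (w (max 0 (t + S y))) \<le> ennreal (w (S y)) * (ennreal (cmod (F t)) * ennreal (w (max 0 t)))"
      proof (cases "t < 0")
        case False
        then have t: "0 \<le> t" "max 0 (t + S y) = t + S y" "max 0 t = t" using S_nonneg[OF y] by auto
        have "cmod (F t) * w (t + S y) \<le> cmod (F t) * (w t * w (S y))" by (intro mult_left_mono w t S_nonneg y) simp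
        then show ?thesis
          using w0[OF t(1)] w0[OF S_nonneg[OF y]] w0[of "t + S y"] t S_nonneg[OF y]
          by (simp add: ennreal_leI ac_simps flip: ennreal_mult)
      qed (simp add: half_line_fun_neg[OF hl(1)])
    qed
    also have "\<dots> = ennreal (w (S y)) * ?I" by (rule nn_integral_cmult) measurable
    finally have "ennreal (cmod (K y)) * (\<integral>\<^sup>+t. ennreal (cmod (F t)) * ennreal (w (max 0 (t + S y))) \<partial>lborel) \<le> ennreal (cmod (K y)) * (ennreal (w (S y)) * ?I)"
      by (rule mult_left_mono) simp
    then show "ennreal (cmod (K y)) * (\<integral>\<^sup>+t. ennreal (cmod (F t)) * ennreal (w (max 0 (t + S y))) \<partial>lborel) \<le> (ennreal (cmod (K y)) * ennreal (w (S y))) * ?I"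
      by (simp add: mult.assoc)
  qed
  also have "\<dots> = ?I * (\<integral>\<^sup>+y. ennreal (cmod (K y)) * ennreal (w (S y)) \<partial>N)"
    by (simp add: nn_integral_multc mult.commute)
  finally show ?thesis .
qed

lemma integrable_G: "integrable lborel G"
  unfolding integrable_iff_bounded
proof
  show "G \<in> borel_measurable lborel" using half_line_fun_measurable[OF half_line_G] by simp
  have "(\<integral>\<^sup>+t. ennreal (cmod (G t)) \<partial>lborel) \<le> (\<integral>\<^sup>+t. ennreal (cmod (F t)) \<partial>lborel) * (\<integral>\<^sup>+y. ennreal (cmod (K y)) \<partial>N)"
    using G_weight_le[of "\<lambda>_. 1"] by simp
  also have "\<dots> < \<infinity>"
    using hl(2) representsD(3)[OF r] by (simp add: integrable_iff_bounded ennreal_mult_less_top)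
  finally show "(\<integral>\<^sup>+t. ennreal (cmod (G t)) \<partial>lborel) < \<infinity>" .
qed

text \<open>Tonelli and translation invariance. This justifies the exchange of integrals below and
  gives absolute convergence of the integral in \<open>G\<close> almost everywhere.\<close>

lemma integrable_pair: "integrable (lborel \<Otimes>\<^sub>M N) (\<lambda>z. F (fst z - S (snd z)) * K (snd z))"
proof -
  interpret N: sigma_finite_measure N by (rule representsD(1)[OF r])
  interpret pair_sigma_finite lborel N by unfold_locales
  have "(\<integral>\<^sup>+z. ennreal (cmod (F (fst z - S (snd z)) * K (snd z))) \<partial>(lborel \<Otimes>\<^sub>M N)) =
     (\<integral>\<^sup>+y. (\<integral>\<^sup>+x. ennreal (cmod (F (x - S y) * K y)) \<partial>lborel) \<partial>N)"
    by (subst nn_integral_snd[symmetric]) auto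
  also have "\<dots> = (\<integral>\<^sup>+y. ennreal (cmod (K y)) * (\<integral>\<^sup>+t. ennreal (cmod (F t)) \<partial>lborel) \<partial>N)"
  proof (intro nn_integral_cong)
    fix y
    have "(\<integral>\<^sup>+x. ennreal (cmod (F (x - S y) * K y)) \<partial>lborel) = (\<integral>\<^sup>+x. ennreal (cmod (K y)) * ennreal (cmod (F x)) \<partial>lborel)"
      by (subst nn_integral_shift[of _ "S y"]) (auto simp: norm_mult ennreal_mult ac_simps)
    also have "\<dots> = ennreal (cmod (K y)) * (\<integral>\<^sup>+t. ennreal (cmod (F t)) \<partial>lborel)"
      by (rule nn_integral_cmult) measurable
    finally show "(\<integral>\<^sup>+x. ennreal (cmod (F (x - S y) * K y)) \<partial>lborel) = ennreal (cmod (K y)) * (\<integral>\<^sup>+t. ennreal (cmod (F t)) \<partial>lborel)" .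
  qed
  also have "\<dots> = (\<integral>\<^sup>+y. ennreal (cmod (K y)) \<partial>N) * (\<integral>\<^sup>+t. ennreal (cmod (F t)) \<partial>lborel)"
    by (rule nn_integral_multc) measurable
  also have "\<dots> < \<infinity>"
    using hl(2) representsD(3)[OF r] by (simp add: integrable_iff_bounded ennreal_mult_less_top)
  finally show ?thesis by (simp add: integrable_iff_bounded)
qed

text \<open>It suffices to compare intervals. Exchanging the integrals and substituting x = S y + t
  produces the product representation with the measure as first factor; commutativity restores the
  order.\<close>

lemma fun_measure_G: "fun_measure (abs_ae_fun G) = measure_conv (fun_measure (abs_ae_fun F)) \<mu>"
proof (rule represents_eqI[OF represents_fun_measure[OF half_line_G integrable_G] represents_conv[OF represents_fun_measure[OF hl] r]])
  interpret N: sigma_finite_measure N by (rule representsD(1)[OF r])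
  interpret pair_sigma_finite lborel N by unfold_locales
  fix y :: real
  let ?E = "{0..<y}"
  note E = bounded_borel_interval[of y]
  note ind[measurable] = indicator_bounded_borel_measurable[OF E]
  have int: "integrable (lborel \<Otimes>\<^sub>M N) (\<lambda>(x, y). indicator ?E (max 0 x) * (F (x - S y) * K y))"
  proof (rule Bochner_Integration.integrable_bound[OF integrable_pair])
    show "AE z in lborel \<Otimes>\<^sub>M N. norm (case z of (x, y) \<Rightarrow> indicator ?E (max 0 x) * (F (x - S y) * K y)) \<le> norm (F (fst z - S (snd z)) * K (snd z))"
      by (intro AE_I2) (auto simp: norm_mult indicator_def)
  qed measurable
  have "fun_measure (abs_ae_fun G) ?E = (\<integral>x. indicator ?E (max 0 x) * G x \<partial>lborel)"
    by (rule representsD(4)[OF represents_fun_measure[OF half_line_G integrable_G] E])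
  also have "\<dots> = (\<integral>x. (\<integral>y. indicator ?E (max 0 x) * (F (x - S y) * K y) \<partial>N) \<partial>lborel)"
    unfolding G_def by simp
  also have "\<dots> = (\<integral>y. (\<integral>x. indicator ?E (max 0 x) * (F (x - S y) * K y) \<partial>lborel) \<partial>N)"
    by (rule Fubini_integral[OF int, symmetric])
  also have "\<dots> = (\<integral>y. (\<integral>t. indicator ?E (S y + max 0 t) * F t \<partial>lborel) * K y \<partial>N)"
  proof (intro Bochner_Integration.integral_cong refl)
    fix y assume y: "y \<in> space N"
    have "(\<integral>x. indicator ?E (max 0 x) * (F (x - S y) * K y) \<partial>lborel) = (\<integral>x. indicator ?E (max 0 (S y + x)) * F x * K y \<partial>lborel)"
      by (subst lborel_integral_real_affine[of 1 _ "S y"]) (auto simp: mult.assoc)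
    \<comment> \<open>The two arguments differ only for negative \<open>x\<close>, where
      \<open>F\<close> vanishes.\<close>
    also have "\<dots> = (\<integral>x. indicator ?E (S y + max 0 x) * F x * K y \<partial>lborel)"
    proof (intro Bochner_Integration.integral_cong refl)
      fix x :: real
      show "indicator ?E (max 0 (S y + x)) * F x * K y = indicator ?E (S y + max 0 x) * F x * K y"
        by (cases "x < 0") (use S_nonneg[OF y] in \<open>auto simp: half_line_fun_neg[OF hl(1)] max_def\<close>)
    qed
    finally show "(\<integral>x. indicator ?E (max 0 x) * (F (x - S y) * K y) \<partial>lborel) = (\<integral>t. indicator ?E (S y + max 0 t) * F t \<partial>lborel) * K y"
      by simp
  qed
  also have "\<dots> = (\<integral>z. indicator ?E (S (fst z) + max 0 (snd z)) * (K (fst z) * F (snd z)) \<partial>(N \<Otimes>\<^sub>M lborel))"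
    by (rule integral_tensor_shift(2)[OF representsD(1)[OF r] lborel.sigma_finite_measure_axioms representsD(3)[OF r] hl(2) _ _ ind cmod_indicator_le, symmetric])
      measurable
  also have "\<dots> = measure_conv \<mu> (fun_measure (abs_ae_fun F)) ?E"
    by (rule representsD(4)[OF represents_conv[OF r represents_fun_measure[OF hl]] E, symmetric])
  also have "\<dots> = measure_conv (fun_measure (abs_ae_fun F)) \<mu> ?E"
    by (simp add: measure_conv_commute[OF finite_variation_represents[OF r] finite_variation_represents[OF represents_fun_measure[OF hl]]])
  finally show "fun_measure (abs_ae_fun G) ?E = measure_conv (fun_measure (abs_ae_fun F)) \<mu> ?E" .
qed

end

context weight_sequence
begin

section \<open>The space A(\<omega>) and its embedding into B(\<omega>)\<close>

abbreviation lborel_norm :: "nat \<Rightarrow> (real \<Rightarrow> complex) \<Rightarrow> ennreal" where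
  "lborel_norm n F \<equiv> (\<integral>\<^sup>+t. ennreal (cmod (F t)) * ennreal (\<omega> n (max 0 t)) \<partial>lborel)"

abbreviation "A \<equiv> space_of (A_algebra \<omega>)"

lemma A_iff: "f \<in> A \<longleftrightarrow> (\<forall>n. fun_norm (\<omega> n) f < \<infinity>)"
  by (simp add: A_algebra_def L1_space_def)

lemma snorm_A: "snorm (A_algebra \<omega>) n f = enn2real (fun_norm (\<omega> n) f)"
  and scale_A: "scale (A_algebra \<omega>) = fun_scale"
  and mult_A: "mult (A_algebra \<omega>) = fun_conv"
  by (simp_all add: A_algebra_def)

lemma ennreal_snorm_A: "f \<in> A \<Longrightarrow> ennreal (snorm (A_algebra \<omega>) n f) = fun_norm (\<omega> n) f"
  by (simp add: snorm_A A_iff)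

lemma fun_norm_weight:
  "half_line_fun F \<Longrightarrow> fun_norm (\<omega> n) (abs_ae_fun F) = (lborel_norm n F)"
  by (rule fun_norm_abs) (auto intro: weight_nonneg)

lemma weight_max_measurable [measurable]: "(\<lambda>t. \<omega> n (max 0 t)) \<in> borel_measurable borel"
  using measurable_compose[OF measurable_max_0 weight_measurable[of n]] by simp

lemma A_integrable:
  assumes F: "half_line_fun F" and A: "abs_ae_fun F \<in> A"
  shows "integrable lborel F"
  using A half_line_fun_measurable[OF F] unfolding A_iff fun_norm_weight[OF F]
  by (intro integrable_of_weight[OF measurable_max_0, of _ 0]) auto

lemma A_cases:
  assumes "f \<in> A"
  obtains F where "half_line_fun F" "f = abs_ae_fun F" "integrable lborel F"
    "\<And>n. (lborel_norm n F) < \<infinity>"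
proof -
  obtain F where F: "half_line_fun F" "f = abs_ae_fun F" by (rule abs_ae_fun_cases)
  have fin: "(lborel_norm n F) < \<infinity>" for n
    using assms unfolding A_iff F(2) fun_norm_weight[OF F(1)] by blast
  show ?thesis by (rule that[OF F A_integrable[OF F(1)] fin]) (use assms F in simp)
qed

lemma A_memI:
  assumes F: "half_line_fun F" "\<And>n. (lborel_norm n F) < \<infinity>"
  shows "abs_ae_fun F \<in> A"
  unfolding A_iff fun_norm_weight[OF F(1)] using F(2) by blast

lemma fun_measure_norm_le: "f \<in> A \<Longrightarrow> measure_norm (\<omega> n) (fun_measure f) \<le> fun_norm (\<omega> n) f"
proof (elim A_cases)
  fix F assume F: "half_line_fun F" "f = abs_ae_fun F" "integrable lborel F"
  show ?thesis unfolding F(2) fun_norm_weight[OF F(1)] by (rule B_bound[OF represents_fun_measure[OF F(1,3)]])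
qed

lemma fun_measure_B: "f \<in> A \<Longrightarrow> fun_measure f \<in> B"
proof (elim A_cases)
  fix F assume F: "half_line_fun F" "f = abs_ae_fun F" "integrable lborel F"
    "\<And>n. (lborel_norm n F) < \<infinity>"
  show ?thesis unfolding F(2) by (rule B_memI[OF represents_fun_measure[OF F(1,3)] F(4)])
qed

lemma fun_measure_inj:
  assumes "f \<in> A" "g \<in> A" "fun_measure f = fun_measure g" shows "f = g"
proof -
  obtain F where F: "half_line_fun F" "f = abs_ae_fun F" "integrable lborel F" by (rule A_cases[OF assms(1)]) (rule that)
  obtain G where G: "half_line_fun G" "g = abs_ae_fun G" "integrable lborel G" by (rule A_cases[OF assms(2)]) (rule that)
  show ?thesis using abs_ae_fun_eqI[OF F(1,3) G(1,3)] assms(3) by (simp add: F(2) G(2))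
qed

lemma half_line_fun_add: "half_line_fun F \<Longrightarrow> half_line_fun G \<Longrightarrow> half_line_fun (\<lambda>t. F t + G t)"
  and half_line_fun_scale: "half_line_fun F \<Longrightarrow> half_line_fun (\<lambda>t. c * F t)"
  by (auto simp: half_line_fun_def)

lemma fun_norm_add: "fun_norm (\<omega> n) (f + g) \<le> fun_norm (\<omega> n) f + fun_norm (\<omega> n) g"
proof -
  obtain F where F: "half_line_fun F" "f = abs_ae_fun F" by (rule abs_ae_fun_cases)
  obtain G where G: "half_line_fun G" "g = abs_ae_fun G" by (rule abs_ae_fun_cases)
  note [measurable] = half_line_fun_measurable[OF F(1)] half_line_fun_measurable[OF G(1)]
  have "fun_norm (\<omega> n) (f + g) \<le> (\<integral>\<^sup>+t. ennreal (cmod (F t)) * ennreal (\<omega> n (max 0 t)) + ennreal (cmod (G t)) * ennreal (\<omega> n (max 0 t)) \<partial>lborel)"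
    unfolding F(2) G(2) plus_ae_fun.abs_eq[OF ae_equal_half_line[OF F(1)] ae_equal_half_line[OF G(1)]]
      fun_norm_weight[OF half_line_fun_add[OF F(1) G(1)]] distrib_right[symmetric]
    by (intro nn_integral_mono mult_right_mono) (simp_all add: norm_triangle_ineq flip: ennreal_plus)
  then show ?thesis
    unfolding F(2) G(2) fun_norm_weight[OF F(1)] fun_norm_weight[OF G(1)] by (subst (asm) nn_integral_add) auto
qed

lemma fun_norm_scale: "fun_norm (\<omega> n) (fun_scale c f) = ennreal (cmod c) * fun_norm (\<omega> n) f"
proof -
  obtain F where F: "half_line_fun F" "f = abs_ae_fun F" by (rule abs_ae_fun_cases)
  note [measurable] = half_line_fun_measurable[OF F(1)]
  show ?thesis
    unfolding F(2) fun_scale.abs_eq[OF ae_equal_half_line[OF F(1)]] fun_norm_weight[OF half_line_fun_scale[OF F(1)]] fun_norm_weight[OF F(1)]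
    by (subst nn_integral_cmult[symmetric]) (auto simp: norm_mult ennreal_mult mult.assoc)
qed

lemma uminus_ae_fun: "- f = fun_scale (-1) f"
proof -
  obtain F where F: "half_line_fun F" "f = abs_ae_fun F" by (rule abs_ae_fun_cases)
  show ?thesis unfolding F(2) fun_scale.abs_eq[OF ae_equal_half_line[OF F(1)]] uminus_ae_fun.abs_eq[OF ae_equal_half_line[OF F(1)]] by simp
qed

lemma fun_norm_zero: "fun_norm (\<omega> n) 0 = 0"
proof -
  have "half_line_fun (\<lambda>_. 0)" by (simp add: half_line_fun_def)
  from fun_norm_weight[OF this] show ?thesis by (simp add: zero_ae_fun.abs_eq)
qed

lemma A_add: "f \<in> A \<Longrightarrow> g \<in> A \<Longrightarrow> f + g \<in> A"
  unfolding A_iff by (intro allI le_less_trans[OF fun_norm_add]) simp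

lemma A_scale: "f \<in> A \<Longrightarrow> fun_scale c f \<in> A"
  unfolding A_iff fun_norm_scale by (simp add: ennreal_mult_less_top)

sublocale A: seminormed_group "A_algebra \<omega>"
proof
  show "0 \<in> A" by (simp add: A_iff fun_norm_zero)
  show "f + g \<in> A" if "f \<in> A" "g \<in> A" for f g by (rule A_add[OF that])
  show "- f \<in> A" if "f \<in> A" for f unfolding uminus_ae_fun by (rule A_scale[OF that])
  show "snorm (A_algebra \<omega>) n 0 = 0" for n by (simp add: snorm_A fun_norm_zero)
  show "snorm (A_algebra \<omega>) n (f + g) \<le> snorm (A_algebra \<omega>) n f + snorm (A_algebra \<omega>) n g"
    if "f \<in> A" "g \<in> A" for n f g
  proof -
    have "ennreal (snorm (A_algebra \<omega>) n (f + g)) \<le> ennreal (snorm (A_algebra \<omega>) n f) + ennreal (snorm (A_algebra \<omega>) n g)"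
      unfolding ennreal_snorm_A[OF that(1)] ennreal_snorm_A[OF that(2)] ennreal_snorm_A[OF A_add[OF that]]
      by (rule fun_norm_add)
    then show ?thesis by (simp add: snorm_A flip: ennreal_plus)
  qed
  show "snorm (A_algebra \<omega>) n (- f) = snorm (A_algebra \<omega>) n f" for n f
    unfolding uminus_ae_fun by (simp add: snorm_A fun_norm_scale)
  show "snorm (A_algebra \<omega>) n f \<le> snorm (A_algebra \<omega>) (Suc n) f" if "f \<in> A" for n f
  proof -
    obtain F where F: "half_line_fun F" "f = abs_ae_fun F" by (rule abs_ae_fun_cases)
    have "fun_norm (\<omega> n) f \<le> fun_norm (\<omega> (Suc n)) f"
      unfolding F(2) fun_norm_weight[OF F(1)] by (intro nn_integral_mono mult_left_mono ennreal_leI increasing) auto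
    then have "ennreal (snorm (A_algebra \<omega>) n f) \<le> ennreal (snorm (A_algebra \<omega>) (Suc n) f)"
      using that by (simp add: ennreal_snorm_A)
    then show ?thesis by (simp add: snorm_A)
  qed
qed

lemma snorm_A_scale: "snorm (A_algebra \<omega>) n (fun_scale c f) = cmod c * snorm (A_algebra \<omega>) n f"
  by (simp add: snorm_A fun_norm_scale enn2real_mult)

lemma snorm_fun_measure_le: "f \<in> A \<Longrightarrow> snorm (B_algebra \<omega>) n (fun_measure f) \<le> snorm (A_algebra \<omega>) n f"
  unfolding snorm_A snorm_B by (intro enn2real_mono fun_measure_norm_le) (simp_all add: A_iff)

lemma fun_measure_add:
  assumes "f \<in> A" "g \<in> A" shows "fun_measure (f + g) = fun_measure f + fun_measure g"
proof -
  obtain F where F: "half_line_fun F" "f = abs_ae_fun F" "integrable lborel F" by (rule A_cases[OF assms(1)]) (rule that)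
  obtain G where G: "half_line_fun G" "g = abs_ae_fun G" "integrable lborel G" by (rule A_cases[OF assms(2)]) (rule that)
  have FG: "f + g = abs_ae_fun (\<lambda>t. F t + G t)"
    unfolding F(2) G(2) by (rule plus_ae_fun.abs_eq[OF ae_equal_half_line[OF F(1)] ae_equal_half_line[OF G(1)]])
  note rF = represents_fun_measure[OF F(1,3)] and rG = represents_fun_measure[OF G(1,3)]
  note rFG = represents_fun_measure[OF half_line_fun_add[OF F(1) G(1)] Bochner_Integration.integrable_add[OF F(3) G(3)]]
  show ?thesis
  proof
    fix E
    show "fun_measure (f + g) E = (fun_measure f + fun_measure g) E"
    proof (cases "E \<in> bounded_borel")
      case True
      note ind = indicator_borel_plus_measurable[OF bounded_borel_sets[OF True]]
      show ?thesis
        unfolding FG plus_fun_apply unfolding F(2) G(2) representsD(4)[OF rFG True] representsD(4)[OF rF True] representsD(4)[OF rG True]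
        using integrable_bounded_mult[OF representsD(2,3)[OF rF] ind cmod_indicator_le]
          integrable_bounded_mult[OF representsD(2,3)[OF rG] ind cmod_indicator_le]
        by (simp add: distrib_left)
    next
      case False
      then show ?thesis unfolding FG plus_fun_apply unfolding F(2) G(2)
        by (simp add: representsD(5)[OF rF] representsD(5)[OF rG] representsD(5)[OF rFG])
    qed
  qed
qed

lemma fun_measure_scale:
  assumes "f \<in> A" shows "fun_measure (fun_scale c f) = (\<lambda>E. c * fun_measure f E)"
proof -
  obtain F where F: "half_line_fun F" "f = abs_ae_fun F" "integrable lborel F" by (rule A_cases[OF assms(1)]) (rule that)
  have cF: "fun_scale c f = abs_ae_fun (\<lambda>t. c * F t)"
    unfolding F(2) by (rule fun_scale.abs_eq[OF ae_equal_half_line[OF F(1)]])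
  note rF = represents_fun_measure[OF F(1,3)]
  have "integrable lborel (\<lambda>t. c * F t)" using F(3) by simp
  note rc = represents_fun_measure[OF half_line_fun_scale[OF F(1)] this]
  show ?thesis
    by (rule represents_eqI[OF rc[folded cF] represents_scale[OF rF[folded F(2)]]])
      (simp add: representsD(4)[OF rc[folded cF] bounded_borel_interval] representsD(4)[OF represents_scale[OF rF[folded F(2)]] bounded_borel_interval])
qed

lemma A_X:
  assumes "f \<in> A" shows "fun_X f \<in> A" and "fun_measure (fun_X f) = measure_X (fun_measure f)"
proof -
  obtain F where F: "half_line_fun F" "f = abs_ae_fun F" "integrable lborel F"
    "\<And>n. (lborel_norm n F) < \<infinity>" by (rule A_cases[OF assms(1)]) (rule that)
  note r = represents_fun_measure[OF F(1,3)]
  have XF: "fun_X f = abs_ae_fun (\<lambda>t. complex_of_real (max 0 t) * F t)"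
  proof -
    \<comment> \<open>The representation of X uses the coordinate \<open>max 0 t\<close>, which
      agrees with t wherever \<open>F\<close> can be nonzero.\<close>
    have "(\<lambda>t. complex_of_real (max 0 t) * F t) = (\<lambda>t. complex_of_real t * F t)"
      by (auto simp: max_def half_line_fun_neg[OF F(1)])
    then show ?thesis unfolding F(2) by (simp add: fun_X.abs_eq[OF ae_equal_half_line[OF F(1)]])
  qed
  have h: "half_line_fun (\<lambda>t. complex_of_real (max 0 t) * F t)"
    using half_line_fun_measurable[OF F(1)] by (simp add: half_line_fun_def half_line_fun_neg[OF F(1)])
  note m = integrable_moment[OF r F(4)]
  show "fun_X f \<in> A" unfolding XF by (rule A_memI[OF h m(1)])
  note rX = represents_fun_measure[OF h m(2)] and rX' = represents_X[OF r m(2)]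
  show "fun_measure (fun_X f) = measure_X (fun_measure f)"
    unfolding XF unfolding F(2)
    by (rule represents_eqI[OF rX rX'])
      (simp add: representsD(4)[OF rX bounded_borel_interval] representsD(4)[OF rX' bounded_borel_interval])
qed

lemma A_ideal:
  assumes f: "f \<in> A" and \<mu>: "\<mu> \<in> B"
  shows "\<exists>g\<in>A. fun_measure g = measure_conv (fun_measure f) \<mu>"
proof -
  obtain F where F: "half_line_fun F" "f = abs_ae_fun F" "integrable lborel F"
    "\<And>n. (lborel_norm n F) < \<infinity>" by (rule A_cases[OF f]) (rule that)
  obtain h where h: "represents \<mu> (total_variation \<mu>) (\<lambda>t. t) h"
    "\<And>n. (\<integral>\<^sup>+t. ennreal (cmod (h t)) * ennreal (\<omega> n t) \<partial>total_variation \<mu>) < \<infinity>"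
    by (rule B_canonical[OF \<mu>]) (rule that)
  interpret fun_measure_conv F \<mu> "total_variation \<mu>" "\<lambda>t. t" h
    by unfold_locales (rule F h)+
  have "(lborel_norm n G) < \<infinity>" for n
    by (rule le_less_trans[OF G_weight_le[OF weight_measurable weight_submult weight_nonneg]])
      (use F(4)[of n] h(2)[of n] in \<open>auto simp: ennreal_mult_less_top\<close>)
  then have "abs_ae_fun G \<in> A" by (rule A_memI[OF half_line_G])
  then show ?thesis using fun_measure_G F(2) by auto
qed

lemma A_conv:
  assumes f: "f \<in> A" and g: "g \<in> A"
  shows "fun_conv f g \<in> A" and "fun_measure (fun_conv f g) = measure_conv (fun_measure f) (fun_measure g)"
proof -
  obtain F where F: "half_line_fun F" "f = abs_ae_fun F" "integrable lborel F"
    "\<And>n. (lborel_norm n F) < \<infinity>" by (rule A_cases[OF f]) (rule that)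
  obtain H where H: "half_line_fun H" "g = abs_ae_fun H" "integrable lborel H"
    "\<And>n. (lborel_norm n H) < \<infinity>" by (rule A_cases[OF g]) (rule that)
  \<comment> \<open>The second factor is treated as the function and the first as the measure with
    density \<open>F\<close> on \<open>lborel\<close>. The order is restored at the end by
    commutativity.\<close>
  interpret fun_measure_conv H "fun_measure f" lborel "max 0" F
    unfolding F(2) by unfold_locales (rule H F represents_fun_measure)+
  have "(CLBINT s:{0..t}. F s * H (t - s)) = G t" for t
    unfolding G_def set_lebesgue_integral_def
  proof (intro Bochner_Integration.integral_cong refl)
    fix s
    show "indicator {0..t} s *\<^sub>R (F s * H (t - s)) = H (t - max 0 s) * F s"
      by (cases "s < 0"; cases "t < s") (auto simp: half_line_fun_neg[OF F(1)] half_line_fun_neg[OF H(1)])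
  qed
  then have FG: "fun_conv f g = abs_ae_fun G"
    unfolding F(2) H(2) by (simp add: fun_conv.abs_eq[OF ae_equal_half_line[OF F(1)] ae_equal_half_line[OF H(1)]])
  have "(lborel_norm n G) < \<infinity>" for n
    by (rule le_less_trans[OF G_weight_le[OF weight_measurable weight_submult weight_nonneg]])
      (use F(4)[of n] H(4)[of n] in \<open>auto simp: ennreal_mult_less_top\<close>)
  then show "fun_conv f g \<in> A" unfolding FG by (rule A_memI[OF half_line_G])
  show "fun_measure (fun_conv f g) = measure_conv (fun_measure f) (fun_measure g)"
    using fun_measure_G measure_conv_commute[OF B_finite_variation[OF fun_measure_B[OF g]] B_finite_variation[OF fun_measure_B[OF f]]]
    unfolding FG unfolding H(2) by simp
qed

text \<open>The description in \<open>D_op\<close> is legitimate: existence is the ideal property,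
  uniqueness the injectivity of the embedding. The embedding thus intertwines the two operators, so
  identities on A(\<omega>) can be read off in B(\<omega>).\<close>

lemma D_op:
  assumes f: "f \<in> A" and \<mu>: "\<mu> \<in> B"
  shows "D_op \<omega> \<mu> f \<in> A" and "fun_measure (D_op \<omega> \<mu> f) = D_bar \<mu> (fun_measure f)"
proof -
  have "\<exists>!g. g \<in> A \<and> fun_measure g = measure_conv (fun_measure (fun_X f)) \<mu>"
    using A_ideal[OF A_X(1)[OF f] \<mu>] fun_measure_inj by metis
  from theI'[OF this] show "D_op \<omega> \<mu> f \<in> A" and "fun_measure (D_op \<omega> \<mu> f) = D_bar \<mu> (fun_measure f)"
    unfolding D_op_def D_bar_def A_X(2)[OF f] by blast+
qed

text \<open>Every identity is checked after applying the injective map \<open>fun_measure\<close>,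
  where it becomes the corresponding identity for \<open>D_bar\<close>.\<close>

lemma derivation_D_op:
  assumes \<mu>: "\<mu> \<in> B" shows "derivation (A_algebra \<omega>) (D_op \<omega> \<mu>)"
  unfolding derivation_def linear_operator_def scale_A mult_A
proof (intro conjI ballI allI)
  note lin = linear_operator_D_bar[OF \<mu>, unfolded linear_operator_def scale_B]
  show "D_op \<omega> \<mu> ` A \<subseteq> A" using D_op(1)[OF _ \<mu>] by blast
  fix f assume f: "f \<in> A"
  note mem = D_op(1)[OF f \<mu>] and fm = fun_measure_B[OF f]
  show "D_op \<omega> \<mu> (fun_scale c f) = fun_scale c (D_op \<omega> \<mu> f)" for c
    using lin fm
    by (intro fun_measure_inj D_op(1) A_scale f \<mu>) (simp add: D_op(2) A_scale f \<mu> mem fun_measure_scale)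
  fix g assume g: "g \<in> A"
  note mem' = D_op(1)[OF g \<mu>] and fm' = fun_measure_B[OF g]
  show "D_op \<omega> \<mu> (f + g) = D_op \<omega> \<mu> f + D_op \<omega> \<mu> g"
    using lin fm fm'
    by (intro fun_measure_inj D_op(1) A_add f g \<mu>) (simp add: D_op(2) A_add f g \<mu> mem mem' fun_measure_add)
  show "D_op \<omega> \<mu> (fun_conv f g) = fun_conv (D_op \<omega> \<mu> f) g + fun_conv f (D_op \<omega> \<mu> g)"
    by (intro fun_measure_inj D_op(1) A_add A_conv f g \<mu>)
      (simp add: D_op(2) A_conv f g \<mu> mem mem' fun_measure_add D_bar_conv[OF \<mu> fm fm'])
qed

end

section \<open>Translation in the mean and completeness\<close>

text \<open>If exactly one of x and h + x lies in A, that point either lies in A - K, or it lies in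
  K and the margin \<open>d\<close> places the other point in U - A.\<close>

lemma indicator_shift_diff_le:
  assumes K: "K \<subseteq> A" "A \<subseteq> U" and d: "\<And>x y. x \<in> K \<Longrightarrow> \<bar>y - x\<bar> < d \<Longrightarrow> y \<in> U" and h: "\<bar>h\<bar> < (d::real)"
  shows "\<bar>indicator A (h + x) - indicator A x\<bar> \<le>
    (indicator (A - K) (h + x) + indicator (U - A) x + (indicator (A - K) x + indicator (U - A) (h + x)) :: real)"
  using K d[of "h + x" x] d[of x "h + x"] h by (auto simp: indicator_def)

text \<open>The inner set has to be compact for the margin argument, so A is first cut down to a
  bounded interval. The cut and the closed approximation cost \<eta> each, whence
  \<open>2 * \<eta>\<close>.\<close>

lemma lborel_inner_outer:
  fixes A :: "real set"
  assumes A: "A \<in> sets borel" "emeasure lborel A < \<infinity>" and \<eta>: "0 < \<eta>"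
  obtains K U where "compact K" "open U" "K \<subseteq> A" "A \<subseteq> U"
    "emeasure lborel (A - K) \<le> ennreal (2 * \<eta>)" "emeasure lborel (U - A) \<le> ennreal \<eta>"
proof -
  have leb: "emeasure lebesgue E = emeasure lborel E" if "E \<in> sets borel" for E :: "real set" using that by simp
  obtain U where U: "open U" "A \<subseteq> U" "emeasure lebesgue (U - A) < ennreal \<eta>"
    by (rule sets_lebesgue_outer_open[OF _ \<eta>, of A]) (use A(1) in simp, rule that)
  have lim: "(\<lambda>n. emeasure lborel (A - {- real n..real n})) \<longlonglongrightarrow> emeasure lborel (\<Inter>n. A - {- real n..real n})"
  proof (rule Lim_emeasure_decseq)
    show "range (\<lambda>n. A - {- real n..real n}) \<subseteq> sets lborel" using A(1) by auto
    show "decseq (\<lambda>n. A - {- real n..real n})" by (auto simp: decseq_def)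
    have "emeasure lborel (A - {- real n..real n}) \<le> emeasure lborel A" for n
      using A(1) by (intro emeasure_mono) auto
    then show "emeasure lborel (A - {- real n..real n}) \<noteq> \<infinity>" for n
      using A(2) by (metis infinity_ennreal_def less_top le_less_trans)
  qed
  have empty: "(\<Inter>n. A - {- real n..real n}) = {}"
  proof -
    have "\<exists>n. x \<in> {- real n..real n}" for x
    proof -
      obtain n where "\<bar>x\<bar> < real n" using reals_Archimedean2 by blast
      then show ?thesis by (intro exI[of _ n]) auto
    qed
    then show ?thesis by blast
  qed
  have "(\<lambda>n. emeasure lborel (A - {- real n..real n})) \<longlonglongrightarrow> 0"
    using lim unfolding empty by simp
  then have "eventually (\<lambda>n. emeasure lborel (A - {- real n..real n}) < ennreal \<eta>) sequentially"
    by (rule order_tendstoD) (use \<eta> in simp)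
  then obtain n where n: "emeasure lborel (A - {- real n..real n}) < ennreal \<eta>"
    by (auto simp: eventually_sequentially)
  let ?A = "A \<inter> {- real n..real n}"
  obtain T where T: "closed T" "T \<subseteq> ?A" "emeasure lebesgue (?A - T) < ennreal \<eta>"
    by (rule sets_lebesgue_inner_closed[OF _ \<eta>, of ?A]) (use A(1) in simp, rule that)
  have Tb: "T \<in> sets borel" using T(1) by (rule borel_closed)
  have "bounded T" by (rule bounded_subset[OF bounded_closed_interval[of "- real n" "real n"] order_trans[OF T(2) Int_lower2]])
  then have "compact T" using T(1) by (simp add: compact_eq_bounded_closed)
  moreover have "emeasure lborel (A - T) \<le> emeasure lborel (A - {- real n..real n}) + emeasure lborel (?A - T)"
  proof -
    have "A - T = (A - {- real n..real n}) \<union> (?A - T)" using T(2) by blast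
    then show ?thesis using A(1) Tb emeasure_subadditive[of "A - {- real n..real n}" lborel "?A - T"] by auto
  qed
  moreover have "\<dots> \<le> ennreal \<eta> + ennreal \<eta>"
    using n T(3) A(1) Tb by (intro add_mono) (auto simp: leb)
  moreover have "ennreal \<eta> + ennreal \<eta> = ennreal (2 * \<eta>)" using \<eta> by (simp flip: ennreal_plus)
  moreover have "emeasure lborel (U - A) \<le> ennreal \<eta>" using U A(1) by (simp add: leb borel_open)
  ultimately show ?thesis using U T(2) by (intro that[of T U]) auto
qed

lemma compact_in_open_margin:
  fixes K :: "real set"
  assumes "compact K" "open U" "K \<subseteq> U"
  obtains d where "0 < d" "\<And>x y. x \<in> K \<Longrightarrow> \<bar>y - x\<bar> < d \<Longrightarrow> y \<in> U"
proof (cases "K = {}")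
  case True
  then show ?thesis by (intro that[of 1]) auto
next
  case False
  obtain e where e: "0 < e" "{x. infdist x K \<le> e} \<subseteq> U"
    by (rule compact_in_open_separated[OF False assms]) (rule that)
  show ?thesis
  proof (rule that[of e])
    fix x y assume "x \<in> K" "\<bar>y - x\<bar> < e"
    then have "infdist y K \<le> e" using infdist_le[of x K y] by (simp add: dist_real_def)
    with e show "y \<in> U" by blast
  qed (rule e)
qed

text \<open>Induction over integrable functions: indicators by regularity of Lebesgue measure, then
  sums, then limits, where translation invariance makes the approximation error the same for the
  translated function.\<close>

lemma L1_translation_continuous:
  fixes F :: "real \<Rightarrow> complex"
  assumes "integrable lborel F"
  shows "\<forall>e>0. \<exists>d>0. \<forall>h. \<bar>h\<bar> < d \<longrightarrow> (\<integral>\<^sup>+x. ennreal (cmod (F (h + x) - F x)) \<partial>lborel) \<le> ennreal e"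
  using assms
proof (induction rule: integrable_induct)
  case (base A c)
  then have A: "A \<in> sets borel" "emeasure lborel A < \<infinity>" by auto
  show ?case
  proof (intro allI impI)
    fix e :: real assume e: "0 < e"
    \<comment> \<open>The error sets A - K and U - A each occur twice, with measures at most 2\<eta>
      and \<eta>, in total 6\<eta>. The summand 1 keeps the denominator positive when
      \<open>c = 0\<close>.\<close>
    define \<eta> where "\<eta> = e / (6 * (cmod c + 1))"
    have \<eta>: "0 < \<eta>" using e by (simp add: \<eta>_def add_nonneg_pos)
    obtain K U where KU: "compact K" "open U" "K \<subseteq> A" "A \<subseteq> U"
      "emeasure lborel (A - K) \<le> ennreal (2 * \<eta>)" "emeasure lborel (U - A) \<le> ennreal \<eta>"
      by (rule lborel_inner_outer[OF A \<eta>]) (rule that)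
    obtain d where d: "0 < d" "\<And>x y. x \<in> K \<Longrightarrow> \<bar>y - x\<bar> < d \<Longrightarrow> y \<in> U"
      by (rule compact_in_open_margin[OF KU(1,2) order_trans[OF KU(3,4)]]) (rule that)
    have [measurable]: "A \<in> sets borel" "K \<in> sets borel" "U \<in> sets borel"
      using A KU(1,2) by (auto intro: borel_compact borel_open)
    have "(\<integral>\<^sup>+x. ennreal (cmod (indicator A (h + x) *\<^sub>R c - indicator A x *\<^sub>R c)) \<partial>lborel) \<le> ennreal e"
      if h: "\<bar>h\<bar> < d" for h
    proof -
      have "(\<integral>\<^sup>+x. ennreal (cmod (indicator A (h + x) *\<^sub>R c - indicator A x *\<^sub>R c)) \<partial>lborel) \<le>
        (\<integral>\<^sup>+x. ennreal (cmod c) * ((indicator (A - K) (h + x) + indicator (U - A) x) + (indicator (A - K) x + indicator (U - A) (h + x))) \<partial>lborel)"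
      proof (rule nn_integral_mono)
        fix x
        have "cmod (indicator A (h + x) *\<^sub>R c - indicator A x *\<^sub>R c) = cmod c * \<bar>indicator A (h + x) - indicator A x\<bar>"
          by (simp flip: scaleR_diff_left)
        also have "\<dots> \<le> cmod c * (indicator (A - K) (h + x) + indicator (U - A) x + (indicator (A - K) x + indicator (U - A) (h + x)))"
          using indicator_shift_diff_le[OF KU(3,4) d(2) h] by (intro mult_left_mono) auto
        finally have "ennreal (cmod (indicator A (h + x) *\<^sub>R c - indicator A x *\<^sub>R c)) \<le> ennreal (cmod c *
           (indicator (A - K) (h + x) + indicator (U - A) x + (indicator (A - K) x + indicator (U - A) (h + x))))"
          by (rule ennreal_leI)
        then show "ennreal (cmod (indicator A (h + x) *\<^sub>R c - indicator A x *\<^sub>R c)) \<le>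
          ennreal (cmod c) * ((indicator (A - K) (h + x) + indicator (U - A) x) + (indicator (A - K) x + indicator (U - A) (h + x)))"
          by (simp add: ennreal_mult ennreal_indicator)
      qed
      also have "\<dots> = ennreal (cmod c) * (((\<integral>\<^sup>+x. indicator (A - K) (h + x) \<partial>lborel) + emeasure lborel (U - A)) +
          (emeasure lborel (A - K) + (\<integral>\<^sup>+x. indicator (U - A) (h + x) \<partial>lborel)))"
        by (subst nn_integral_cmult, measurable) (simp add: nn_integral_add)
      also have "\<dots> = ennreal (cmod c) * ((emeasure lborel (A - K) + emeasure lborel (U - A)) + (emeasure lborel (A - K) + emeasure lborel (U - A)))"
        by (subst (1 2) nn_integral_shift[symmetric]) auto
      also have "\<dots> \<le> ennreal (cmod c) * ((ennreal (2 * \<eta>) + ennreal \<eta>) + (ennreal (2 * \<eta>) + ennreal \<eta>))"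
        by (intro mult_left_mono add_mono KU) auto
      also have "\<dots> = ennreal (cmod c * (6 * \<eta>))"
        using \<eta> by (simp flip: ennreal_plus ennreal_mult)
      also have "\<dots> \<le> ennreal e"
      proof (rule ennreal_leI)
        have "cmod c * (6 * \<eta>) \<le> (cmod c + 1) * (6 * \<eta>)" using \<eta> by (intro mult_right_mono) auto
        also have "\<dots> = e"
        proof -
          have "cmod c + 1 \<noteq> 0" using norm_ge_zero[of c] by linarith
          then show ?thesis unfolding \<eta>_def by (simp add: field_simps)
        qed
        finally show "cmod c * (6 * \<eta>) \<le> e" .
      qed
      finally show ?thesis .
    qed
    with d(1) show "\<exists>d>0. \<forall>h. \<bar>h\<bar> < d \<longrightarrow> (\<integral>\<^sup>+x. ennreal (cmod (indicator A (h + x) *\<^sub>R c - indicator A x *\<^sub>R c)) \<partial>lborel) \<le> ennreal e" by blast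
  qed
next
  case (add f g)
  have [measurable]: "f \<in> borel_measurable borel" "g \<in> borel_measurable borel"
    using add.hyps by (auto dest: borel_measurable_integrable)
  show ?case
  proof (intro allI impI)
    fix e :: real assume e: "0 < e"
    obtain d1 where d1: "0 < d1" "\<And>h. \<bar>h\<bar> < d1 \<Longrightarrow> (\<integral>\<^sup>+x. ennreal (cmod (f (h + x) - f x)) \<partial>lborel) \<le> ennreal (e / 2)"
      using add.IH(1)[rule_format, OF half_gt_zero[OF e]] by auto
    obtain d2 where d2: "0 < d2" "\<And>h. \<bar>h\<bar> < d2 \<Longrightarrow> (\<integral>\<^sup>+x. ennreal (cmod (g (h + x) - g x)) \<partial>lborel) \<le> ennreal (e / 2)"
      using add.IH(2)[rule_format, OF half_gt_zero[OF e]] by auto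
    have "(\<integral>\<^sup>+x. ennreal (cmod (f (h + x) + g (h + x) - (f x + g x))) \<partial>lborel) \<le> ennreal e" if h: "\<bar>h\<bar> < min d1 d2" for h
    proof -
      have "(\<integral>\<^sup>+x. ennreal (cmod (f (h + x) + g (h + x) - (f x + g x))) \<partial>lborel) \<le>
        (\<integral>\<^sup>+x. ennreal (cmod (f (h + x) - f x)) + ennreal (cmod (g (h + x) - g x)) \<partial>lborel)"
        by (intro nn_integral_mono) (simp add: norm_diff_triangle_ineq flip: ennreal_plus)
      also have "\<dots> = (\<integral>\<^sup>+x. ennreal (cmod (f (h + x) - f x)) \<partial>lborel) + (\<integral>\<^sup>+x. ennreal (cmod (g (h + x) - g x)) \<partial>lborel)"
        by (rule nn_integral_add) measurable
      also have "\<dots> \<le> ennreal (e / 2) + ennreal (e / 2)" using d1 d2 h by (intro add_mono) auto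
      also have "\<dots> = ennreal e" using e by (simp flip: ennreal_plus)
      finally show ?thesis .
    qed
    then show "\<exists>d>0. \<forall>h. \<bar>h\<bar> < d \<longrightarrow> (\<integral>\<^sup>+x. ennreal (cmod (f (h + x) + g (h + x) - (f x + g x))) \<partial>lborel) \<le> ennreal e"
      using d1(1) d2(1) by (intro exI[of _ "min d1 d2"]) auto
  qed
next
  case (lim f s)
  have fm[measurable]: "f \<in> borel_measurable borel" using lim.hyps(4) by (auto dest: borel_measurable_integrable)
  have sm[measurable]: "s i \<in> borel_measurable borel" for i using lim.hyps(1)[of i] by (auto dest: borel_measurable_integrable)
  show ?case
  proof (intro allI impI)
    fix e :: real assume e: "0 < e"
    have "(\<lambda>i. \<integral>\<^sup>+x. ennreal (cmod (s i x - f x)) \<partial>lborel) \<longlonglongrightarrow> (\<integral>\<^sup>+x. 0 \<partial>(lborel :: real measure))"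
    proof (rule nn_integral_dominated_convergence)
      \<comment> \<open>The approximants in this induction satisfy |s i| \<le> 2|f|, whence the
        factor 3.\<close>
      show "AE x in lborel. ennreal (cmod (s i x - f x)) \<le> ennreal (3 * cmod (f x))" for i
      proof (intro AE_I2 ennreal_leI)
        fix x show "cmod (s i x - f x) \<le> 3 * cmod (f x)"
          using norm_triangle_ineq4[of "s i x" "f x"] lim.hyps(3)[of x i] by simp
      qed
      have "integrable lborel (\<lambda>x. 3 * cmod (f x))" using lim.hyps(4) by simp
      then show "(\<integral>\<^sup>+x. ennreal (3 * cmod (f x)) \<partial>lborel) < \<infinity>"
        unfolding integrable_iff_bounded by (simp only: real_norm_def abs_mult abs_norm_cancel abs_numeral)
      have "(\<lambda>i. ennreal (cmod (s i x - f x))) \<longlonglongrightarrow> ennreal 0" for x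
        using lim.hyps(2)[of x] by (intro tendsto_ennrealI) (simp add: tendsto_norm_zero LIM_zero)
      then show "AE x in lborel. (\<lambda>i. ennreal (cmod (s i x - f x))) \<longlonglongrightarrow> 0" by simp
    qed measurable
    then have "eventually (\<lambda>i. (\<integral>\<^sup>+x. ennreal (cmod (s i x - f x)) \<partial>lborel) < ennreal (e / 3)) sequentially"
      by (intro order_tendstoD) (use e in auto)
    then obtain i where i: "(\<integral>\<^sup>+x. ennreal (cmod (s i x - f x)) \<partial>lborel) < ennreal (e / 3)"
      by (auto simp: eventually_sequentially)
    have "0 < e / 3" using e by simp
    then obtain d where d: "0 < d" "\<And>h. \<bar>h\<bar> < d \<Longrightarrow> (\<integral>\<^sup>+x. ennreal (cmod (s i (h + x) - s i x)) \<partial>lborel) \<le> ennreal (e / 3)"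
      using lim.IH[of i] by blast
    have "(\<integral>\<^sup>+x. ennreal (cmod (f (h + x) - f x)) \<partial>lborel) \<le> ennreal e" if h: "\<bar>h\<bar> < d" for h
    proof -
      have "(\<integral>\<^sup>+x. ennreal (cmod (f (h + x) - f x)) \<partial>lborel) \<le>
        (\<integral>\<^sup>+x. (ennreal (cmod (s i (h + x) - f (h + x))) + ennreal (cmod (s i (h + x) - s i x))) + ennreal (cmod (s i x - f x)) \<partial>lborel)"
      proof (rule nn_integral_mono)
        fix x
        have "cmod (f (h + x) - f x) \<le> cmod (s i (h + x) - f (h + x)) + cmod (s i (h + x) - s i x) + cmod (s i x - f x)"
          by norm
        then show "ennreal (cmod (f (h + x) - f x)) \<le> (ennreal (cmod (s i (h + x) - f (h + x))) + ennreal (cmod (s i (h + x) - s i x))) + ennreal (cmod (s i x - f x))"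
          by (simp flip: ennreal_plus)
      qed
      also have "\<dots> = ((\<integral>\<^sup>+x. ennreal (cmod (s i (h + x) - f (h + x))) \<partial>lborel) + (\<integral>\<^sup>+x. ennreal (cmod (s i (h + x) - s i x)) \<partial>lborel)) + (\<integral>\<^sup>+x. ennreal (cmod (s i x - f x)) \<partial>lborel)"
        by (simp add: nn_integral_add)
      also have "(\<integral>\<^sup>+x. ennreal (cmod (s i (h + x) - f (h + x))) \<partial>lborel) = (\<integral>\<^sup>+x. ennreal (cmod (s i x - f x)) \<partial>lborel)"
        by (rule nn_integral_shift[symmetric]) measurable
      also have "((\<integral>\<^sup>+x. ennreal (cmod (s i x - f x)) \<partial>lborel) + (\<integral>\<^sup>+x. ennreal (cmod (s i (h + x) - s i x)) \<partial>lborel)) + (\<integral>\<^sup>+x. ennreal (cmod (s i x - f x)) \<partial>lborel)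
        \<le> (ennreal (e / 3) + ennreal (e / 3)) + ennreal (e / 3)"
        using i d(2)[OF h] by (intro add_mono) auto
      also have "\<dots> = ennreal e" using e by (simp flip: ennreal_plus)
      finally show ?thesis .
    qed
    with d(1) show "\<exists>d>0. \<forall>h. \<bar>h\<bar> < d \<longrightarrow> (\<integral>\<^sup>+x. ennreal (cmod (f (h + x) - f x)) \<partial>lborel) \<le> ennreal e" by blast
  qed
qed

text \<open>Along indices with consecutive L1 distances at most 2 to the power -k, the sum of the
  absolute differences has a finite integral. It is therefore finite almost everywhere, and the
  telescoping series converges there.\<close>

lemma L1_Cauchy_AE_convergent_subsequence:
  fixes F :: "nat \<Rightarrow> 'a \<Rightarrow> complex"
  assumes [measurable]: "\<And>i. F i \<in> borel_measurable M"
    and cauchy: "\<And>e. 0 < e \<Longrightarrow> \<exists>N. \<forall>i\<ge>N. \<forall>j\<ge>N. (\<integral>\<^sup>+x. ennreal (cmod (F i x - F j x)) \<partial>M) \<le> ennreal e"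
  shows "\<exists>r. strict_mono r \<and> (AE x in M. convergent (\<lambda>k. F (r k) x))"
proof -
  have "\<exists>N. \<forall>k. (\<forall>i\<ge>N k. \<forall>j\<ge>N k. (\<integral>\<^sup>+x. ennreal (cmod (F i x - F j x)) \<partial>M) \<le> ennreal ((1/2)^k)) \<and> N k < N (Suc k)"
  proof (rule dependent_nat_choice)
    show "\<exists>N. \<forall>i\<ge>N. \<forall>j\<ge>N. (\<integral>\<^sup>+x. ennreal (cmod (F i x - F j x)) \<partial>M) \<le> ennreal ((1/2)^0)"
      by (rule cauchy) simp
    fix N :: nat and k :: nat
    obtain N' where N': "\<forall>i\<ge>N'. \<forall>j\<ge>N'. (\<integral>\<^sup>+x. ennreal (cmod (F i x - F j x)) \<partial>M) \<le> ennreal ((1/2)^Suc k)"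
      using cauchy[of "(1/2)^Suc k"] by auto
    then show "\<exists>N''. (\<forall>i\<ge>N''. \<forall>j\<ge>N''. (\<integral>\<^sup>+x. ennreal (cmod (F i x - F j x)) \<partial>M) \<le> ennreal ((1/2)^Suc k)) \<and> N < N''"
      by (intro exI[of _ "max N' (Suc N)"]) auto
  qed
  then obtain r where r: "\<And>k i j. r k \<le> i \<Longrightarrow> r k \<le> j \<Longrightarrow> (\<integral>\<^sup>+x. ennreal (cmod (F i x - F j x)) \<partial>M) \<le> ennreal ((1/2)^k)"
    "\<And>k. r k < r (Suc k)" by blast
  have mono: "strict_mono r" using r(2) by (simp add: strict_mono_Suc_iff)
  have "(\<integral>\<^sup>+x. (\<Sum>k. ennreal (cmod (F (r (Suc k)) x - F (r k) x))) \<partial>M) = (\<Sum>k. \<integral>\<^sup>+x. ennreal (cmod (F (r (Suc k)) x - F (r k) x)) \<partial>M)"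
    by (rule nn_integral_suminf) measurable
  also have "\<dots> \<le> (\<Sum>k. ennreal ((1/2)^k))"
  proof (rule suminf_le)
    fix k
    show "(\<integral>\<^sup>+x. ennreal (cmod (F (r (Suc k)) x - F (r k) x)) \<partial>M) \<le> ennreal ((1/2)^k)"
      by (rule r(1)) (use r(2)[of k] in auto)
  qed auto
  also have "\<dots> = ennreal (\<Sum>k. (1/2)^k)" by (rule suminf_ennreal2) (auto intro: summable_geometric)
  finally have "(\<integral>\<^sup>+x. (\<Sum>k. ennreal (cmod (F (r (Suc k)) x - F (r k) x))) \<partial>M) \<noteq> \<infinity>"
    by (metis ennreal_neq_top infinity_ennreal_def top_unique)
  then have "AE x in M. (\<Sum>k. ennreal (cmod (F (r (Suc k)) x - F (r k) x))) \<noteq> \<infinity>"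
    by (rule nn_integral_PInf_AE[rotated]) measurable
  then have "AE x in M. convergent (\<lambda>k. F (r k) x)"
  proof eventually_elim
    case (elim x)
    then have "summable (\<lambda>k. cmod (F (r (Suc k)) x - F (r k) x))"
      by (intro summable_suminf_not_top) auto
    then have "summable (\<lambda>k. F (r (Suc k)) x - F (r k) x)" by (rule summable_norm_cancel)
    then obtain l where "(\<lambda>m. \<Sum>k<m. F (r (Suc k)) x - F (r k) x) \<longlonglongrightarrow> l" by (auto simp: summable_def sums_def)
    then have "(\<lambda>m. F (r m) x - F (r 0) x) \<longlonglongrightarrow> l" by (simp only: sum_lessThan_telescope[of "\<lambda>k. F (r k) x"])
    from tendsto_add[OF this tendsto_const[of "F (r 0) x"]] show ?case by (auto simp: convergent_def)
  qed
  with mono show ?thesis by blast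
qed

context weight_sequence
begin

section \<open>Completeness of A(\<omega>)\<close>

lemma minus_abs_ae_fun: "half_line_fun F \<Longrightarrow> half_line_fun H \<Longrightarrow> abs_ae_fun F - abs_ae_fun H = abs_ae_fun (\<lambda>t. F t - H t)"
  by (rule minus_ae_fun.abs_eq) (auto intro: ae_equal_half_line)

lemma half_line_fun_diff: "half_line_fun F \<Longrightarrow> half_line_fun H \<Longrightarrow> half_line_fun (\<lambda>t. F t - H t)"
  by (auto simp: half_line_fun_def)

lemma snorm_A_le_iff:
  assumes "f \<in> A" "0 \<le> c" shows "snorm (A_algebra \<omega>) n f \<le> c \<longleftrightarrow> fun_norm (\<omega> n) f \<le> ennreal c"
  using assms A.snorm_nonneg[OF assms(1), of n] by (simp add: ennreal_snorm_A[symmetric] ennreal_le_iff)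

text \<open>The norm with index 0 dominates the plain L1 norm, so a subsequence converges almost
  everywhere. Its pointwise limit is the candidate for all norms at once, and the lemma of Fatou
  gives the estimate in each of them.\<close>

lemma A_complete:
  assumes \<sigma>: "range \<sigma> \<subseteq> A"
    and cauchy: "\<And>n e. 0 < e \<Longrightarrow> \<exists>N. \<forall>i\<ge>N. \<forall>j\<ge>N. snorm (A_algebra \<omega>) n (\<sigma> i - \<sigma> j) < e"
  shows "\<exists>f\<in>A. \<forall>n. (\<lambda>i. snorm (A_algebra \<omega>) n (\<sigma> i - f)) \<longlonglongrightarrow> 0"
proof -
  have "\<exists>F. half_line_fun F \<and> \<sigma> i = abs_ae_fun F" for i by (metis abs_ae_fun_cases)
  then obtain F where F: "\<And>i. half_line_fun (F i)" "\<And>i. \<sigma> i = abs_ae_fun (F i)" by metis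
  note [measurable] = half_line_fun_measurable[OF F(1)]
  have \<sigma>A: "\<sigma> i \<in> A" for i using \<sigma> by auto
  have diff: "\<sigma> i - \<sigma> j = abs_ae_fun (\<lambda>t. F i t - F j t)" for i j
    unfolding F(2) by (rule minus_abs_ae_fun[OF F(1) F(1)])
  have cauchy': "\<exists>N. \<forall>i\<ge>N. \<forall>j\<ge>N. (lborel_norm n (\<lambda>t. F i t - F j t)) \<le> ennreal e" if e: "0 < e" for n e
  proof -
    obtain N where N: "\<And>i j. N \<le> i \<Longrightarrow> N \<le> j \<Longrightarrow> snorm (A_algebra \<omega>) n (\<sigma> i - \<sigma> j) < e" using cauchy[OF e] by blast
    have "(lborel_norm n (\<lambda>t. F i t - F j t)) \<le> ennreal e" if "N \<le> i" "N \<le> j" for i j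
      using N[OF that] snorm_A_le_iff[OF A.diff_mem[OF \<sigma>A[of i] \<sigma>A[of j]], of e n] e
      unfolding diff fun_norm_weight[OF half_line_fun_diff[OF F(1) F(1)]] by simp
    then show ?thesis by blast
  qed
  obtain C where C: "0 < C" "\<And>t. 0 \<le> t \<Longrightarrow> 1 \<le> C * \<omega> 0 t" by (rule weight_lower_bound[of 0]) (rule that)
  have "\<exists>r. strict_mono r \<and> (AE x in lborel. convergent (\<lambda>k. F (r k) x))"
  proof (rule L1_Cauchy_AE_convergent_subsequence)
    show "F i \<in> borel_measurable lborel" for i using half_line_fun_measurable[OF F(1)] by simp
    fix e :: real assume e: "0 < e"
    then obtain N where N: "\<And>i j. N \<le> i \<Longrightarrow> N \<le> j \<Longrightarrow> (lborel_norm 0 (\<lambda>t. F i t - F j t)) \<le> ennreal (e / C)"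
      using cauchy'[of "e / C" 0] C(1) by auto
    have "(\<integral>\<^sup>+t. ennreal (cmod (F i t - F j t)) \<partial>lborel) \<le> ennreal e" if "N \<le> i" "N \<le> j" for i j
    proof -
      have "(\<integral>\<^sup>+t. ennreal (cmod (F i t - F j t)) \<partial>lborel) \<le> (\<integral>\<^sup>+t. ennreal C * (ennreal (cmod (F i t - F j t)) * ennreal (\<omega> 0 (max 0 t))) \<partial>lborel)"
      proof (rule nn_integral_mono)
        fix t
        have "ennreal (cmod (F i t - F j t)) * 1 \<le> ennreal (cmod (F i t - F j t)) * (ennreal C * ennreal (\<omega> 0 (max 0 t)))"
          by (intro mult_left_mono one_le_ennreal_mult C) auto
        then show "ennreal (cmod (F i t - F j t)) \<le> ennreal C * (ennreal (cmod (F i t - F j t)) * ennreal (\<omega> 0 (max 0 t)))"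
          by (simp add: ac_simps)
      qed
      also have "\<dots> = ennreal C * (lborel_norm 0 (\<lambda>t. F i t - F j t))"
        by (rule nn_integral_cmult) measurable
      also have "\<dots> \<le> ennreal C * ennreal (e / C)" using N[OF that] by (intro mult_left_mono) auto
      also have "\<dots> = ennreal e" using C(1) e by (simp flip: ennreal_mult)
      finally show ?thesis .
    qed
    then show "\<exists>N. \<forall>i\<ge>N. \<forall>j\<ge>N. (\<integral>\<^sup>+x. ennreal (cmod (F i x - F j x)) \<partial>lborel) \<le> ennreal e" by blast
  qed
  then obtain r where r: "strict_mono r" "AE x in lborel. convergent (\<lambda>k. F (r k) x)" by blast
  define L where "L t = lim (\<lambda>k. F (r k) t)" for t
  have [measurable]: "L \<in> borel_measurable borel" unfolding L_def by measurable
  have L: "half_line_fun L"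
    unfolding half_line_fun_def by (auto simp: L_def half_line_fun_neg[OF F(1)])
  \<comment> \<open>Fatou along the subsequence: a bound on the distances from \<open>F i\<close> to
    all late \<open>F j\<close> passes to the distance from \<open>F i\<close> to
    \<open>L\<close>.\<close>
  have est: "(lborel_norm n (\<lambda>t. F i t - L t)) \<le> ennreal e"
    if N: "\<And>j. N \<le> j \<Longrightarrow> (lborel_norm n (\<lambda>t. F i t - F j t)) \<le> ennreal e" for i n N e
  proof -
    have "(lborel_norm n (\<lambda>t. F i t - L t)) =
       (\<integral>\<^sup>+t. liminf (\<lambda>k. ennreal (cmod (F i t - F (r k) t)) * ennreal (\<omega> n (max 0 t))) \<partial>lborel)"
    proof (rule nn_integral_cong_AE)
      show "AE t in lborel. ennreal (cmod (F i t - L t)) * ennreal (\<omega> n (max 0 t)) = liminf (\<lambda>k. ennreal (cmod (F i t - F (r k) t)) * ennreal (\<omega> n (max 0 t)))"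
        using r(2)
      proof eventually_elim
        case (elim t)
        then have "(\<lambda>k. F (r k) t) \<longlonglongrightarrow> L t" by (simp add: L_def convergent_LIMSEQ_iff)
        then have "(\<lambda>k. ennreal (cmod (F i t - F (r k) t) * \<omega> n (max 0 t))) \<longlonglongrightarrow> ennreal (cmod (F i t - L t) * \<omega> n (max 0 t))"
          by (intro tendsto_intros)
        then have "liminf (\<lambda>k. ennreal (cmod (F i t - F (r k) t) * \<omega> n (max 0 t))) = ennreal (cmod (F i t - L t) * \<omega> n (max 0 t))"
          by (intro lim_imp_Liminf) auto
        then show ?case by (simp add: ennreal_mult weight_nonneg)
      qed
    qed
    also have "\<dots> \<le> liminf (\<lambda>k. \<integral>\<^sup>+t. ennreal (cmod (F i t - F (r k) t)) * ennreal (\<omega> n (max 0 t)) \<partial>lborel)"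
      by (rule nn_integral_liminf) measurable
    also have "\<dots> \<le> limsup (\<lambda>k. \<integral>\<^sup>+t. ennreal (cmod (F i t - F (r k) t)) * ennreal (\<omega> n (max 0 t)) \<partial>lborel)"
      by (rule Liminf_le_Limsup) simp
    also have "\<dots> \<le> ennreal e"
    proof (rule Limsup_bounded)
      have "N \<le> r k" if "N \<le> k" for k using seq_suble[OF r(1), of k] that by simp
      then show "\<forall>\<^sub>F k in sequentially. (lborel_norm n (\<lambda>t. F i t - F (r k) t)) \<le> ennreal e"
        using N by (auto simp: eventually_sequentially)
    qed
    finally show ?thesis .
  qed
  have diffL: "\<sigma> i - abs_ae_fun L = abs_ae_fun (\<lambda>t. F i t - L t)" for i
    unfolding F(2) by (rule minus_abs_ae_fun[OF F(1) L])
  have close: "\<exists>N. \<forall>i\<ge>N. fun_norm (\<omega> n) (\<sigma> i - abs_ae_fun L) \<le> ennreal e" if e: "0 < e" for n e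
  proof -
    obtain N where N: "\<And>i j. N \<le> i \<Longrightarrow> N \<le> j \<Longrightarrow> (lborel_norm n (\<lambda>t. F i t - F j t)) \<le> ennreal e"
      using cauchy'[OF e, of n] by auto
    have "fun_norm (\<omega> n) (\<sigma> i - abs_ae_fun L) \<le> ennreal e" if "N \<le> i" for i
      unfolding diffL fun_norm_weight[OF half_line_fun_diff[OF F(1) L]] using N[OF that] by (rule est)
    then show ?thesis by blast
  qed
  have LA: "abs_ae_fun L \<in> A"
    unfolding A_iff
  proof
    fix n
    obtain i where i: "fun_norm (\<omega> n) (\<sigma> i - abs_ae_fun L) \<le> ennreal 1" using close[of 1 n] by auto
    \<comment> \<open>For each norm the limit is within distance 1 of some member of the sequence,
      hence has finite norm.\<close>
    have "abs_ae_fun L = \<sigma> i + fun_scale (-1) (\<sigma> i - abs_ae_fun L)" by (simp flip: uminus_ae_fun)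
    then have "fun_norm (\<omega> n) (abs_ae_fun L) \<le> fun_norm (\<omega> n) (\<sigma> i) + fun_norm (\<omega> n) (fun_scale (-1) (\<sigma> i - abs_ae_fun L))"
      by (metis fun_norm_add)
    also have "\<dots> < \<infinity>" using i \<sigma>A[of i] by (auto simp: fun_norm_scale A_iff intro: le_less_trans)
    finally show "fun_norm (\<omega> n) (abs_ae_fun L) < \<infinity>" .
  qed
  have "(\<lambda>i. snorm (A_algebra \<omega>) n (\<sigma> i - abs_ae_fun L)) \<longlonglongrightarrow> 0" for n
  proof (rule LIMSEQ_I)
    fix e :: real assume e: "0 < e"
    obtain N where "\<forall>i\<ge>N. fun_norm (\<omega> n) (\<sigma> i - abs_ae_fun L) \<le> ennreal (e/2)" using close[of "e/2" n] e by auto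
    then have N: "\<And>i. N \<le> i \<Longrightarrow> snorm (A_algebra \<omega>) n (\<sigma> i - abs_ae_fun L) \<le> e / 2"
      using snorm_A_le_iff[OF A.diff_mem[OF \<sigma>A LA], of "e/2"] e by auto
    have "norm (snorm (A_algebra \<omega>) n (\<sigma> i - abs_ae_fun L) - 0) < e" if "N \<le> i" for i
      using N[OF that] A.snorm_nonneg[OF A.diff_mem[OF \<sigma>A[of i] LA], of n] e by simp
    then show "\<exists>N. \<forall>i\<ge>N. norm (snorm (A_algebra \<omega>) n (\<sigma> i - abs_ae_fun L) - 0) < e" by blast
  qed
  with LA show ?thesis by blast
qed

end

section \<open>Approximation by finitely many translates\<close>

lemma nn_integral_shift_weight_le:
  assumes F: "half_line_fun F" and t: "0 \<le> t"
    and w: "w \<in> borel_measurable borel_plus" "\<And>s t. 0 \<le> s \<Longrightarrow> 0 \<le> t \<Longrightarrow> w (s + t) \<le> w s * w t"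
    and w0: "\<And>t. 0 \<le> t \<Longrightarrow> 0 \<le> (w t :: real)"
  shows "(\<integral>\<^sup>+x. ennreal (cmod (F (x - t))) * ennreal (w (max 0 x)) \<partial>lborel) \<le>
    ennreal (w t) * (\<integral>\<^sup>+x. ennreal (cmod (F x)) * ennreal (w (max 0 x)) \<partial>lborel)"
proof -
  note [measurable] = half_line_fun_measurable[OF F]
  have wm[measurable]: "(\<lambda>t. w (max 0 t)) \<in> borel_measurable borel"
    using measurable_compose[OF measurable_max_0 w(1)] by simp
  have "(\<integral>\<^sup>+x. ennreal (cmod (F (x - t))) * ennreal (w (max 0 x)) \<partial>lborel) =
      (\<integral>\<^sup>+x. ennreal (cmod (F x)) * ennreal (w (max 0 (t + x))) \<partial>lborel)"
    by (subst nn_integral_shift[of _ t]) auto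
  also have "\<dots> \<le> (\<integral>\<^sup>+x. ennreal (w t) * (ennreal (cmod (F x)) * ennreal (w (max 0 x))) \<partial>lborel)"
  proof (rule nn_integral_mono)
    fix x :: real
    show "ennreal (cmod (F x)) * ennreal (w (max 0 (t + x))) \<le> ennreal (w t) * (ennreal (cmod (F x)) * ennreal (w (max 0 x)))"
    proof (cases "x < 0")
      case False
      then have x: "0 \<le> x" "max 0 (t + x) = t + x" "max 0 x = x" using t by auto
      have "cmod (F x) * w (t + x) \<le> cmod (F x) * (w t * w x)" by (intro mult_left_mono w t x) simp
      then show ?thesis
        using w0[OF t] w0[OF x(1)] w0[of "t + x"] x t by (simp add: ennreal_leI ac_simps flip: ennreal_mult)
    qed (simp add: half_line_fun_neg[OF F])
  qed
  also have "\<dots> = ennreal (w t) * (\<integral>\<^sup>+x. ennreal (cmod (F x)) * ennreal (w (max 0 x)) \<partial>lborel)"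
    by (rule nn_integral_cmult) measurable
  finally show ?thesis .
qed

text \<open>With bounded support, differences of translates live on an interval where the weight is
  bounded. Their weighted norm is then controlled by the plain L1 norm, in which translation is
  continuous.\<close>

definition cut_off :: "real \<Rightarrow> (real \<Rightarrow> complex) \<Rightarrow> real \<Rightarrow> complex" where
  "cut_off b F x = (if x \<le> b then F x else 0)"

lemma half_line_cut_off: "half_line_fun F \<Longrightarrow> half_line_fun (cut_off b F)"
  unfolding half_line_fun_def cut_off_def by (auto intro!: measurable_If simp: cut_off_def[abs_def])

lemma integrable_cut_off: "integrable lborel F \<Longrightarrow> integrable lborel (cut_off b F)"
proof (rule Bochner_Integration.integrable_bound)
  assume "integrable lborel F"
  then have [measurable]: "F \<in> borel_measurable borel" by auto
  show "cut_off b F \<in> borel_measurable lborel" unfolding cut_off_def[abs_def] by measurable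
qed (auto simp: cut_off_def)

lemma floor_eq_iff_grid: "0 < \<delta> \<Longrightarrow> t \<in> {real j * \<delta>..<real (Suc j) * \<delta>} \<longleftrightarrow> \<lfloor>t / \<delta>\<rfloor> = int j"
  by (auto simp: floor_eq_iff field_simps)

context fun_measure_conv
begin

text \<open>The three terms on the right are three sources of error: cutting \<open>F\<close> off at
  \<open>b\<close>, moving a shift \<open>S y\<close> to the left end of its grid cell, and ignoring
  the shifts beyond the grid. The bounds involve \<open>K\<close> only through integrals, so they
  can be uniform over a bounded family of measures.\<close>

lemma grid_approx:
  fixes J :: nat
  assumes w: "w \<in> borel_measurable borel_plus" "\<And>s t. 0 \<le> s \<Longrightarrow> 0 \<le> t \<Longrightarrow> w (s + t) \<le> w s * w t"
    and w0: "\<And>t. 0 \<le> t \<Longrightarrow> 0 \<le> (w t :: real)"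
    and \<delta>: "0 < \<delta>" and b: "0 \<le> b"
    and \<eta>: "(\<integral>\<^sup>+x. ennreal (cmod (F x - cut_off b F x)) * ennreal (w (max 0 x)) \<partial>lborel) \<le> \<eta>"
    and W: "\<And>t. 0 \<le> t \<Longrightarrow> t \<le> b + real J * \<delta> \<Longrightarrow> w t \<le> W" "0 \<le> W"
    and modulus: "\<And>s. 0 \<le> s \<Longrightarrow> s < \<delta> \<Longrightarrow> (\<integral>\<^sup>+x. ennreal (cmod (cut_off b F (s + x) - cut_off b F x)) \<partial>lborel) \<le> \<eta>'"
  shows "(\<integral>\<^sup>+x. ennreal (cmod (G x - (\<Sum>j<J. (\<integral>y. indicator {real j * \<delta>..<real (Suc j) * \<delta>} (S y) * K y \<partial>N) * cut_off b F (x - real j * \<delta>))))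
        * ennreal (w (max 0 x)) \<partial>lborel) \<le>
    \<eta> * (\<integral>\<^sup>+y. ennreal (cmod (K y)) * ennreal (w (S y)) \<partial>N) + ennreal W * \<eta>' * (\<integral>\<^sup>+y. ennreal (cmod (K y)) \<partial>N) +
    (\<integral>\<^sup>+x. ennreal (cmod (F x)) * ennreal (w (max 0 x)) \<partial>lborel) *
      (\<integral>\<^sup>+y. ennreal (cmod (K y)) * ennreal (w (S y)) * indicator {real J * \<delta>..} (S y) \<partial>N)"
    (is "?L \<le> \<eta> * ?Kw + ennreal W * \<eta>' * ?K1 + ?Fw * ?Kt")
proof -
  interpret N: sigma_finite_measure N by (rule representsD(1)[OF r])
  interpret pair_sigma_finite lborel N by unfold_locales
  define Fc where "Fc = cut_off b F"
  have Fc: "half_line_fun Fc" unfolding Fc_def by (rule half_line_cut_off[OF hl(1)])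
  note [measurable] = half_line_fun_measurable[OF Fc]
  define I where "I j = (indicator {real j * \<delta>..<real (Suc j) * \<delta>} :: real \<Rightarrow> complex)" for j
  have [measurable]: "I j \<in> borel_measurable borel" for j unfolding I_def by measurable
  \<comment> \<open>The error for an individual shift \<open>S y\<close>; integrating it against
    \<open>K\<close> gives the total error.\<close>
  define Z where "Z x y = F (x - S y) - (\<Sum>j<J. I j (S y) * Fc (x - real j * \<delta>))" for x y
  have wS[measurable]: "(\<lambda>y. w (S y)) \<in> borel_measurable N"
    using measurable_compose[OF representsD(2)[OF r] w(1)] .
  have wm[measurable]: "(\<lambda>t. w (max 0 t)) \<in> borel_measurable borel"
    using measurable_compose[OF measurable_max_0 w(1)] by simp
  have K: "integrable N K" by (rule representsD(3)[OF r])
  have IK: "integrable N (\<lambda>y. I j (S y) * K y)" for j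
    by (rule integrable_bounded_mult[OF representsD(2,3)[OF r], where B=1])
      (auto simp: I_def cmod_indicator_le intro!: measurable_restrict_space1)
  \<comment> \<open>Only almost everywhere, since splitting the integral requires that of
    \<open>G\<close> to converge absolutely at \<open>x\<close>.\<close>
  have "AE x in lborel. G x - (\<Sum>j<J. (\<integral>y. I j (S y) * K y \<partial>N) * Fc (x - real j * \<delta>)) = (\<integral>y. Z x y * K y \<partial>N)"
    using AE_integrable_fst'[OF integrable_pair]
  proof eventually_elim
    case (elim x)
    then have i: "integrable N (\<lambda>y. F (x - S y) * K y)" by simp
    have "(\<integral>y. Z x y * K y \<partial>N) = (\<integral>y. F (x - S y) * K y - (\<Sum>j<J. (I j (S y) * K y) * Fc (x - real j * \<delta>)) \<partial>N)"
      by (intro Bochner_Integration.integral_cong refl) (simp only: Z_def left_diff_distrib sum_distrib_right mult.assoc mult.commute[of "Fc _"])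
    also have "\<dots> = G x - (\<integral>y. (\<Sum>j<J. (I j (S y) * K y) * Fc (x - real j * \<delta>)) \<partial>N)"
      unfolding G_def using i IK by (intro Bochner_Integration.integral_diff) auto
    also have "(\<integral>y. (\<Sum>j<J. (I j (S y) * K y) * Fc (x - real j * \<delta>)) \<partial>N) = (\<Sum>j<J. (\<integral>y. I j (S y) * K y \<partial>N) * Fc (x - real j * \<delta>))"
      using IK by (subst Bochner_Integration.integral_sum) auto
    finally show ?case by simp
  qed
  then have "?L = (\<integral>\<^sup>+x. ennreal (cmod (\<integral>y. Z x y * K y \<partial>N)) * ennreal (w (max 0 x)) \<partial>lborel)"
    unfolding Fc_def I_def by (intro nn_integral_cong_AE) (auto elim!: eventually_mono)
  also have "\<dots> \<le> (\<integral>\<^sup>+y. ennreal (cmod (K y)) * (\<integral>\<^sup>+x. ennreal (cmod (Z x y)) * ennreal (w (max 0 x)) \<partial>lborel) \<partial>N)"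
    by (rule nn_integral_kernel_le[OF representsD(1)[OF r]]) (unfold Z_def, measurable)
  also have "\<dots> \<le> (\<integral>\<^sup>+y. ennreal (cmod (K y)) * (ennreal (w (S y)) * \<eta> + ennreal W * \<eta>' + ennreal (w (S y)) * indicator {real J * \<delta>..} (S y) * ?Fw) \<partial>N)"
  proof (intro nn_integral_mono mult_left_mono)
    fix y assume "y \<in> space N"
    then have t: "0 \<le> S y" by (rule S_nonneg)
    let ?t = "S y"
    \<comment> \<open>The cell of a shift is identified by a floor, so at most one term of the sum
      over \<open>j\<close> survives.\<close>
    have grid: "I j ?t = (if \<lfloor>?t / \<delta>\<rfloor> = int j then 1 else 0)" for j
      unfolding I_def indicator_def floor_eq_iff_grid[OF \<delta>] by simp
    show "(\<integral>\<^sup>+x. ennreal (cmod (Z x y)) * ennreal (w (max 0 x)) \<partial>lborel) \<le>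
      ennreal (w ?t) * \<eta> + ennreal W * \<eta>' + ennreal (w ?t) * indicator {real J * \<delta>..} ?t * ?Fw"
    proof (cases "?t < real J * \<delta>")
      case False
      have "\<lfloor>?t / \<delta>\<rfloor> \<noteq> int j" if "j < J" for j
      proof -
        have "real J \<le> ?t / \<delta>" using False \<delta> by (simp add: field_simps)
        then have "int J \<le> \<lfloor>?t / \<delta>\<rfloor>" by (simp add: le_floor_iff)
        then show ?thesis using that by linarith
      qed
      then have "Z x y = F (x - ?t)" for x by (simp add: Z_def grid)
      then have "(\<integral>\<^sup>+x. ennreal (cmod (Z x y)) * ennreal (w (max 0 x)) \<partial>lborel) \<le> ennreal (w ?t) * ?Fw"
        using nn_integral_shift_weight_le[OF hl(1) t w w0] by simp
      also have "\<dots> = ennreal (w ?t) * indicator {real J * \<delta>..} ?t * ?Fw" using False by simp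
      finally show ?thesis by (rule order_trans) simp
    next
      case True
      define j0 where "j0 = nat \<lfloor>?t / \<delta>\<rfloor>"
      have j0: "\<lfloor>?t / \<delta>\<rfloor> = int j0" using t \<delta> by (simp add: j0_def)
      then have j0t: "real j0 * \<delta> \<le> ?t" "?t < real (Suc j0) * \<delta>" using floor_eq_iff_grid[OF \<delta>, of ?t j0] by auto
      have "real j0 * \<delta> < real J * \<delta>" using j0t(1) True by linarith
      have "0 \<le> real j0 * \<delta>" using \<delta> by (intro mult_nonneg_nonneg) auto
      have "j0 < J" using \<open>real j0 * \<delta> < real J * \<delta>\<close> \<delta> by simp
      then have Z: "Z x y = F (x - ?t) - Fc (x - real j0 * \<delta>)" for x
        by (simp add: Z_def grid j0 if_distrib[of "\<lambda>c. c * _"] cong: if_cong)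
      have 1: "(\<integral>\<^sup>+x. ennreal (cmod (F (x - ?t) - Fc (x - ?t))) * ennreal (w (max 0 x)) \<partial>lborel) \<le> ennreal (w ?t) * \<eta>"
      proof -
        have "half_line_fun (\<lambda>x. F x - Fc x)" using hl(1) Fc by (auto simp: half_line_fun_def)
        from nn_integral_shift_weight_le[OF this t w w0]
        have "(\<integral>\<^sup>+x. ennreal (cmod (F (x - ?t) - Fc (x - ?t))) * ennreal (w (max 0 x)) \<partial>lborel) \<le>
           ennreal (w ?t) * (\<integral>\<^sup>+x. ennreal (cmod (F x - Fc x)) * ennreal (w (max 0 x)) \<partial>lborel)" by simp
        also have "\<dots> \<le> ennreal (w ?t) * \<eta>" using \<eta> unfolding Fc_def by (intro mult_left_mono) auto
        finally show ?thesis .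
      qed
      have 2: "(\<integral>\<^sup>+x. ennreal (cmod (Fc (x - ?t) - Fc (x - real j0 * \<delta>))) * ennreal (w (max 0 x)) \<partial>lborel) \<le> ennreal W * \<eta>'"
      proof -
        have "(\<integral>\<^sup>+x. ennreal (cmod (Fc (x - ?t) - Fc (x - real j0 * \<delta>))) * ennreal (w (max 0 x)) \<partial>lborel) \<le>
          (\<integral>\<^sup>+x. ennreal W * ennreal (cmod (Fc (x - ?t) - Fc (x - real j0 * \<delta>))) \<partial>lborel)"
        proof (rule nn_integral_mono)
          fix x
          show "ennreal (cmod (Fc (x - ?t) - Fc (x - real j0 * \<delta>))) * ennreal (w (max 0 x)) \<le> ennreal W * ennreal (cmod (Fc (x - ?t) - Fc (x - real j0 * \<delta>)))"
          \<comment> \<open>Outside this interval both translates of the cut-off function vanish,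
            and inside it the weight is at most \<open>W\<close>.\<close>
          proof (cases "0 \<le> x \<and> x \<le> b + real J * \<delta>")
            case True
            then have "w (max 0 x) \<le> W" using W(1)[of x] by simp
            then show ?thesis by (subst mult.commute) (intro mult_right_mono ennreal_leI, auto)
          next
            case False
            then consider "x < 0" | "b + real J * \<delta> < x" by linarith
            then have "Fc (x - ?t) = 0 \<and> Fc (x - real j0 * \<delta>) = 0"
            proof cases
              case 1
              then have "x - ?t < 0" "x - real j0 * \<delta> < 0" using t \<open>0 \<le> real j0 * \<delta>\<close> by linarith+
              then show ?thesis by (simp add: half_line_fun_neg[OF Fc])
            next
              case 2
              then have "\<not> x - ?t \<le> b" "\<not> x - real j0 * \<delta> \<le> b" using True j0t \<open>real j0 * \<delta> < real J * \<delta>\<close> by linarith+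
              then show ?thesis by (simp add: Fc_def cut_off_def)
            qed
            then show ?thesis by simp
          qed
        qed
        also have "\<dots> = ennreal W * (\<integral>\<^sup>+x. ennreal (cmod (Fc (x - ?t) - Fc (x - real j0 * \<delta>))) \<partial>lborel)"
          by (rule nn_integral_cmult) measurable
        \<comment> \<open>Substituting x + S y for x leaves one translation, by the distance of
          \<open>S y\<close> from the left end of its cell. That distance lies in [0, \<delta>),
          where \<open>modulus\<close> applies.\<close>
        also have "(\<integral>\<^sup>+x. ennreal (cmod (Fc (x - ?t) - Fc (x - real j0 * \<delta>))) \<partial>lborel) =
            (\<integral>\<^sup>+x. ennreal (cmod (Fc ((?t - real j0 * \<delta>) + x) - Fc x)) \<partial>lborel)"
          by (subst nn_integral_shift[of _ ?t]) (auto simp: norm_minus_commute algebra_simps)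
        also have "ennreal W * \<dots> \<le> ennreal W * \<eta>'"
          unfolding Fc_def using j0t by (intro mult_left_mono modulus) (auto simp: algebra_simps)
        finally show ?thesis .
      qed
      have "(\<integral>\<^sup>+x. ennreal (cmod (Z x y)) * ennreal (w (max 0 x)) \<partial>lborel) \<le>
        (\<integral>\<^sup>+x. ennreal (cmod (F (x - ?t) - Fc (x - ?t))) * ennreal (w (max 0 x)) + ennreal (cmod (Fc (x - ?t) - Fc (x - real j0 * \<delta>))) * ennreal (w (max 0 x)) \<partial>lborel)"
      proof (rule nn_integral_mono)
        fix x
        have "cmod (Z x y) \<le> cmod (F (x - ?t) - Fc (x - ?t)) + cmod (Fc (x - ?t) - Fc (x - real j0 * \<delta>))"
          unfolding Z by norm
        then have "ennreal (cmod (Z x y)) \<le> ennreal (cmod (F (x - ?t) - Fc (x - ?t))) + ennreal (cmod (Fc (x - ?t) - Fc (x - real j0 * \<delta>)))"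
          by (simp flip: ennreal_plus)
        from mult_right_mono[OF this, of "ennreal (w (max 0 x))"]
        show "ennreal (cmod (Z x y)) * ennreal (w (max 0 x)) \<le> ennreal (cmod (F (x - ?t) - Fc (x - ?t))) * ennreal (w (max 0 x)) + ennreal (cmod (Fc (x - ?t) - Fc (x - real j0 * \<delta>))) * ennreal (w (max 0 x))"
          by (simp add: distrib_right)
      qed
      also have "\<dots> = (\<integral>\<^sup>+x. ennreal (cmod (F (x - ?t) - Fc (x - ?t))) * ennreal (w (max 0 x)) \<partial>lborel) +
          (\<integral>\<^sup>+x. ennreal (cmod (Fc (x - ?t) - Fc (x - real j0 * \<delta>))) * ennreal (w (max 0 x)) \<partial>lborel)"
        by (rule nn_integral_add) measurable
      also have "\<dots> \<le> ennreal (w ?t) * \<eta> + ennreal W * \<eta>'" by (intro add_mono 1 2)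
      finally show ?thesis by (rule order_trans) simp
    qed
  qed simp
  also have "\<dots> = (\<integral>\<^sup>+y. (\<eta> * (ennreal (cmod (K y)) * ennreal (w (S y))) + ennreal W * \<eta>' * ennreal (cmod (K y))) +
      ?Fw * (ennreal (cmod (K y)) * ennreal (w (S y)) * indicator {real J * \<delta>..} (S y)) \<partial>N)"
    by (simp add: distrib_left ac_simps)
  also have "\<dots> = (\<integral>\<^sup>+y. \<eta> * (ennreal (cmod (K y)) * ennreal (w (S y))) \<partial>N) + (\<integral>\<^sup>+y. ennreal W * \<eta>' * ennreal (cmod (K y)) \<partial>N) +
      (\<integral>\<^sup>+y. ?Fw * (ennreal (cmod (K y)) * ennreal (w (S y)) * indicator {real J * \<delta>..} (S y)) \<partial>N)"
    by (simp add: nn_integral_add)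
  also have "\<dots> = \<eta> * ?Kw + ennreal W * \<eta>' * ?K1 + ?Fw * ?Kt"
    by (simp add: nn_integral_cmult)
  finally show ?thesis .
qed

end

section \<open>Total boundedness of the images in one norm\<close>

lemma (in seminormed_group) sum_mem: "(\<And>j. j \<in> J \<Longrightarrow> v j \<in> space_of S) \<Longrightarrow> (\<Sum>j\<in>J. v j) \<in> space_of S"
  by (induction J rule: infinite_finite_induct) (auto simp: zero_mem add_mem)

context weight_sequence
begin

lemma fun_scale_diff: "fun_scale c f - fun_scale d f = fun_scale (c - d) f"
proof -
  obtain F where F: "half_line_fun F" "f = abs_ae_fun F" by (rule abs_ae_fun_cases)
  show ?thesis
    unfolding F(2) fun_scale.abs_eq[OF ae_equal_half_line[OF F(1)]]
      minus_abs_ae_fun[OF half_line_fun_scale[OF F(1)] half_line_fun_scale[OF F(1)]] by (simp add: left_diff_distrib)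
qed

text \<open>A finite net in the compact disc of coefficients is carried to a net of multiples of
  \<open>v\<close>.\<close>

lemma A_precompact_disc:
  assumes v: "v \<in> A" shows "A.precompact_in n {fun_scale c v | c. cmod c \<le> \<Lambda>}"
  unfolding A.precompact_in_def
proof (intro allI impI)
  fix e :: real assume e: "0 < e"
  \<comment> \<open>The summand 1 covers the case that \<open>v\<close> has seminorm 0.\<close>
  define d where "d = e / (snorm (A_algebra \<omega>) n v + 1)"
  have pos: "0 < snorm (A_algebra \<omega>) n v + 1" using A.snorm_nonneg[OF v, of n] by linarith
  have d: "0 < d" using e pos by (simp add: d_def)
  obtain k where k: "finite k" "cball (0::complex) \<Lambda> \<subseteq> (\<Union>x\<in>k. ball x d)"
    using compact_cball[of "0::complex" \<Lambda>] d unfolding compact_eq_totally_bounded by blast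
  have "{fun_scale c v | c. cmod c \<le> \<Lambda>} \<subseteq> (\<Union>x\<in>(\<lambda>c. fun_scale c v) ` k. A.snball n x e)"
  proof safe
    fix c :: complex assume "cmod c \<le> \<Lambda>"
    then have "c \<in> cball 0 \<Lambda>" by simp
    with k(2) obtain c' where c': "c' \<in> k" "c \<in> ball c' d" by blast
    have "snorm (A_algebra \<omega>) n (fun_scale c v - fun_scale c' v) = cmod (c - c') * snorm (A_algebra \<omega>) n v"
      by (simp add: fun_scale_diff snorm_A_scale)
    also have "\<dots> \<le> cmod (c - c') * (snorm (A_algebra \<omega>) n v + 1)" by (intro mult_left_mono) auto
    also have "\<dots> < d * (snorm (A_algebra \<omega>) n v + 1)"
      using c'(2) pos by (intro mult_strict_right_mono) (auto simp: dist_norm norm_minus_commute)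
    also have "\<dots> = e" using pos by (simp add: d_def)
    finally show "fun_scale c v \<in> (\<Union>x\<in>(\<lambda>c. fun_scale c v) ` k. A.snball n x e)"
      using c'(1) A_scale[OF v] by (auto simp: A.snball_def)
  qed
  then show "\<exists>F. finite F \<and> F \<subseteq> A \<and> {fun_scale c v | c. cmod c \<le> \<Lambda>} \<subseteq> (\<Union>x\<in>F. A.snball n x e)"
    using k(1) A_scale[OF v] by (intro exI[of _ "(\<lambda>c. fun_scale c v) ` k"]) auto
qed

lemma sum_abs_ae_fun:
  assumes "finite J" "\<And>j. half_line_fun (V j)"
  shows "half_line_fun (\<lambda>x. \<Sum>j\<in>J. c j * V j x)"
    and "(\<Sum>j\<in>J. fun_scale (c j) (abs_ae_fun (V j))) = abs_ae_fun (\<lambda>x. \<Sum>j\<in>J. c j * V j x)"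
proof -
  show h: "half_line_fun (\<lambda>x. \<Sum>j\<in>J. c j * V j x)" for J
  proof -
    have [measurable]: "V j \<in> borel_measurable borel" for j by (rule half_line_fun_measurable[OF assms(2)])
    have "(\<lambda>x. \<Sum>j\<in>J. c j * V j x) \<in> borel_measurable borel" by measurable
    then show ?thesis by (simp add: half_line_fun_def half_line_fun_neg[OF assms(2)])
  qed
  show "(\<Sum>j\<in>J. fun_scale (c j) (abs_ae_fun (V j))) = abs_ae_fun (\<lambda>x. \<Sum>j\<in>J. c j * V j x)"
    using assms(1)
  proof induction
    case empty
    then show ?case by (simp add: zero_ae_fun.abs_eq)
  next
    case (insert i J)
    have "(\<Sum>j\<in>insert i J. fun_scale (c j) (abs_ae_fun (V j))) = abs_ae_fun (\<lambda>x. c i * V i x) + abs_ae_fun (\<lambda>x. \<Sum>j\<in>J. c j * V j x)"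
      using insert by (simp add: fun_scale.abs_eq[OF ae_equal_half_line[OF assms(2)]])
    also have "\<dots> = abs_ae_fun (\<lambda>x. c i * V i x + (\<Sum>j\<in>J. c j * V j x))"
      by (rule plus_ae_fun.abs_eq[OF ae_equal_half_line[OF half_line_fun_scale[OF assms(2)]] ae_equal_half_line[OF h]])
    also have "(\<lambda>x. c i * V i x + (\<Sum>j\<in>J. c j * V j x)) = (\<lambda>x. \<Sum>j\<in>insert i J. c j * V j x)"
      using insert by simp
    finally show ?case .
  qed
qed

lemma A_translate:
  assumes F: "half_line_fun F" "abs_ae_fun F \<in> A" and t: "0 \<le> t"
  shows "half_line_fun (\<lambda>x. F (x - t))" and "abs_ae_fun (\<lambda>x. F (x - t)) \<in> A"
proof -
  show h: "half_line_fun (\<lambda>x. F (x - t))" using F(1) t by (auto simp: half_line_fun_def)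
  have "(lborel_norm n (\<lambda>x. F (x - t))) < \<infinity>" for n
    by (rule le_less_trans[OF nn_integral_shift_weight_le[OF F(1) t weight_measurable weight_submult weight_nonneg]])
      (use F(2) in \<open>auto simp: A_iff fun_norm_weight[OF F(1)] ennreal_mult_less_top\<close>)
  then show "abs_ae_fun (\<lambda>x. F (x - t)) \<in> A" by (rule A_memI[OF h])
qed

lemma A_cut_off:
  assumes F: "half_line_fun F" "abs_ae_fun F \<in> A"
  shows "abs_ae_fun (cut_off b F) \<in> A"
proof (rule A_memI[OF half_line_cut_off[OF F(1)]])
  fix n
  have "(lborel_norm n (\<lambda>t. cut_off b F t)) \<le> (lborel_norm n F)"
    by (intro nn_integral_mono mult_right_mono) (auto simp: cut_off_def)
  also have "\<dots> < \<infinity>" using F(2) by (simp add: A_iff fun_norm_weight[OF F(1)])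
  finally show "(lborel_norm n (\<lambda>t. cut_off b F t)) < \<infinity>" .
qed

lemma cut_off_approx:
  assumes F: "half_line_fun F" "abs_ae_fun F \<in> A" and \<eta>: "0 < \<eta>"
  obtains b where "0 \<le> b" "(lborel_norm n (\<lambda>x. F x - cut_off b F x)) \<le> ennreal \<eta>"
proof -
  note [measurable] = half_line_fun_measurable[OF F(1)] half_line_fun_measurable[OF half_line_cut_off[OF F(1)]]
  have "(\<lambda>i. \<integral>\<^sup>+x. ennreal (cmod (F x - cut_off (real i) F x)) * ennreal (\<omega> n (max 0 x)) \<partial>lborel) \<longlonglongrightarrow> (\<integral>\<^sup>+x. 0 \<partial>(lborel :: real measure))"
  proof (rule nn_integral_dominated_convergence)
    show "AE x in lborel. ennreal (cmod (F x - cut_off (real i) F x)) * ennreal (\<omega> n (max 0 x)) \<le> ennreal (cmod (F x)) * ennreal (\<omega> n (max 0 x))" for i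
      by (intro AE_I2 mult_right_mono) (auto simp: cut_off_def)
    show "(lborel_norm n F) < \<infinity>"
      using F(2) by (simp add: A_iff fun_norm_weight[OF F(1)])
    have "(\<lambda>i. ennreal (cmod (F x - cut_off (real i) F x)) * ennreal (\<omega> n (max 0 x))) \<longlonglongrightarrow> 0" for x
    proof (rule tendsto_eventually)
      obtain i0 where "x < real i0" using reals_Archimedean2 by blast
      then show "\<forall>\<^sub>F i in sequentially. ennreal (cmod (F x - cut_off (real i) F x)) * ennreal (\<omega> n (max 0 x)) = 0"
        by (auto simp: eventually_sequentially cut_off_def intro!: exI[of _ i0])
    qed
    then show "AE x in lborel. (\<lambda>i. ennreal (cmod (F x - cut_off (real i) F x)) * ennreal (\<omega> n (max 0 x))) \<longlonglongrightarrow> 0" by simp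
  qed measurable
  then have "eventually (\<lambda>i. (lborel_norm n (\<lambda>x. F x - cut_off (real i) F x)) < ennreal \<eta>) sequentially"
    by (intro order_tendstoD) (use \<eta> in auto)
  then obtain i where "(lborel_norm n (\<lambda>x. F x - cut_off (real i) F x)) < ennreal \<eta>"
    by (auto simp: eventually_sequentially)
  then show ?thesis by (intro that[of "real i"]) auto
qed

lemma bounded_subset_B:
  assumes "bounded_subset (B_algebra \<omega>) C"
  obtains k where "0 \<le> k" "\<And>\<nu>. \<nu> \<in> C \<Longrightarrow> measure_norm (\<omega> n) \<nu> \<le> ennreal k"
proof -
  obtain k where k: "\<And>\<nu>. \<nu> \<in> C \<Longrightarrow> snorm (B_algebra \<omega>) n \<nu> \<le> k" and C: "C \<subseteq> B"
    using assms unfolding bounded_subset_def by blast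
  have "measure_norm (\<omega> n) \<nu> \<le> ennreal (max k 0)" if "\<nu> \<in> C" for \<nu>
    using k[OF that] C that ennreal_snorm_B[of \<nu> n, symmetric] by (auto intro!: ennreal_leI)
  then show ?thesis by (intro that[of "max k 0"]) auto
qed

lemma tail_moment:
  assumes "((\<lambda>t. t * \<omega> n t / \<omega> m t) \<longlongrightarrow> 0) at_top" "0 < \<rho>"
  obtains R where "0 \<le> R" "\<And>t. R \<le> t \<Longrightarrow> t * \<omega> n t \<le> \<rho> * \<omega> m t"
proof -
  have "eventually (\<lambda>t. t * \<omega> n t / \<omega> m t < \<rho>) at_top" using assms by (rule order_tendstoD)
  then obtain b where b: "\<And>t. b \<le> t \<Longrightarrow> t * \<omega> n t / \<omega> m t < \<rho>" by (auto simp: eventually_at_top_linorder)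
  have "t * \<omega> n t \<le> \<rho> * \<omega> m t" if "max b 0 \<le> t" for t
    using b[of t] weight_pos[of t m] that by (simp add: divide_less_eq)
  then show ?thesis by (intro that[of "max b 0"]) auto
qed

text \<open>The approximants for all \<nu> in \<open>C\<close> have to lie in one totally bounded
  set. Cut-off, grid and coefficient bound are therefore chosen from \<open>e\<close>,
  \<open>g\<close> and the norm bounds of \<open>C\<close> alone, before any \<nu> is fixed; only
  the coefficients depend on \<nu>.\<close>

lemma A_precompact_conv:
  assumes g: "g \<in> A" and C: "bounded_subset (B_algebra \<omega>) C"
  shows "A.precompact_in n {f \<in> A. \<exists>\<nu>\<in>C. fun_measure f = measure_conv (fun_measure g) (measure_X \<nu>)}"
    (is "A.precompact_in n ?S")
proof (rule A.precompact_in_approx)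
  show "?S \<subseteq> A" by blast
  fix e :: real assume e: "0 < e"
  obtain F where F: "half_line_fun F" "g = abs_ae_fun F" "integrable lborel F"
    "\<And>n. (lborel_norm n F) < \<infinity>" by (rule A_cases[OF g]) (rule that)
  have CB: "C \<subseteq> B" using C by (simp add: bounded_subset_def)
  define Gn where "Gn = snorm (A_algebra \<omega>) n g"
  have Gn: "0 \<le> Gn" "(lborel_norm n F) = ennreal Gn"
    unfolding Gn_def using A.snorm_nonneg[OF g] ennreal_snorm_A[OF g, of n] by (auto simp: F(2) fun_norm_weight[OF F(1)])
  obtain m1 C1 where C1: "0 < C1" "\<And>t. 0 \<le> t \<Longrightarrow> t * \<omega> n t \<le> C1 * \<omega> m1 t" by (rule weight_moment[of n]) (rule that)
  obtain k1 where k1: "0 \<le> k1" "\<And>\<nu>. \<nu> \<in> C \<Longrightarrow> measure_norm (\<omega> m1) \<nu> \<le> ennreal k1"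
    by (rule bounded_subset_B[OF C, of m1]) (rule that)
  obtain C0 where C0: "0 < C0" "\<And>t. 0 \<le> t \<Longrightarrow> 1 \<le> C0 * \<omega> n t" by (rule weight_lower_bound[of n]) (rule that)
  \<comment> \<open>For all \<nu> in \<open>C\<close>, \<open>\<Lambda>\<close> bounds the n-th
    weighted integral of the density of X\<nu>, and \<open>\<Lambda>'\<close> its unweighted
    integral. The factor 4 is that of \<open>B_canonical\<close>.\<close>
  define \<Lambda> where "\<Lambda> = C1 * (4 * k1)"
  define \<Lambda>' where "\<Lambda>' = C0 * \<Lambda>"
  have \<Lambda>: "0 \<le> \<Lambda>" "0 \<le> \<Lambda>'" using C1 k1 C0 by (auto simp: \<Lambda>_def \<Lambda>'_def)
  text \<open>The index \<open>m\<close> is fixed before \<open>\<rho>\<close> is chosen, since \<open>\<rho>\<close> depends on a bound for \<open>C\<close> in the norm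
    with index \<open>m\<close>.\<close>
  obtain m where m: "((\<lambda>t. t * \<omega> n t / \<omega> m t) \<longlongrightarrow> 0) at_top" using ratio_limit by blast
  obtain k where k: "0 \<le> k" "\<And>\<nu>. \<nu> \<in> C \<Longrightarrow> measure_norm (\<omega> m) \<nu> \<le> ennreal k"
    by (rule bounded_subset_B[OF C, of m]) (rule that)
  \<comment> \<open>\<open>\<rho>\<close>, \<open>\<eta>\<close> and \<open>\<eta>'\<close> are
    chosen to make each of the three errors in \<open>grid_approx\<close> at most e/4; the summands
    1 keep the denominators positive.\<close>
  define \<rho> where "\<rho> = e / 4 / ((Gn + 1) * (4 * (k + 1)))"
  have \<rho>: "0 < \<rho>" using e k Gn by (simp add: \<rho>_def)
  obtain R where R: "0 \<le> R" "\<And>t. R \<le> t \<Longrightarrow> t * \<omega> n t \<le> \<rho> * \<omega> m t"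
    by (rule tail_moment[OF m \<rho>]) (rule that)
  define \<eta> where "\<eta> = e / 4 / (\<Lambda> + 1)"
  have \<eta>: "0 < \<eta>" using e \<Lambda> by (simp add: \<eta>_def)
  obtain b where b: "0 \<le> b" "(lborel_norm n (\<lambda>x. F x - cut_off b F x)) \<le> ennreal \<eta>"
    by (rule cut_off_approx[OF F(1) _ \<eta>, of n]) (use g F(2) in simp, rule that)
  \<comment> \<open>\<open>W\<close> must be fixed before the mesh \<open>\<delta>\<close>, because
    \<open>\<eta>'\<close> and then \<open>\<delta>\<close> depend on it. The interval up to
    \<open>b + (R + 1)\<close> leaves room for rounding \<open>R\<close> up to a grid point.\<close>
  obtain W where W: "0 < W" "\<And>t. 0 \<le> t \<Longrightarrow> t \<le> b + (R + 1) \<Longrightarrow> \<omega> n t \<le> W" by (rule weight_bounded[of "b + (R + 1)" n]) (rule that)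
  define \<eta>' where "\<eta>' = e / 4 / (W * (\<Lambda>' + 1))"
  have \<eta>': "0 < \<eta>'" using e \<Lambda> W by (simp add: \<eta>'_def)
  obtain d where d: "0 < d" "\<And>h. \<bar>h\<bar> < d \<Longrightarrow> (\<integral>\<^sup>+x. ennreal (cmod (cut_off b F (h + x) - cut_off b F x)) \<partial>lborel) \<le> ennreal \<eta>'"
    using L1_translation_continuous[OF integrable_cut_off[OF F(3)], rule_format, OF \<eta>', of b] by blast
  \<comment> \<open>A mesh of at most 1 keeps the end of the grid below \<open>R + 1\<close>, as the
    choice of \<open>W\<close> presupposes.\<close>
  define \<delta> where "\<delta> = min d 1"
  have \<delta>: "0 < \<delta>" "\<delta> \<le> 1" using d by (auto simp: \<delta>_def)
  define J where "J = nat \<lceil>R / \<delta>\<rceil>"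
  have J: "R \<le> real J * \<delta>" "real J * \<delta> \<le> R + 1"
  proof -
    have "0 \<le> R / \<delta>" using R \<delta> by simp
    then have "R / \<delta> \<le> real J" "real J \<le> R / \<delta> + 1" unfolding J_def by linarith+
    then have "R \<le> real J * \<delta>" "real J * \<delta> \<le> R + \<delta>" using \<delta>(1) by (simp_all add: field_simps)
    with \<delta>(2) show "R \<le> real J * \<delta>" "real J * \<delta> \<le> R + 1" by auto
  qed
  define V where "V j x = cut_off b F (x - real j * \<delta>)" for j :: nat and x
  have gA: "abs_ae_fun F \<in> A" using g F(2) by simp
  have V: "half_line_fun (V j)" "abs_ae_fun (V j) \<in> A" for j
    unfolding V_def using A_translate[OF half_line_cut_off[OF F(1)] A_cut_off[OF F(1) gA], of "real j * \<delta>" b] \<delta>(1) by auto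
  define D where "D = {\<Sum>j<J. v j | v. \<forall>j\<in>{..<J}. v j \<in> {fun_scale c (abs_ae_fun (V j)) | c. cmod c \<le> \<Lambda>'}}"
  have "A.precompact_in n D"
    unfolding D_def by (rule A.precompact_in_sum) (auto intro: A_precompact_disc V)
  moreover have DA: "D \<subseteq> A"
  proof
    fix x assume "x \<in> D"
    then obtain v where v: "x = (\<Sum>j<J. v j)" "\<forall>j\<in>{..<J}. v j \<in> {fun_scale c (abs_ae_fun (V j)) | c. cmod c \<le> \<Lambda>'}"
      unfolding D_def by blast
    have "v j \<in> A" if j: "j \<in> {..<J}" for j
    proof -
      obtain c where "v j = fun_scale c (abs_ae_fun (V j))" using v(2)[rule_format, OF j] by blast
      then show ?thesis using A_scale[OF V(2)] by simp
    qed
    then show "x \<in> A" unfolding v(1) by (rule A.sum_mem)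
  qed
  moreover have "\<exists>y\<in>D. snorm (A_algebra \<omega>) n (f - y) < e" if f: "f \<in> ?S" for f
  proof -
    from f obtain \<nu> where \<nu>: "\<nu> \<in> C" "fun_measure f = measure_conv (fun_measure g) (measure_X \<nu>)" and fA: "f \<in> A" by blast
    then have \<nu>B: "\<nu> \<in> B" using CB by blast
    let ?M = "total_variation \<nu>"
    obtain h where h: "represents \<nu> ?M (\<lambda>t. t) h"
      "\<And>n. (\<integral>\<^sup>+t. ennreal (cmod (h t)) * ennreal (\<omega> n t) \<partial>?M) \<le> 4 * measure_norm (\<omega> n) \<nu>"
      "\<And>n. (\<integral>\<^sup>+t. ennreal (cmod (h t)) * ennreal (\<omega> n t) \<partial>?M) < \<infinity>" by (rule B_canonical[OF \<nu>B]) (rule that)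
    have hm[measurable]: "h \<in> borel_measurable ?M" using representsD(3)[OF h(1)] by auto
    have [measurable]: "(\<lambda>t. t) \<in> borel_measurable ?M" by (rule measurable_borel_plus_borel[OF representsD(2)[OF h(1)]])
    have [measurable]: "\<omega> n \<in> borel_measurable ?M" for n
      using weight_measurable[of n] by (simp add: measurable_cong_sets[OF sets_total_variation refl])
    have le4: "(\<integral>\<^sup>+t. ennreal (cmod (h t)) * ennreal (\<omega> i t) \<partial>?M) \<le> ennreal (4 * a)"
      if "measure_norm (\<omega> i) \<nu> \<le> ennreal a" "0 \<le> a" for i a
    proof -
      have "4 * measure_norm (\<omega> i) \<nu> \<le> 4 * ennreal a" by (rule mult_left_mono[OF that(1)]) simp
      also have "\<dots> = ennreal (4 * a)" using that(2) by (simp add: ennreal_mult)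
      finally show ?thesis using h(2)[of i] by (rule order_trans[rotated])
    qed
    define K where "K t = complex_of_real t * h t" for t
    have [measurable]: "K \<in> borel_measurable ?M" unfolding K_def by measurable
    note mom = integrable_moment[OF h(1) h(3)]
    have rX: "represents (measure_X \<nu>) ?M (\<lambda>t. t) K" unfolding K_def by (rule represents_X[OF h(1) mom(2)])
    have Kw: "(\<integral>\<^sup>+t. ennreal (cmod (K t)) * ennreal (\<omega> n t) \<partial>?M) \<le> ennreal \<Lambda>"
    proof -
      have "(\<integral>\<^sup>+t. ennreal (cmod (K t)) * ennreal (\<omega> n t) \<partial>?M) \<le> ennreal C1 * (\<integral>\<^sup>+t. ennreal (cmod (h t)) * ennreal (\<omega> m1 t) \<partial>?M)"
        unfolding K_def using C1 by (intro nn_integral_moment_le representsD(2)[OF h(1)] hm) auto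
      also have "\<dots> \<le> ennreal C1 * ennreal (4 * k1)" by (intro mult_left_mono le4 k1 \<nu>(1)) simp
      also have "\<dots> = ennreal \<Lambda>" using C1 k1 by (simp add: \<Lambda>_def flip: ennreal_mult)
      finally show ?thesis .
    qed
    have K1: "(\<integral>\<^sup>+t. ennreal (cmod (K t)) \<partial>?M) \<le> ennreal \<Lambda>'"
    proof -
      have "(\<integral>\<^sup>+t. ennreal (cmod (K t)) \<partial>?M) \<le> (\<integral>\<^sup>+t. ennreal C0 * (ennreal (cmod (K t)) * ennreal (\<omega> n t)) \<partial>?M)"
      proof (rule nn_integral_mono)
        fix t assume "t \<in> space ?M"
        then have "ennreal (cmod (K t)) * 1 \<le> ennreal (cmod (K t)) * (ennreal C0 * ennreal (\<omega> n t))"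
          by (intro mult_left_mono one_le_ennreal_mult C0) auto
        then show "ennreal (cmod (K t)) \<le> ennreal C0 * (ennreal (cmod (K t)) * ennreal (\<omega> n t))" by (simp add: ac_simps)
      qed
      also have "\<dots> = ennreal C0 * (\<integral>\<^sup>+t. ennreal (cmod (K t)) * ennreal (\<omega> n t) \<partial>?M)" by (rule nn_integral_cmult) measurable
      also have "\<dots> \<le> ennreal C0 * ennreal \<Lambda>" by (intro mult_left_mono Kw) simp
      also have "\<dots> = ennreal \<Lambda>'" using C0 \<Lambda> by (simp add: \<Lambda>'_def flip: ennreal_mult)
      finally show ?thesis .
    qed
    have Kt: "(\<integral>\<^sup>+t. ennreal (cmod (K t)) * ennreal (\<omega> n t) * indicator {real J * \<delta>..} t \<partial>?M) \<le> ennreal (\<rho> * (4 * k))"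
    proof -
      have "(\<integral>\<^sup>+t. ennreal (cmod (K t)) * ennreal (\<omega> n t) * indicator {real J * \<delta>..} t \<partial>?M) \<le>
          (\<integral>\<^sup>+t. ennreal \<rho> * (ennreal (cmod (h t)) * ennreal (\<omega> m t)) \<partial>?M)"
      proof (rule nn_integral_mono)
        fix t assume "t \<in> space ?M"
        then have t: "0 \<le> t" by simp
        show "ennreal (cmod (K t)) * ennreal (\<omega> n t) * indicator {real J * \<delta>..} t \<le> ennreal \<rho> * (ennreal (cmod (h t)) * ennreal (\<omega> m t))"
        proof (cases "real J * \<delta> \<le> t")
          case True
          then have "cmod (h t) * (t * \<omega> n t) \<le> cmod (h t) * (\<rho> * \<omega> m t)" using J(1) by (intro mult_left_mono R) auto
          then show ?thesis
            using True t weight_nonneg[OF t] \<rho> by (simp add: K_def norm_mult ennreal_leI ac_simps flip: ennreal_mult)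
        qed simp
      qed
      also have "\<dots> = ennreal \<rho> * (\<integral>\<^sup>+t. ennreal (cmod (h t)) * ennreal (\<omega> m t) \<partial>?M)" by (rule nn_integral_cmult) measurable
      also have "\<dots> \<le> ennreal \<rho> * ennreal (4 * k)" by (intro mult_left_mono le4 k \<nu>(1)) simp
      also have "\<dots> = ennreal (\<rho> * (4 * k))" using \<rho> k by (simp flip: ennreal_mult)
      finally show ?thesis .
    qed
    interpret fun_measure_conv F "measure_X \<nu>" ?M "\<lambda>t. t" K
      by unfold_locales (rule F rX)+
    have "(lborel_norm i G) < \<infinity>" for i
      by (rule le_less_trans[OF G_weight_le[OF weight_measurable weight_submult weight_nonneg]])
        (use F(4)[of i] mom(1)[of i] in \<open>auto simp: ennreal_mult_less_top K_def\<close>)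
    then have GA: "abs_ae_fun G \<in> A" by (rule A_memI[OF half_line_G])
    have fG: "f = abs_ae_fun G"
      by (rule fun_measure_inj[OF fA GA]) (simp add: \<nu>(2) fun_measure_G F(2))
    \<comment> \<open>The value of X\<nu> on the j-th grid cell, hence bounded by the total
      mass.\<close>
    define c where "c j = (\<integral>y. indicator {real j * \<delta>..<real (Suc j) * \<delta>} y * K y \<partial>?M)" for j :: nat
    have c: "cmod (c j) \<le> \<Lambda>'" for j
    proof -
      have "ennreal (cmod (c j)) \<le> (\<integral>\<^sup>+t. ennreal (cmod (indicator {real j * \<delta>..<real (Suc j) * \<delta>} t * K t)) \<partial>?M)"
        unfolding c_def by (rule ennreal_norm_integral_le)
      also have "\<dots> \<le> (\<integral>\<^sup>+t. ennreal (cmod (K t)) \<partial>?M)"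
        by (intro nn_integral_mono ennreal_leI) (auto simp: indicator_def)
      also note K1
      finally show ?thesis using \<Lambda>(2) by (simp add: ennreal_le_iff)
    qed
    define y where "y = (\<Sum>j<J. fun_scale (c j) (abs_ae_fun (V j)))"
    have yD: "y \<in> D" unfolding y_def D_def using c by blast
    note Y = sum_abs_ae_fun[OF finite_lessThan[of J] V(1), where c=c]
    have fy: "f - y = abs_ae_fun (\<lambda>x. G x - (\<Sum>j<J. c j * V j x))"
      unfolding fG y_def Y(2) by (rule minus_abs_ae_fun[OF half_line_G Y(1)])
    have "fun_norm (\<omega> n) (f - y) \<le> ennreal \<eta> * (\<integral>\<^sup>+t. ennreal (cmod (K t)) * ennreal (\<omega> n t) \<partial>?M) +
        ennreal W * ennreal \<eta>' * (\<integral>\<^sup>+t. ennreal (cmod (K t)) \<partial>?M) +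
        (lborel_norm n F) *
        (\<integral>\<^sup>+t. ennreal (cmod (K t)) * ennreal (\<omega> n t) * indicator {real J * \<delta>..} t \<partial>?M)"
      unfolding fy fun_norm_weight[OF half_line_fun_diff[OF half_line_G Y(1)]] unfolding c_def V_def
    proof (rule grid_approx[OF weight_measurable weight_submult weight_nonneg \<delta>(1) b])
      show "\<omega> n t \<le> W" if "0 \<le> t" "t \<le> b + real J * \<delta>" for t using W(2) that J(2) by simp
      show "(\<integral>\<^sup>+x. ennreal (cmod (cut_off b F (s + x) - cut_off b F x)) \<partial>lborel) \<le> ennreal \<eta>'" if "0 \<le> s" "s < \<delta>" for s
        using that by (intro d(2)) (simp add: \<delta>_def)
    qed (use W in auto)
    also have "\<dots> \<le> ennreal \<eta> * ennreal \<Lambda> + ennreal W * ennreal \<eta>' * ennreal \<Lambda>' + ennreal Gn * ennreal (\<rho> * (4 * k))"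
      unfolding Gn(2) by (intro add_mono mult_left_mono Kw K1 Kt) auto
    also have "\<dots> = ennreal (\<eta> * \<Lambda> + W * \<eta>' * \<Lambda>' + Gn * (\<rho> * (4 * k)))"
      using \<eta> \<Lambda> W \<eta>' Gn \<rho> k by (simp add: ennreal_plus ennreal_mult)
    also have "\<dots> \<le> ennreal (3 * e / 4)"
    proof (rule ennreal_leI)
      have nz: "\<Lambda> + 1 \<noteq> 0" "W * (\<Lambda>' + 1) \<noteq> 0" "(Gn + 1) * (4 * (k + 1)) \<noteq> 0" using \<Lambda> W Gn k by auto
      have "\<eta> * \<Lambda> \<le> \<eta> * (\<Lambda> + 1)" using \<eta> by simp
      also have "\<dots> = e / 4" using nonzero_eq_divide_eq[OF nz(1)] \<eta>_def by blast
      finally have 1: "\<eta> * \<Lambda> \<le> e / 4" .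
      have "W * \<eta>' * \<Lambda>' \<le> W * \<eta>' * (\<Lambda>' + 1)" using \<eta>' W by simp
      also have "\<dots> = \<eta>' * (W * (\<Lambda>' + 1))" by (simp add: ac_simps)
      also have "\<dots> = e / 4" using nonzero_eq_divide_eq[OF nz(2)] \<eta>'_def by blast
      finally have 2: "W * \<eta>' * \<Lambda>' \<le> e / 4" .
      have "Gn * (\<rho> * (4 * k)) \<le> (Gn + 1) * (\<rho> * (4 * (k + 1)))" using Gn \<rho> k by (intro mult_mono) auto
      also have "\<dots> = \<rho> * ((Gn + 1) * (4 * (k + 1)))" by (simp only: ac_simps)
      also have "\<dots> = e / 4" using nonzero_eq_divide_eq[OF nz(3)] \<rho>_def by blast
      finally show "\<eta> * \<Lambda> + W * \<eta>' * \<Lambda>' + Gn * (\<rho> * (4 * k)) \<le> 3 * e / 4" using 1 2 by linarith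
    qed
    finally have "snorm (A_algebra \<omega>) n (f - y) \<le> 3 * e / 4"
      using snorm_A_le_iff[of "f - y" "3 * e / 4" n] e A.diff_mem[OF fA subsetD[OF DA yD]] by simp
    with yD e show ?thesis by (intro bexI[of _ y]) auto
  qed
  ultimately show "\<exists>D. D \<subseteq> A \<and> A.precompact_in n D \<and> (\<forall>x\<in>?S. \<exists>y\<in>D. snorm (A_algebra \<omega>) n (x - y) < e)" by blast
qed

end

section \<open>Absolutely continuous measures and approximate identities\<close>

text \<open>The bounded Borel pieces of a null set are null, so every sum in the supremum defining
  the variation vanishes.\<close>

lemma absolutely_continuous_total_variation:
  assumes \<nu>: "locally_finite_measure \<nu>" and ac: "abs_continuous \<nu>"
  shows "absolutely_continuous lborel_plus (total_variation \<nu>)"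
  unfolding absolutely_continuous_def
proof
  fix E assume E: "E \<in> null_sets lborel_plus"
  then have Es: "E \<in> sets borel_plus" by (auto simp: null_sets_def)
  then have "emeasure lborel_plus E = emeasure lborel E"
    by (subst emeasure_restrict_space) (auto simp: sets_borel_plus_iff)
  with E have zero: "emeasure lborel E = 0" by (simp add: null_sets_def)
  have lca: "locally_countably_additive \<nu>" using \<nu> by (simp add: locally_finite_measure_alt)
  have "emeasure (total_variation \<nu>) E \<le> 0"
    unfolding emeasure_total_variation[OF lca Es]
  proof (rule SUP_least)
    fix P assume P: "P \<in> {P. finite P \<and> P \<subseteq> bounded_borel \<and> disjoint P \<and> \<Union>P \<subseteq> E}"
    have "\<nu> F = 0" if "F \<in> P" for F
    proof -
      have F: "F \<in> bounded_borel" "F \<subseteq> E" using that P by auto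
      have "emeasure lborel F \<le> emeasure lborel E"
        using F(2) Es by (intro emeasure_mono) (auto simp: sets_borel_plus_iff)
      then show ?thesis using ac F(1) zero by (simp add: abs_continuous_def)
    qed
    then show "(\<Sum>F\<in>P. ennreal (cmod (\<nu> F))) \<le> 0" by (subst sum.neutral) auto
  qed
  with Es show "E \<in> null_sets (total_variation \<nu>)" by (simp add: null_sets_def)
qed

lemma shift_image_bounded_borel:
  assumes E: "E \<in> bounded_borel"
  shows "(\<lambda>t. t + 1) ` E \<in> bounded_borel" and "emeasure lborel ((\<lambda>t. t + 1) ` E) = emeasure lborel E"
proof -
  obtain b where b: "E \<subseteq> {0..b}" by (rule bounded_borel_boundE[OF E])
  have Eb: "E \<in> sets borel" using bounded_borel_sets[OF E] by (simp add: sets_borel_plus_iff)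
  have eq: "(\<lambda>t. t + 1) ` E = (\<lambda>t. t - 1) -` E \<inter> space borel"
    by (auto intro!: image_eqI[of _ _ "_ - 1"])
  have s: "(\<lambda>t. t + 1) ` E \<in> sets borel" unfolding eq by (rule measurable_sets[OF _ Eb]) simp
  have "(\<lambda>t. t + 1) ` E \<subseteq> {0..b + 1}" using b by auto
  with s show "(\<lambda>t. t + 1) ` E \<in> bounded_borel"
    unfolding bounded_borel_def by (auto simp: sets_borel_plus_iff intro: bounded_subset[OF bounded_closed_interval])
  have "emeasure lborel ((\<lambda>t. t + 1) ` E) = (\<integral>\<^sup>+t. indicator ((\<lambda>t. t + 1) ` E) t \<partial>lborel)" using s by simp
  also have "\<dots> = (\<integral>\<^sup>+t. indicator ((\<lambda>t. t + 1) ` E) (1 + t) \<partial>lborel)"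
    by (rule nn_integral_shift) (use s in measurable)
  also have "\<dots> = (\<integral>\<^sup>+t. indicator E t \<partial>lborel)" by (intro nn_integral_cong) (auto simp: indicator_def)
  also have "\<dots> = emeasure lborel E" using Eb by simp
  finally show "emeasure lborel ((\<lambda>t. t + 1) ` E) = emeasure lborel E" .
qed

text \<open>Restricting \<nu> to [1, \<infinity>) and moving it back by 1 gives a measure that
  agrees with \<mu> on intervals, hence everywhere. This allows absolute continuity to pass from a
  translate back to \<mu>.\<close>

lemma locally_finite_measure_shift_eq:
  assumes r: "represents \<nu> M (\<lambda>t. t) h" and r': "represents \<mu> N S K"
    and shift: "\<And>x. \<nu> {0..<x} = \<mu> {0..<x - 1}" and E: "E \<in> bounded_borel"
  shows "\<mu> E = \<nu> ((\<lambda>t. t + 1) ` E)"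
proof -
  \<comment> \<open>\<open>T\<close> moves back by 1. Below 1 its value is irrelevant, because
    \<open>H\<close> vanishes there; the maximum keeps it in the half-line.\<close>
  define T where "T t = max 0 (t - 1)" for t :: real
  define H where "H t = indicator {1..} t * h t" for t
  define \<mu>' where "\<mu>' E = (if E \<in> bounded_borel then \<integral>t. indicator E (T t) * H t \<partial>M else 0)" for E
  have i1: "(indicator {1..} :: real \<Rightarrow> complex) \<in> borel_measurable borel_plus"
    by (rule measurable_restrict_space1) simp
  have Hint: "integrable M H"
    unfolding H_def by (rule integrable_bounded_mult[OF representsD(2,3)[OF r] i1 cmod_indicator_le])
  have T: "T \<in> measurable M borel_plus"
  proof (rule measurable_restrict_space2)
    have "(\<lambda>t::real. t) \<in> borel_measurable M" by (rule measurable_borel_plus_borel[OF representsD(2)[OF r]])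
    then show "T \<in> borel_measurable M" unfolding T_def by measurable
  qed (simp add: T_def)
  have rep: "represents \<mu>' M T H"
    unfolding represents_def using representsD(1)[OF r] T Hint by (simp add: \<mu>'_def)
  have pt: "indicator E (T t) * H t = indicator ((\<lambda>t. t + 1) ` E) t * h t" if "E \<subseteq> {0..}" for E t
  proof (cases "1 \<le> t")
    case True
    then have "T t = t - 1" by (simp add: T_def)
    moreover have "t - 1 \<in> E \<longleftrightarrow> t \<in> (\<lambda>t. t + 1) ` E" by (auto intro!: image_eqI[of _ _ "t - 1"])
    ultimately show ?thesis using True by (simp add: H_def indicator_def)
  next
    case False
    then have "t \<notin> (\<lambda>t. t + 1) ` E" using that by auto
    with False show ?thesis by (simp add: H_def)
  qed
  have "\<mu>' = \<mu>"
  proof (rule represents_eqI[OF rep r'])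
    fix y :: real
    show "\<mu>' {0..<y} = \<mu> {0..<y}"
    proof (cases "0 < y")
      case True
      have int: "integrable M (\<lambda>t. indicator {0..<x} t * h t)" for x
        by (rule integrable_bounded_mult[OF representsD(2,3)[OF r]
              indicator_borel_plus_measurable[OF bounded_borel_sets[OF bounded_borel_interval]] cmod_indicator_le])
      have "\<mu>' {0..<y} = (\<integral>t. indicator {0..<y + 1} t * h t - indicator {0..<1} t * h t \<partial>M)"
        unfolding \<mu>'_def if_P[OF bounded_borel_interval]
      proof (intro Bochner_Integration.integral_cong refl)
        fix t
        have "(\<lambda>t. t + 1) ` {0..<y} = {1..<y + 1}"
          by (auto simp: image_iff intro!: bexI[of _ "_ - 1"])
        then have "indicator {0..<y} (T t) * H t = indicator {1..<y + 1} t * h t"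
          using pt[of "{0..<y}" t] by (simp add: subset_eq)
        then show "indicator {0..<y} (T t) * H t = indicator {0..<y + 1} t * h t - indicator {0..<1} t * h t"
          using True by (auto simp: indicator_def)
      qed
      also have "\<dots> = \<nu> {0..<y + 1} - \<nu> {0..<1}"
        using int by (simp add: representsD(4)[OF r bounded_borel_interval])
      \<comment> \<open>For \<open>x = 1\<close> the interval on the right of \<open>shift\<close>
        is empty, so \<nu> has the value 0 on [0, 1).\<close>
      also have "\<nu> {0..<1} = \<mu> {}" by (simp add: shift)
      also have "\<mu> {} = 0" using representsD(4)[OF r' bounded_borel_empty] by simp
      finally show ?thesis by (simp add: shift)
    next
      case False
      then have "{0..<y} = {}" by simp
      then show ?thesis using representsD(4)[OF r' bounded_borel_empty] by (simp add: \<mu>'_def)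
    qed
  qed
  note EI = shift_image_bounded_borel(1)[OF E]
  have "\<mu> E = (\<integral>t. indicator E (T t) * H t \<partial>M)"
    using E unfolding \<open>\<mu>' = \<mu>\<close>[symmetric] by (simp add: \<mu>'_def)
  also have "\<dots> = (\<integral>t. indicator ((\<lambda>t. t + 1) ` E) t * h t \<partial>M)"
    using bounded_borel_sets[OF E] by (intro Bochner_Integration.integral_cong refl pt) (simp add: sets_borel_plus_iff)
  also have "\<dots> = \<nu> ((\<lambda>t. t + 1) ` E)" by (rule representsD(4)[OF r EI, symmetric])
  finally show ?thesis .
qed

context weight_sequence
begin

text \<open>The density is the product of the Radon-Nikodym density \<open>p\<close> of |\<mu>| with
  respect to Lebesgue measure and the density \<open>h\<close> of \<mu> with respect to |\<mu>|. Its
  weighted norms are those of \<open>h\<close> with respect to |\<mu>|, hence finite.\<close>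

lemma abs_continuous_density:
  assumes \<mu>: "\<mu> \<in> B" and ac: "abs_continuous \<mu>"
  shows "\<exists>g\<in>A. fun_measure g = \<mu>"
proof -
  let ?m = "total_variation \<mu>"
  obtain h where h: "represents \<mu> ?m (\<lambda>t. t) h"
    "\<And>n. (\<integral>\<^sup>+t. ennreal (cmod (h t)) * ennreal (\<omega> n t) \<partial>?m) < \<infinity>"
    by (rule B_canonical[OF \<mu>]) (rule that)
  have sf: "sigma_finite_measure lborel_plus"
    by (rule sigma_finite_measure_restrict_space) (use lborel.sigma_finite_measure_axioms in auto)
  interpret L: sigma_finite_measure lborel_plus by (rule sf)
  have "absolutely_continuous lborel_plus ?m"
    using absolutely_continuous_total_variation[OF _ ac] \<mu> by (simp add: B_iff)
  note RN = finite_measure_total_variation[OF B_finite_variation[OF \<mu>]] this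
  have s: "sets ?m = sets lborel_plus" by simp
  obtain p where p: "p \<in> borel_measurable lborel_plus" "AE x in lborel_plus. RN_deriv lborel_plus ?m x = ennreal (p x)" "\<And>x. 0 \<le> p x"
    using L.real_RN_deriv[OF RN s] by metis
  have dens: "?m = density lborel_plus (\<lambda>x. ennreal (p x))"
    using L.density_RN_deriv[OF RN(2) s] density_cong[OF borel_measurable_RN_deriv _ p(2)] p(1) by simp
  have hm: "h \<in> borel_measurable borel_plus"
    using borel_measurable_integrable[OF representsD(3)[OF h(1)]] by (simp add: measurable_cong_sets[OF sets_total_variation refl])
  have pm: "p \<in> borel_measurable borel_plus" using p(1) by (simp add: measurable_cong_sets[OF sets_lborel_plus refl])
  have hl: "h \<in> borel_measurable lborel_plus" using hm by (simp add: measurable_cong_sets[OF sets_lborel_plus refl])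
  define F where "F t = indicator {0..} t *\<^sub>R (complex_of_real (p t) * h t)" for t
  have F: "half_line_fun F"
    unfolding half_line_fun_def F_def using hm pm by (auto intro!: zero_extension_measurable)
  have nn: "(lborel_norm n F) = (\<integral>\<^sup>+t. ennreal (cmod (h t)) * ennreal (\<omega> n t) \<partial>?m)" for n
  proof -
    have wl: "\<omega> n \<in> borel_measurable lborel_plus" using weight_measurable[of n] by (simp add: measurable_cong_sets[OF sets_lborel_plus refl])
    have "(\<integral>\<^sup>+t. ennreal (cmod (h t)) * ennreal (\<omega> n t) \<partial>?m) = (\<integral>\<^sup>+t. ennreal (p t) * (ennreal (cmod (h t)) * ennreal (\<omega> n t)) \<partial>lborel_plus)"
      unfolding dens using p(1) hl wl by (subst nn_integral_density) auto
    also have "\<dots> = (lborel_norm n F)"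
      by (subst nn_integral_restrict_space)
        (auto intro!: nn_integral_cong simp: F_def indicator_def norm_mult ennreal_mult p(3) mult.assoc)
    finally show ?thesis by simp
  qed
  have FA: "abs_ae_fun F \<in> A" by (rule A_memI[OF F]) (simp only: nn h(2))
  note r = represents_fun_measure[OF F A_integrable[OF F FA]]
  have "fun_measure (abs_ae_fun F) = \<mu>"
  proof (rule represents_eqI[OF r h(1)])
    fix y :: real
    have [measurable]: "{0..<y} \<in> sets lborel_plus" using bounded_borel_sets[OF bounded_borel_interval[of y]] by simp
    have "\<mu> {0..<y} = (\<integral>t. indicator {0..<y} t * h t \<partial>density lborel_plus (\<lambda>x. ennreal (p x)))"
      unfolding dens[symmetric] by (rule representsD(4)[OF h(1) bounded_borel_interval])
    also have "\<dots> = (\<integral>t. p t *\<^sub>R (indicator {0..<y} t * h t) \<partial>lborel_plus)"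
      using p hl by (subst integral_density) auto
    also have "\<dots> = (\<integral>t. indicator {0..<y} (max 0 t) * F t \<partial>lborel)"
      by (subst integral_restrict_space)
        (auto intro!: Bochner_Integration.integral_cong simp: F_def indicator_def scaleR_conv_of_real)
    also have "\<dots> = fun_measure (abs_ae_fun F) {0..<y}" by (rule representsD(4)[OF r bounded_borel_interval, symmetric])
    finally show "fun_measure (abs_ae_fun F) {0..<y} = \<mu> {0..<y}" by simp
  qed
  with FA show ?thesis by blast
qed

lemma fun_measure_null:
  assumes f: "f \<in> A" and E: "E \<in> bounded_borel" "emeasure lborel E = 0"
  shows "fun_measure f E = 0"
proof -
  obtain F where F: "half_line_fun F" "f = abs_ae_fun F" "integrable lborel F" by (rule A_cases[OF f]) (rule that)
  have "E \<in> null_sets lborel" using E by (auto simp: null_sets_def sets_borel_plus_iff dest: bounded_borel_sets)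
  then have "AE t in lborel. t \<notin> E" by (rule AE_not_in)
  then have "AE t in lborel. indicator E (max 0 t) * F t = 0"
    by eventually_elim (auto simp: indicator_def max_def half_line_fun_neg[OF F(1)])
  then show ?thesis
    unfolding F(2) representsD(4)[OF represents_fun_measure[OF F(1,3)] E(1)] by (rule integral_eq_zero_AE)
qed

text \<open>The factor 1/t is cancelled by X, which turns \<open>bump k\<close> into the normalised
  indicator of an interval shrinking to 1 from the right.\<close>

definition bump :: "nat \<Rightarrow> real \<Rightarrow> complex" where
  "bump k t = complex_of_real (indicator {1..1 + 1 / real (Suc k)} t * real (Suc k) / t)"

lemma half_line_bump: "half_line_fun (bump k)"
  unfolding half_line_fun_def bump_def[abs_def] by (auto simp: indicator_def)

text \<open>The height \<open>Suc k\<close> cancels the length of the support, which stays inside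
  [1, 2]. The bound is independent of \<open>k\<close>, so the bumps form a bounded set in every
  norm.\<close>

lemma bump_norm_le:
  assumes W: "\<And>t. 0 \<le> t \<Longrightarrow> t \<le> 2 \<Longrightarrow> \<omega> n t \<le> W" "0 < W"
  shows "(lborel_norm n (\<lambda>t. bump k t)) \<le> ennreal W"
proof -
  let ?I = "{1..1 + 1 / real (Suc k)}"
  have "(lborel_norm n (\<lambda>t. bump k t)) \<le> (\<integral>\<^sup>+t. ennreal (real (Suc k) * W) * indicator ?I t \<partial>lborel)"
  proof (rule nn_integral_mono)
    fix t :: real
    show "ennreal (cmod (bump k t)) * ennreal (\<omega> n (max 0 t)) \<le> ennreal (real (Suc k) * W) * indicator ?I t"
    proof (cases "t \<in> ?I")
      case True
      have "1 / real (Suc k) \<le> 1" by simp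
      then have t: "1 \<le> t" "t \<le> 2" using True unfolding atLeastAtMost_iff by linarith+
      have c: "cmod (bump k t) = real (Suc k) / t" unfolding bump_def norm_of_real using True t by (simp add: abs_of_pos)
      have "cmod (bump k t) * \<omega> n t \<le> real (Suc k) * W"
        unfolding c using t W(1)[of t] weight_nonneg[of t n] by (intro mult_mono) (auto simp: divide_le_eq mult_le_cancel_left1)
      then show ?thesis using True t weight_nonneg[of t n] by (simp add: max_def ennreal_leI flip: ennreal_mult)
    qed (simp add: bump_def)
  qed
  also have "\<dots> = ennreal (real (Suc k) * W) * emeasure lborel ?I" by (rule nn_integral_cmult_indicator) simp
  also have "\<dots> = ennreal W" using W(2) by (simp flip: ennreal_mult)
  finally show ?thesis .
qed

lemma bump_A: "abs_ae_fun (bump k) \<in> A"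
proof (rule A_memI[OF half_line_bump])
  fix n
  obtain W where W: "0 < W" "\<And>t. 0 \<le> t \<Longrightarrow> t \<le> 2 \<Longrightarrow> \<omega> n t \<le> W" by (rule weight_bounded[of 2 n]) (rule that)
  show "(lborel_norm n (\<lambda>t. bump k t)) < \<infinity>"
    by (rule le_less_trans[OF bump_norm_le[OF W(2,1)]]) simp_all
qed

lemma bounded_bump: "bounded_subset (A_algebra \<omega>) (range (\<lambda>k. abs_ae_fun (bump k)))"
  unfolding bounded_subset_def
proof (intro conjI allI)
  show "range (\<lambda>k. abs_ae_fun (bump k)) \<subseteq> A" using bump_A by blast
  fix n
  obtain W where W: "0 < W" "\<And>t. 0 \<le> t \<Longrightarrow> t \<le> 2 \<Longrightarrow> \<omega> n t \<le> W" by (rule weight_bounded[of 2 n]) (rule that)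
  have "fun_norm (\<omega> n) (abs_ae_fun (bump k)) \<le> ennreal W" for k
    unfolding fun_norm_weight[OF half_line_bump] by (rule bump_norm_le[OF W(2,1)])
  then have "snorm (A_algebra \<omega>) n (abs_ae_fun (bump k)) \<le> W" for k
    using snorm_A_le_iff[OF bump_A, of W] W(1) by simp
  then show "\<exists>K. \<forall>x\<in>range (\<lambda>k. abs_ae_fun (bump k)). snorm (A_algebra \<omega>) n x \<le> K" by auto
qed

text \<open>With \<mu> as the outer measure, the value on [0, x) is the integral of
  \<open>\<psi> k\<close> against \<mu>, where \<open>\<psi> k t\<close> is the average of the
  indicator of t + s < x over s in the support of \<open>bump k\<close>. These averages are bounded
  by 1 and converge pointwise.\<close>

lemma D_bar_bump_tendsto:
  assumes \<mu>: "\<mu> \<in> B"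
  shows "(\<lambda>k. D_bar \<mu> (fun_measure (abs_ae_fun (bump k))) {0..<x}) \<longlonglongrightarrow> \<mu> {0..<x - 1}"
proof -
  let ?m = "total_variation \<mu>"
  obtain h where h: "represents \<mu> ?m (\<lambda>t. t) h"
    "\<And>n. (\<integral>\<^sup>+t. ennreal (cmod (h t)) * ennreal (\<omega> n t) \<partial>?m) < \<infinity>"
    by (rule B_canonical[OF \<mu>]) (rule that)
  define I where "I k = {1..1 + 1 / real (Suc k)}" for k
  define H where "H k t = complex_of_real (real (Suc k) * indicator (I k) t)" for k t
  have Hint: "integrable lborel (H k)" for k
    unfolding H_def I_def by (intro integrable_of_real integrable_mult_right) (simp add: emeasure_lborel_Icc_eq)
  have rX: "represents (measure_X (fun_measure (abs_ae_fun (bump k)))) lborel (max 0) (H k)" for k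
  proof -
    have "(\<lambda>t. complex_of_real (max 0 t) * bump k t) = H k"
      by (auto simp: fun_eq_iff bump_def H_def I_def indicator_def max_def)
    then show ?thesis
      using represents_X[OF represents_fun_measure[OF half_line_bump A_integrable[OF half_line_bump bump_A]], of k] Hint[of k] by simp
  qed
  note E = bounded_borel_interval[of x]
  note ind = indicator_bounded_borel_measurable[OF E]
  define \<psi> where "\<psi> k t = measure_integral (measure_X (fun_measure (abs_ae_fun (bump k)))) (\<lambda>s. indicator {0..<x} (t + s))" for k t
  have \<psi>: "\<psi> k t = (\<integral>s. indicator {0..<x} (t + max 0 s) * H k s \<partial>lborel)" for k t
    unfolding \<psi>_def by (rule measure_integral_shift[OF rX ind cmod_indicator_le])
  have \<psi>m: "\<psi> k \<in> borel_measurable borel_plus" for k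
    unfolding \<psi>_def[abs_def] by (rule measurable_restrict_space1[OF measure_integral_shift_measurable(1)[OF rX ind cmod_indicator_le]])
  have H1: "(\<integral>s. cmod (H k s) \<partial>lborel) = 1" "(\<integral>s. H k s \<partial>lborel) = 1" for k
    unfolding H_def I_def norm_of_real integral_complex_of_real by (simp_all add: abs_mult)
  have \<psi>B: "cmod (\<psi> k t) \<le> 1" for k t
    unfolding \<psi>_def using measure_integral_shift_measurable(2)[OF rX ind cmod_indicator_le, of k t] by (simp add: H1)
  \<comment> \<open>Since s \<ge> 1 on the support, the average is 0 for every k as soon as t \<ge>
    x - 1, including the endpoint; for smaller t it is eventually 1. The limit is thus exactly the
    indicator of a half-open interval, whatever atoms \<mu> has.\<close>
  have lim: "(\<lambda>k. \<psi> k t) \<longlonglongrightarrow> indicator {0..<x - 1} t" if t: "0 \<le> t" for t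
  proof (cases "t < x - 1")
    case True
    obtain k0 where k0: "1 / real (Suc k0) < x - 1 - t" using nat_approx_posE[of "x - 1 - t"] True by auto
    have "\<psi> k t = 1" if "k0 \<le> k" for k
    proof -
      have "1 / real (Suc k) \<le> 1 / real (Suc k0)" using that by (simp add: frac_le)
      then have eq: "indicator {0..<x} (t + max 0 s) * H k s = H k s" for s
        using k0 t by (auto simp: H_def I_def indicator_def)
      show ?thesis unfolding \<psi> eq by (rule H1)
    qed
    then have "\<forall>\<^sub>F k in sequentially. \<psi> k t = indicator {0..<x - 1} t"
      using True t by (auto simp: eventually_sequentially)
    then show ?thesis by (rule tendsto_eventually)
  next
    case False
    have eq: "indicator {0..<x} (t + max 0 s) * H k s = 0" for s k
      using False by (auto simp: H_def I_def indicator_def)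
    have "\<psi> k t = 0" for k unfolding \<psi> eq by simp
    then show ?thesis using False by simp
  qed
  have "D_bar \<mu> (fun_measure (abs_ae_fun (bump k))) {0..<x} = (\<integral>t. \<psi> k t * h t \<partial>?m)" for k
  proof -
    have "D_bar \<mu> (fun_measure (abs_ae_fun (bump k))) {0..<x} = measure_conv \<mu> (measure_X (fun_measure (abs_ae_fun (bump k)))) {0..<x}"
      unfolding D_bar_def
      by (simp add: measure_conv_commute[OF finite_variation_represents[OF rX] B_finite_variation[OF \<mu>]])
    also have "\<dots> = measure_integral \<mu> (\<psi> k)" using E by (simp add: measure_conv_def \<psi>_def[abs_def])
    also have "\<dots> = (\<integral>t. \<psi> k t * h t \<partial>?m)" by (rule measure_integral_eq[OF h(1) \<psi>m \<psi>B])
    finally show ?thesis .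
  qed
  moreover have "(\<lambda>k. \<integral>t. \<psi> k t * h t \<partial>?m) \<longlonglongrightarrow> (\<integral>t. indicator {0..<x - 1} t * h t \<partial>?m)"
    by (rule integral_bounded_mult_tendsto[OF representsD(2,3)[OF h(1)]
        indicator_borel_plus_measurable[OF bounded_borel_sets[OF bounded_borel_interval]] \<psi>m \<psi>B lim])
  moreover have "\<mu> {0..<x - 1} = (\<integral>t. indicator {0..<x - 1} t * h t \<partial>?m)"
    by (rule representsD(4)[OF h(1) bounded_borel_interval])
  ultimately show ?thesis by simp
qed

lemma D_bar_bump_null:
  assumes \<mu>: "\<mu> \<in> B" and E: "E \<in> bounded_borel" "emeasure lborel E = 0"
  shows "D_bar \<mu> (fun_measure (abs_ae_fun (bump k))) E = 0"
  using fun_measure_null[OF D_op(1)[OF bump_A \<mu>] E] D_op(2)[OF bump_A \<mu>] by simp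

text \<open>The functions \<open>bump k\<close> approximate the point mass at 1, so a weak cluster point \<open>\<nu>\<close> of their
  images is the translate of \<open>\<mu>\<close> by 1; as the images are absolutely continuous, so is \<open>\<nu>\<close>.\<close>

lemma abs_continuous_of_cluster_point:
  assumes \<mu>: "\<mu> \<in> B" and \<nu>: "\<nu> \<in> B"
    and cluster: "\<And>E l. E \<in> bounded_borel \<Longrightarrow> (\<lambda>k. D_bar \<mu> (fun_measure (abs_ae_fun (bump k))) E) \<longlonglongrightarrow> l \<Longrightarrow> \<nu> E = l"
  shows "abs_continuous \<mu>"
proof -
  obtain h where h: "represents \<mu> (total_variation \<mu>) (\<lambda>t. t) h" by (rule B_canonical[OF \<mu>]) (rule that)
  obtain k where k: "represents \<nu> (total_variation \<nu>) (\<lambda>t. t) k" by (rule B_canonical[OF \<nu>]) (rule that)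
  have shift: "\<nu> {0..<x} = \<mu> {0..<x - 1}" for x
    by (rule cluster[OF bounded_borel_interval D_bar_bump_tendsto[OF \<mu>]])
  have null: "\<nu> E = 0" if E: "E \<in> bounded_borel" "emeasure lborel E = 0" for E
    by (rule cluster[OF E(1)]) (simp add: D_bar_bump_null[OF \<mu> E])
  show ?thesis
    unfolding abs_continuous_def
    using locally_finite_measure_shift_eq[OF k h shift] null shift_image_bounded_borel by simp
qed

section \<open>Weak compactness implies absolute continuity\<close>

lemma A_evaluation_dual:
  assumes E: "E \<in> bounded_borel" shows "(\<lambda>f. fun_measure f E) \<in> dual_space (A_algebra \<omega>)"
proof -
  obtain C where C: "\<And>\<nu>. \<nu> \<in> B \<Longrightarrow> cmod (\<nu> E) \<le> C * snorm (B_algebra \<omega>) 0 \<nu>" "0 \<le> C"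
    by (rule B_evaluation_bound[OF E]) (rule that)
  show ?thesis
  proof (rule A.dual_spaceI)
    fix f assume f: "f \<in> A"
    have "cmod (fun_measure f E) \<le> C * snorm (B_algebra \<omega>) 0 (fun_measure f)" by (rule C(1)[OF fun_measure_B[OF f]])
    also have "\<dots> \<le> C * snorm (A_algebra \<omega>) 0 f" by (intro mult_left_mono snorm_fun_measure_le f C(2))
    finally show "cmod (fun_measure f E) \<le> C * snorm (A_algebra \<omega>) 0 f" .
  qed (simp_all add: fun_measure_add fun_measure_scale scale_A)
qed

lemma A_separated:
  assumes "f \<in> A" "g \<in> A" "f \<noteq> g"
  shows "\<exists>\<phi>\<in>dual_space (A_algebra \<omega>). \<phi> f \<noteq> \<phi> g"
proof -
  obtain E where E: "fun_measure f E \<noteq> fun_measure g E" using fun_measure_inj[OF assms(1,2)] assms(3) by blast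
  have "fun_measure f F = 0" "fun_measure g F = 0" if "F \<notin> bounded_borel" for F
    using fun_measure_B[OF assms(1)] fun_measure_B[OF assms(2)] that unfolding B_iff locally_finite_measure_alt by blast+
  with E have "E \<in> bounded_borel" by metis
  then show ?thesis using E by (intro bexI[of _ "\<lambda>f. fun_measure f E"] A_evaluation_dual)
qed

lemma weakly_Montel_D_op_imp:
  assumes \<mu>: "\<mu> \<in> B" and wM: "weakly_Montel (A_algebra \<omega>) (A_algebra \<omega>) (D_op \<omega> \<mu>)"
  shows "abs_continuous \<mu>"
proof -
  let ?f = "\<lambda>k. abs_ae_fun (bump k)"
  have "relatively_compact_in (weak_topology (A_algebra \<omega>)) (D_op \<omega> \<mu> ` range ?f)"
    using wM bounded_bump unfolding weakly_Montel_def by blast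
  from A.weak_cluster_point[OF this, of "\<lambda>k. D_op \<omega> \<mu> (?f k)"]
  obtain y where y: "y \<in> A" "\<And>\<phi> l. \<phi> \<in> dual_space (A_algebra \<omega>) \<Longrightarrow> (\<lambda>k. \<phi> (D_op \<omega> \<mu> (?f k))) \<longlonglongrightarrow> l \<Longrightarrow> \<phi> y = l"
    by blast
  show ?thesis
  proof (rule abs_continuous_of_cluster_point[OF \<mu> fun_measure_B[OF y(1)]])
    fix E l assume "E \<in> bounded_borel" "(\<lambda>k. D_bar \<mu> (fun_measure (?f k)) E) \<longlonglongrightarrow> l"
    then show "fun_measure y E = l"
      using y(2)[OF A_evaluation_dual, of E l] by (simp add: D_op(2)[OF bump_A \<mu>])
  qed
qed

lemma bounded_fun_measure:
  assumes "bounded_subset (A_algebra \<omega>) C" shows "bounded_subset (B_algebra \<omega>) (fun_measure ` C)"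
  unfolding bounded_subset_def
proof (intro conjI allI)
  have CA: "C \<subseteq> A" using assms by (simp add: bounded_subset_def)
  then show "fun_measure ` C \<subseteq> B" using fun_measure_B by blast
  fix n
  obtain K where K: "\<And>x. x \<in> C \<Longrightarrow> snorm (A_algebra \<omega>) n x \<le> K" using assms unfolding bounded_subset_def by blast
  have "snorm (B_algebra \<omega>) n (fun_measure x) \<le> K" if "x \<in> C" for x
    using order_trans[OF snorm_fun_measure_le[OF subsetD[OF CA that]] K[OF that]] .
  then show "\<exists>K. \<forall>x\<in>fun_measure ` C. snorm (B_algebra \<omega>) n x \<le> K" by blast
qed

lemma weakly_Montel_D_bar_imp:
  assumes \<mu>: "\<mu> \<in> B" and wM: "weakly_Montel (B_algebra \<omega>) (B_algebra \<omega>) (D_bar \<mu>)"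
  shows "abs_continuous \<mu>"
proof -
  let ?f = "\<lambda>k. fun_measure (abs_ae_fun (bump k))"
  have "relatively_compact_in (weak_topology (B_algebra \<omega>)) (D_bar \<mu> ` fun_measure ` range (\<lambda>k. abs_ae_fun (bump k)))"
    using wM bounded_fun_measure[OF bounded_bump] unfolding weakly_Montel_def by blast
  from B.weak_cluster_point[OF this, of "\<lambda>k. D_bar \<mu> (?f k)"]
  obtain y where y: "y \<in> B" "\<And>\<phi> l. \<phi> \<in> dual_space (B_algebra \<omega>) \<Longrightarrow> (\<lambda>k. \<phi> (D_bar \<mu> (?f k))) \<longlonglongrightarrow> l \<Longrightarrow> \<phi> y = l"
    by blast
  show ?thesis
    by (rule abs_continuous_of_cluster_point[OF \<mu> y(1)]) (rule y(2)[OF B_evaluation_dual])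
qed

section \<open>Absolute continuity implies compactness\<close>

lemma relatively_compact_conv:
  assumes g: "g \<in> A" and C: "bounded_subset (B_algebra \<omega>) C"
    and S: "S \<subseteq> {f \<in> A. \<exists>\<nu>\<in>C. fun_measure f = measure_conv (fun_measure g) (measure_X \<nu>)}"
  shows "relatively_compact_in (seminorm_topology (A_algebra \<omega>)) S"
  by (rule A.relatively_compact_seminormI[OF A_complete])
    (use S A.precompact_in_subset[OF A_precompact_conv[OF g C] S] in auto)

lemma Montel_D_op:
  assumes \<mu>: "\<mu> \<in> B" and ac: "abs_continuous \<mu>"
  shows "Montel (A_algebra \<omega>) (A_algebra \<omega>) (D_op \<omega> \<mu>)"
  unfolding Montel_def
proof (intro conjI allI impI)
  show "linear_operator (A_algebra \<omega>) (A_algebra \<omega>) (D_op \<omega> \<mu>)"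
    using derivation_D_op[OF \<mu>] by (simp add: derivation_def)
  obtain g where g: "g \<in> A" "fun_measure g = \<mu>" using abs_continuous_density[OF \<mu> ac] by blast
  fix C assume C: "bounded_subset (A_algebra \<omega>) C"
  then have CA: "C \<subseteq> A" by (simp add: bounded_subset_def)
  show "relatively_compact_in (seminorm_topology (A_algebra \<omega>)) (D_op \<omega> \<mu> ` C)"
  proof (rule relatively_compact_conv[OF g(1) bounded_fun_measure[OF C]], safe)
    fix f assume "f \<in> C"
    then have f: "f \<in> A" using CA by blast
    show "D_op \<omega> \<mu> f \<in> A" by (rule D_op(1)[OF f \<mu>])
    have "fun_measure (D_op \<omega> \<mu> f) = measure_conv (fun_measure g) (measure_X (fun_measure f))"
      unfolding D_op(2)[OF f \<mu>] D_bar_def g(2)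
      by (rule measure_conv_commute[OF B_finite_variation[OF B_X[OF fun_measure_B[OF f]]] B_finite_variation[OF \<mu>]])
    then show "\<exists>\<nu>\<in>fun_measure ` C. fun_measure (D_op \<omega> \<mu> f) = measure_conv (fun_measure g) (measure_X \<nu>)"
      using \<open>f \<in> C\<close> by blast
  qed
qed

text \<open>The embedding is additive and does not increase any of the seminorms. It is used to
  transport compactness from A(\<omega>) to B(\<omega>).\<close>

lemma fun_measure_continuous:
  "continuous_map (seminorm_topology (A_algebra \<omega>)) (seminorm_topology (B_algebra \<omega>)) fun_measure"
  unfolding continuous_map_def A.topspace_seminorm B.topspace_seminorm
proof (intro conjI allI impI)
  show "fun_measure \<in> A \<rightarrow> B" using fun_measure_B by blast
  fix U assume U: "openin (seminorm_topology (B_algebra \<omega>)) U"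
  show "openin (seminorm_topology (A_algebra \<omega>)) {f \<in> A. fun_measure f \<in> U}"
    unfolding A.openin_seminorm_iff
  proof (intro conjI ballI)
    fix f assume f: "f \<in> {f \<in> A. fun_measure f \<in> U}"
    then obtain n e where e: "0 < e" "B.snball n (fun_measure f) e \<subseteq> U" using U unfolding B.openin_seminorm_iff by blast
    have "A.snball n f e \<subseteq> {f \<in> A. fun_measure f \<in> U}"
    proof
      fix y assume "y \<in> A.snball n f e"
      then have y: "y \<in> A" "snorm (A_algebra \<omega>) n (y - f) < e" by (auto simp: A.snball_def)
      have d: "y - f \<in> A" using y(1) f by (intro A.diff_mem) auto
      have "fun_measure y = fun_measure (y - f) + fun_measure f"
        using fun_measure_add[OF d, of f] f by simp
      then have "snorm (B_algebra \<omega>) n (fun_measure y - fun_measure f) < e"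
        using snorm_fun_measure_le[OF d, of n] y(2) by simp
      then have "fun_measure y \<in> B.snball n (fun_measure f) e" using fun_measure_B[OF y(1)] by (simp add: B.snball_def)
      with e(2) y(1) show "y \<in> {f \<in> A. fun_measure f \<in> U}" by blast
    qed
    with e(1) show "\<exists>n e. 0 < e \<and> A.snball n f e \<subseteq> {f \<in> A. fun_measure f \<in> U}" by blast
  qed blast
qed

lemma Hausdorff_B: "Hausdorff_space (seminorm_topology (B_algebra \<omega>))"
  unfolding Hausdorff_space_def
proof (intro allI impI)
  fix x y assume "x \<in> topspace (seminorm_topology (B_algebra \<omega>)) \<and> y \<in> topspace (seminorm_topology (B_algebra \<omega>)) \<and> x \<noteq> y"
  then obtain U V where "openin (weak_topology (B_algebra \<omega>)) U" "openin (weak_topology (B_algebra \<omega>)) V" "x \<in> U" "y \<in> V" "disjnt U V"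
    using B.Hausdorff_weak[OF B_separated] unfolding Hausdorff_space_def B.topspace_weak B.topspace_seminorm by blast
  then show "\<exists>U V. openin (seminorm_topology (B_algebra \<omega>)) U \<and> openin (seminorm_topology (B_algebra \<omega>)) V \<and> x \<in> U \<and> y \<in> V \<and> disjnt U V"
    using B.openin_weak_imp_seminorm by blast
qed

text \<open>The image of the closure is compact, hence closed in the Hausdorff space B(\<omega>), so
  it contains the closure of the image.\<close>

lemma relatively_compact_fun_measure:
  assumes "relatively_compact_in (seminorm_topology (A_algebra \<omega>)) S"
  shows "relatively_compact_in (seminorm_topology (B_algebra \<omega>)) (fun_measure ` S)"
proof -
  let ?TA = "seminorm_topology (A_algebra \<omega>)" and ?TB = "seminorm_topology (B_algebra \<omega>)"
  have S: "S \<subseteq> topspace ?TA" "compactin ?TA (?TA closure_of S)" using assms by (auto simp: relatively_compact_in_def)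
  have K: "compactin ?TB (fun_measure ` (?TA closure_of S))"
    by (rule image_compactin[OF S(2) fun_measure_continuous])
  then have "closedin ?TB (fun_measure ` (?TA closure_of S))" by (rule compactin_imp_closedin[OF Hausdorff_B])
  moreover have "fun_measure ` S \<subseteq> fun_measure ` (?TA closure_of S)" by (intro image_mono closure_of_subset S(1))
  ultimately have "compactin ?TB (?TB closure_of (fun_measure ` S))"
    by (intro closed_compactin[OF K] closure_of_minimal closedin_closure_of)
  moreover have "fun_measure ` S \<subseteq> topspace ?TB"
    using S(1) fun_measure_B unfolding A.topspace_seminorm B.topspace_seminorm by blast
  ultimately show ?thesis by (simp add: relatively_compact_in_def)
qed

text \<open>As \<mu> has a density and A(\<omega>) is an ideal, \<open>D_bar\<close> maps all of
  B(\<omega>) into the embedded copy of A(\<omega>). The image of a bounded set is the embedding of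
  a set already known to be relatively compact there.\<close>

lemma Montel_D_bar:
  assumes \<mu>: "\<mu> \<in> B" and ac: "abs_continuous \<mu>"
  shows "Montel (B_algebra \<omega>) (B_algebra \<omega>) (D_bar \<mu>)"
  unfolding Montel_def
proof (intro conjI allI impI)
  show "linear_operator (B_algebra \<omega>) (B_algebra \<omega>) (D_bar \<mu>)" by (rule linear_operator_D_bar[OF \<mu>])
  obtain g where g: "g \<in> A" "fun_measure g = \<mu>" using abs_continuous_density[OF \<mu> ac] by blast
  fix C assume C: "bounded_subset (B_algebra \<omega>) C"
  then have CB: "C \<subseteq> B" by (simp add: bounded_subset_def)
  let ?S = "{f \<in> A. \<exists>\<nu>\<in>C. fun_measure f = measure_conv (fun_measure g) (measure_X \<nu>)}"
  have D: "D_bar \<mu> \<nu> = measure_conv (fun_measure g) (measure_X \<nu>)" if "\<nu> \<in> C" for \<nu>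
    unfolding D_bar_def g(2)
    by (rule measure_conv_commute[OF B_finite_variation[OF B_X[OF subsetD[OF CB that]]] B_finite_variation[OF \<mu>]])
  have "D_bar \<mu> ` C = fun_measure ` ?S"
  proof safe
    fix \<nu> assume \<nu>: "\<nu> \<in> C"
    obtain f where "f \<in> A" "fun_measure f = measure_conv (fun_measure g) (measure_X \<nu>)"
      using A_ideal[OF g(1) B_X[OF subsetD[OF CB \<nu>]]] by blast
    with \<nu> D[OF \<nu>] show "D_bar \<mu> \<nu> \<in> fun_measure ` ?S" by (intro image_eqI[of _ _ f]) auto
  next
    fix f \<nu> assume "\<nu> \<in> C" "fun_measure f = measure_conv (fun_measure g) (measure_X \<nu>)"
    with D show "fun_measure f \<in> D_bar \<mu> ` C" by (intro image_eqI[of _ _ \<nu>]) auto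
  qed
  moreover have "relatively_compact_in (seminorm_topology (A_algebra \<omega>)) ?S"
    by (rule relatively_compact_conv[OF g(1) C order_refl])
  ultimately show "relatively_compact_in (seminorm_topology (B_algebra \<omega>)) (D_bar \<mu> ` C)"
    using relatively_compact_fun_measure by simp
qed

end

theorem theorem4p4:
  fixes \<omega> :: "nat \<Rightarrow> real \<Rightarrow> real" and \<mu> :: "real set \<Rightarrow> complex"
  assumes weights: "\<And>n. algebra_weight (\<omega> n)"
    and increasing: "\<And>n t. 0 \<le> t \<Longrightarrow> \<omega> n t \<le> \<omega> (Suc n) t"
    and tends_infinity: "\<And>n. filterlim (\<omega> n) at_top at_top"
    and growth: "\<And>n. ((\<lambda>t. \<omega> n t powr (1 / t)) \<longlongrightarrow> 1) at_top"
    and ratio_unbounded: "\<And>n. \<not> bdd_above ((\<lambda>t. \<omega> (Suc n) t / \<omega> n t) ` {0..})"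
    and ratio_limit: "\<And>n. \<exists>m. ((\<lambda>t. t * \<omega> n t / \<omega> m t) \<longlongrightarrow> 0) at_top"
    and mu: "\<mu> \<in> space_of (B_algebra \<omega>)"
  shows "(Montel_derivation (A_algebra \<omega>) (D_op \<omega> \<mu>) \<longleftrightarrow>
            weakly_Montel_derivation (A_algebra \<omega>) (D_op \<omega> \<mu>)) \<and>
         (weakly_Montel_derivation (A_algebra \<omega>) (D_op \<omega> \<mu>) \<longleftrightarrow> abs_continuous \<mu>) \<and>
         (abs_continuous \<mu> \<longleftrightarrow> Montel_derivation (B_algebra \<omega>) (D_bar \<mu>)) \<and>
         (Montel_derivation (B_algebra \<omega>) (D_bar \<mu>) \<longleftrightarrow>
            weakly_Montel_derivation (B_algebra \<omega>) (D_bar \<mu>))"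
proof -
  interpret weight_sequence \<omega>
    by unfold_locales (rule weights, erule increasing, rule tends_infinity, rule ratio_limit)
  note ders = derivation_D_op[OF mu] derivation_D_bar[OF mu]
  \<comment> \<open>Two cycles of implications share condition (c): from (c) to (a) to (b) and back,
    and from (c) to (d) to (e) and back.\<close>
  have ab: "Montel_derivation (A_algebra \<omega>) (D_op \<omega> \<mu>)" if "abs_continuous \<mu>"
    using ders Montel_D_op[OF mu that] by (simp add: Montel_derivation_def)
  have aw: "weakly_Montel_derivation (A_algebra \<omega>) (D_op \<omega> \<mu>)" if "Montel_derivation (A_algebra \<omega>) (D_op \<omega> \<mu>)"
    using that A.Montel_imp_weakly_Montel[OF A_separated, of "A_algebra \<omega>" "D_op \<omega> \<mu>"] by (simp add: Montel_derivation_def weakly_Montel_derivation_def)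
  have wc: "abs_continuous \<mu>" if "weakly_Montel_derivation (A_algebra \<omega>) (D_op \<omega> \<mu>)"
    using that weakly_Montel_D_op_imp[OF mu] by (simp add: weakly_Montel_derivation_def)
  have bb: "Montel_derivation (B_algebra \<omega>) (D_bar \<mu>)" if "abs_continuous \<mu>"
    using ders Montel_D_bar[OF mu that] by (simp add: Montel_derivation_def)
  have bw: "weakly_Montel_derivation (B_algebra \<omega>) (D_bar \<mu>)" if "Montel_derivation (B_algebra \<omega>) (D_bar \<mu>)"
    using that B.Montel_imp_weakly_Montel[OF B_separated, of "B_algebra \<omega>" "D_bar \<mu>"] by (simp add: Montel_derivation_def weakly_Montel_derivation_def)
  have bc: "abs_continuous \<mu>" if "weakly_Montel_derivation (B_algebra \<omega>) (D_bar \<mu>)"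
    using that weakly_Montel_D_bar_imp[OF mu] by (simp add: weakly_Montel_derivation_def)
  show ?thesis using ab aw wc bb bw bc by blast
qed

end
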